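(* Let $S$ be a finite set of ideals of a commutative Noetherian ring with unit, let $k$ be a field, and let $M$ be a finitely generated $P\mathcal{G}_{0,S}^{\mathrm{op}}$-module over $k$. Then the Hilbert--Dyck series $$\mathrm{HD}_M(t)=\sum_{w\in\mathcal{D}(S)}\dim_k M(T(w))\,t^{|E_{T(w)}|}$$ is algebraic.
   Context: The set $S$ serves only as a finite set of edge-labels. Objects of $P\mathcal{G}_{0,S}$ are finite planar rooted trees with edge-labels in $S$: a finite tree $T$ with a root $v$, a map $\alpha\colon E_T\to S$, and, for each vertex $u$, a total order $\sigma_u$ on the edges directed out of $u$ (edges are directed away from the root). The orders $\sigma_u$ determine a total depth-first order $<$ on $V_T$ starting at the root (at each vertex, outgoing edges are explored in the order $\sigma_u$). A morphism $T\to T'$ in $P\mathcal{G}_{0,S}$ is a map $\varphi\colon V_T\sqcup E_T\to V_{T'}\sqcup E_{T'}$ such that: $\varphi(V_T)=V_{T'}$; $\varphi$ of the set of endpoints of an edge $e$ is the set of endpoints of $\varphi(e)$ (a vertex being regarded as its own boundary, and endpoints with equal image being identified with that vertex); $\varphi$ restricts to a bijection $\varphi^{-1}(E_{T'})\to E_{T'}$ preserving labels; for each vertex $x$ of $T'$, $\varphi^{-1}(x)$ is a subtree of $T$; the root maps to the root; and $\varphi$ respects the depth-first orders, in the sense that if $x<y$ in $V_{T'}$ then the $<$-smallest vertex of $\varphi^{-1}(x)$ is less than the $<$-smallest vertex of $\varphi^{-1}(y)$ in $V_T$. A $P\mathcal{G}_{0,S}^{\mathrm{op}}$-module over $k$ is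 a covariant functor $M$ from $P\mathcal{G}_{0,S}^{\mathrm{op}}$ to finite-dimensional $k$-vector spaces. It is finitely generated if there is a finite list of objects $T_i$ such that for every object $T$, $M(T)$ is spanned by the images of the $M(T_i)$ under the maps induced by morphisms $T\to T_i$ of $P\mathcal{G}_{0,S}$. The Dyck language $\mathcal{D}(S)$ is the set of words (including the empty word) in the alphabet $\{(_\alpha,\,)_\alpha\mid\alpha\in S\}$ that are properly nested sequences of parentheses, each left parenthesis being closed by a right parenthesis with the same label. For $w\in\mathcal{D}(S)$ the tree $T(w)$ is defined recursively: the empty word gives the one-vertex tree; if $w=(_{\alpha_1}w_1)_{\alpha_1}\cdots(_{\alpha_n}w_n)_{\alpha_n}$ with $w_i\in\mathcal{D}(S)$, then $T(w)$ has $n$ edges out of its root, labeled $\alpha_1,\dots,\alpha_n$ from left to right, the $i$-th one attached to the root of $T(w_i)$. This is a bijection between $\mathcal{D}(S)$ and (isomorphism classes of) planar rooted trees with edge-labels in $S$; $|E_{T(w)}|$ is half the length of $w$. A formal power series $F(t)$ is algebraic if there is a nonzero polynomial $P(x,t)$ with rational coefficients such that $P(F(t),t)=0$. *)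

theory Defs
  imports
    "HOL-Algebra.Ring_Divisibility"
    "HOL-Computational_Algebra.Polynomial_FPS"
    "Graph_Theory.Arc_Walk"
    "Jordan_Normal_Form.Missing_VectorSpace"
begin

section \<open>Planar rooted trees with labelled edges\<close>

text \<open>
  The predicate \<open>tree\<close> of \<open>Graph_Theory.Digraph_Component\<close> excludes only directed cycles, so on
  graphs whose arcs point away from a root it does not describe trees.  A rooted tree with all arcs
  directed away from the root is a digraph in which every vertex is reached from the root by
  exactly one directed walk.
\<close>

definition out_tree :: "('v, 'e) pre_digraph \<Rightarrow> 'v \<Rightarrow> bool" where
  "out_tree G r \<longleftrightarrow> fin_digraph G \<and> r \<in> verts G \<and>
     (\<forall>v \<in> verts G. \<exists>!p. pre_digraph.awalk G r p v)"

record ('v, 'e, 's) planar_tree =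
  pt_graph :: "('v, 'e) pre_digraph"
  pt_root  :: 'v
  pt_label :: "'e \<Rightarrow> 's"
  pt_order :: "'v \<Rightarrow> 'e rel"

definition planar_tree :: "'s set \<Rightarrow> ('v, 'e, 's) planar_tree \<Rightarrow> bool" where
  "planar_tree S T \<longleftrightarrow>
     out_tree (pt_graph T) (pt_root T) \<and>
     pt_label T \<in> arcs (pt_graph T) \<rightarrow> S \<and>
     (\<forall>u \<in> verts (pt_graph T). linear_order_on (out_arcs (pt_graph T) u) (pt_order T u))"

text \<open>
  In the depth-first order a vertex precedes its proper descendants, and the vertices lying beyond
  an edge precede those beyond any later edge out of the same vertex.
\<close>

definition df_less :: "('v, 'e, 's) planar_tree \<Rightarrow> 'v \<Rightarrow> 'v \<Rightarrow> bool" where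
  "df_less T u v \<longleftrightarrow> u \<rightarrow>\<^sup>+\<^bsub>pt_graph T\<^esub> v \<or>
     (\<exists>e \<in> arcs (pt_graph T). \<exists>f \<in> arcs (pt_graph T).
        tail (pt_graph T) e = tail (pt_graph T) f \<and> e \<noteq> f \<and>
        (e, f) \<in> pt_order T (tail (pt_graph T) e) \<and>
        head (pt_graph T) e \<rightarrow>\<^sup>*\<^bsub>pt_graph T\<^esub> u \<and> head (pt_graph T) f \<rightarrow>\<^sup>*\<^bsub>pt_graph T\<^esub> v)"

definition df_first :: "('v, 'e, 's) planar_tree \<Rightarrow> 'v set \<Rightarrow> 'v" where
  "df_first T U = (THE u. u \<in> U \<and> (\<forall>v \<in> U. v \<noteq> u \<longrightarrow> df_less T u v))"

definition elems :: "('v, 'e, 's) planar_tree \<Rightarrow> ('v + 'e) set" where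
  "elems T = verts (pt_graph T) <+> arcs (pt_graph T)"

fun endpoints :: "('v, 'e, 's) planar_tree \<Rightarrow> 'v + 'e \<Rightarrow> 'v set" where
  "endpoints T (Inl v) = {v}"
| "endpoints T (Inr e) = {tail (pt_graph T) e, head (pt_graph T) e}"

text \<open>
  The incidence maps are inherited from the ambient tree, so \<open>wf_digraph\<close> (a part of
  \<open>fin_digraph\<close>) says that the set contains the endpoints of its edges.
\<close>

definition subtree :: "('v, 'e, 's) planar_tree \<Rightarrow> ('v + 'e) set \<Rightarrow> bool" where
  "subtree T X \<longleftrightarrow> X \<subseteq> elems T \<and>
     (\<exists>r. out_tree \<lparr>verts = Inl -` X, arcs = Inr -` X,
                    tail = tail (pt_graph T), head = head (pt_graph T)\<rparr> r)"

section \<open>The category of planar rooted trees\<close>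

definition fibre :: "('v, 'e, 's) planar_tree \<Rightarrow> ('v + 'e \<Rightarrow> 'v + 'e) \<Rightarrow> 'v \<Rightarrow> ('v + 'e) set" where
  "fibre T \<phi> x = {z \<in> elems T. \<phi> z = Inl x}"

text \<open>
  Maps are extensional (\<open>undefined\<close> outside the source), so that equality of functions is equality
  of morphisms.
\<close>

definition pt_hom :: "('v, 'e, 's) planar_tree \<Rightarrow> ('v, 'e, 's) planar_tree
    \<Rightarrow> ('v + 'e \<Rightarrow> 'v + 'e) set" where
  "pt_hom T T' = {\<phi> \<in> elems T \<rightarrow>\<^sub>E elems T'.
     \<phi> ` Inl ` verts (pt_graph T) = Inl ` verts (pt_graph T') \<and>
     (\<forall>e \<in> arcs (pt_graph T). \<phi> ` Inl ` endpoints T (Inr e) = Inl ` endpoints T' (\<phi> (Inr e))) \<and>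
     bij_betw \<phi> {z \<in> elems T. \<phi> z \<in> Inr ` arcs (pt_graph T')} (Inr ` arcs (pt_graph T')) \<and>
     (\<forall>e \<in> arcs (pt_graph T). \<forall>e'. \<phi> (Inr e) = Inr e' \<longrightarrow> pt_label T' e' = pt_label T e) \<and>
     (\<forall>x \<in> verts (pt_graph T'). subtree T (fibre T \<phi> x)) \<and>
     \<phi> (Inl (pt_root T)) = Inl (pt_root T') \<and>
     (\<forall>x \<in> verts (pt_graph T'). \<forall>y \<in> verts (pt_graph T'). df_less T' x y \<longrightarrow>
        df_less T (df_first T (Inl -` fibre T \<phi> x)) (df_first T (Inl -` fibre T \<phi> y)))}"

section \<open>Modules over the opposite category\<close>

text \<open>
  \<open>M\<close> gives the vector spaces and \<open>act T T' \<phi> : M T' \<rightarrow> M T\<close> the map induced by a morphism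
  \<open>\<phi> : T \<rightarrow> T'\<close>.  The objects are the trees whose vertices and edges are taken from the types
  \<open>'v\<close> and \<open>'e\<close>; when these are infinite, every finite planar rooted tree is isomorphic to one
  of them.
\<close>

locale PG_op_module =
  fixes S :: "'s set"
    and K :: "('k, 'd) ring_scheme"
    and M :: "('v, 'e, 's) planar_tree \<Rightarrow> ('k, 'm) module"
    and act :: "('v, 'e, 's) planar_tree \<Rightarrow> ('v, 'e, 's) planar_tree
      \<Rightarrow> ('v + 'e \<Rightarrow> 'v + 'e) \<Rightarrow> 'm \<Rightarrow> 'm"
  assumes vectorspace: "planar_tree S T \<Longrightarrow> vectorspace K (M T)"
    and fin_dim: "planar_tree S T \<Longrightarrow> vectorspace.fin_dim K (M T)"
    and linear: "\<lbrakk>planar_tree S T; planar_tree S T'; \<phi> \<in> pt_hom T T'\<rbrakk>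
      \<Longrightarrow> linear_map K (M T') (M T) (act T T' \<phi>)"
    and act_id: "\<lbrakk>planar_tree S T; x \<in> carrier (M T)\<rbrakk> \<Longrightarrow> act T T (restrict id (elems T)) x = x"
    and act_comp: "\<lbrakk>planar_tree S T; planar_tree S T'; planar_tree S T'';
        \<phi> \<in> pt_hom T T'; \<psi> \<in> pt_hom T' T''; x \<in> carrier (M T'')\<rbrakk>
      \<Longrightarrow> act T T'' (compose (elems T) \<psi> \<phi>) x = act T T' \<phi> (act T' T'' \<psi> x)"

definition (in PG_op_module) finitely_generated :: bool where
  "finitely_generated \<longleftrightarrow>
     (\<exists>Ts. finite Ts \<and> (\<forall>T' \<in> Ts. planar_tree S T') \<and>
        (\<forall>T. planar_tree S T \<longrightarrow>
           LinearCombinations.module.span K (M T)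
             (\<Union>T' \<in> Ts. \<Union>\<phi> \<in> pt_hom T T'. act T T' \<phi> ` carrier (M T')) = carrier (M T)))"

section \<open>Dyck words and their trees\<close>

datatype 's paren = LParen 's | RParen 's

inductive_set dyck :: "'s set \<Rightarrow> 's paren list set" for S :: "'s set" where
  Nil: "[] \<in> dyck S"
| append: "\<lbrakk>u \<in> dyck S; v \<in> dyck S\<rbrakk> \<Longrightarrow> u @ v \<in> dyck S"
| paren: "\<lbrakk>\<alpha> \<in> S; w \<in> dyck S\<rbrakk> \<Longrightarrow> LParen \<alpha> # w @ [RParen \<alpha>] \<in> dyck S"

text \<open>
  \<open>graft [(\<alpha>\<^sub>0, T\<^sub>0), (\<alpha>\<^sub>1, T\<^sub>1), \<dots>]\<close> has the new root \<open>[]\<close>; the vertices and edges of \<open>T\<^sub>i\<close> are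
  renamed by prefixing \<open>i\<close>, and the new edge to the root of \<open>T\<^sub>i\<close> is \<open>[i]\<close>.  The name \<open>[]\<close> is
  never used for an edge, so \<open>[i]\<close> is fresh.
\<close>

definition graft :: "('s \<times> (nat list, nat list, 's) planar_tree) list
    \<Rightarrow> (nat list, nat list, 's) planar_tree" where
  "graft Ts = (let G = (\<lambda>i. pt_graph (snd (Ts ! i))) in
    \<lparr>pt_graph =
       \<lparr>verts = insert [] (\<Union>i<length Ts. (#) i ` verts (G i)),
        arcs = (\<Union>i<length Ts. insert [i] ((#) i ` arcs (G i))),
        tail = (\<lambda>e. if tl e = [] then [] else hd e # tail (G (hd e)) (tl e)),
        head = (\<lambda>e. if tl e = [] then hd e # pt_root (snd (Ts ! hd e))
                    else hd e # head (G (hd e)) (tl e))\<rparr>,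
     pt_root = [],
     pt_label = (\<lambda>e. if tl e = [] then fst (Ts ! hd e)
                     else pt_label (snd (Ts ! hd e)) (tl e)),
     pt_order = (\<lambda>u. if u = [] then {([i], [j]) | i j. i \<le> j \<and> j < length Ts}
                     else map_prod ((#) (hd u)) ((#) (hd u)) ` pt_order (snd (Ts ! hd u)) (tl u))\<rparr>)"

inductive word_tree :: "'s paren list \<Rightarrow> (nat list, nat list, 's) planar_tree \<Rightarrow> bool" where
  "(\<And>\<alpha> w T. (\<alpha>, w, T) \<in> set xs \<Longrightarrow> word_tree w T)
   \<Longrightarrow> word_tree (concat (map (\<lambda>(\<alpha>, w, T). LParen \<alpha> # w @ [RParen \<alpha>]) xs))
         (graft (map (\<lambda>(\<alpha>, w, T). (\<alpha>, T)) xs))"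

definition dyck_tree :: "'s paren list \<Rightarrow> (nat list, nat list, 's) planar_tree" where
  "dyck_tree w = (THE T. word_tree w T)"

section \<open>The Hilbert--Dyck series\<close>

definition hilbert_dyck :: "'s set \<Rightarrow> ('k, 'd) ring_scheme
    \<Rightarrow> ((nat list, nat list, 's) planar_tree \<Rightarrow> ('k, 'm) module) \<Rightarrow> rat fps" where
  "hilbert_dyck S K M = Abs_fps (\<lambda>n.
     \<Sum>w \<in> {w \<in> dyck S. card (arcs (pt_graph (dyck_tree w))) = n}.
       of_nat (vectorspace.dim K (M (dyck_tree w))))"

text \<open>A polynomial in \<open>x\<close> and \<open>t\<close> is a polynomial in \<open>x\<close> with coefficients in \<open>\<rat>[t]\<close>.\<close>

definition algebraic_fps :: "rat fps \<Rightarrow> bool" where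
  "algebraic_fps F \<longleftrightarrow> (\<exists>P :: rat poly poly. P \<noteq> 0 \<and> poly (map_poly fps_of_poly P) F = 0)"

section \<open>Well-definedness of the trees of Dyck words\<close>

abbreviation enc :: "('s \<times> 's paren list \<times> (nat list, nat list, 's) planar_tree) list \<Rightarrow> 's paren list" where
 "enc xs \<equiv> concat (map (\<lambda>(\<alpha>, w, T). LParen \<alpha> # w @ [RParen \<alpha>]) xs)"
abbreviation grf :: "('s \<times> 's paren list \<times> (nat list, nat list, 's) planar_tree) list \<Rightarrow> (nat list, nat list, 's) planar_tree" where "grf xs \<equiv> graft (map (\<lambda>(\<alpha>, w, T). (\<alpha>, T)) xs)"

definition closing where "closing r \<longleftrightarrow> r = [] \<or> (\<exists>a r'. r = RParen a # r')"

lemma enc_unique: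
  assumes "\<And>\<alpha> w T w' T' r r'. \<lbrakk>(\<alpha>,w,T) \<in> set xs; word_tree w' T'; closing r; closing r'; w @ r = w' @ r'\<rbrakk> \<Longrightarrow> w = w' \<and> T = T'"
  and "\<And>\<alpha> w T. (\<alpha>,w,T) \<in> set ys \<Longrightarrow> word_tree w T"
  and "enc xs @ r = enc ys @ r'" "closing r" "closing r'"
  shows "xs = ys"
  using assms
proof (induction xs arbitrary: ys)
  case Nil
  then show ?case by (cases ys) (auto simp: closing_def)
next
  case (Cons x xs)
  obtain a w T where x: "x = (a,w,T)" by (cases x)
  obtain b w' T' ys' where ys: "ys = (b,w',T') # ys'" using Cons.prems(3,4,5)
    by (cases ys) (auto simp: x closing_def)
  have e: "a = b" "w @ (RParen a # enc xs @ r) = w' @ (RParen b # enc ys' @ r')"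
    using Cons.prems(3) by (auto simp: x ys)
  have w: "w = w' \<and> T = T'"
    by (rule Cons.prems(1)[OF _ _ _ _ e(2)]) (auto simp: x ys closing_def intro: Cons.prems(2))
  have "xs = ys'"
  proof (rule Cons.IH)
    show "enc xs @ r = enc ys' @ r'" using e w by auto
    show "word_tree w T" if "(\<alpha>, w, T) \<in> set ys'" for \<alpha> w T
      using that Cons.prems(2)[of \<alpha> w T] ys by auto
    show "w = w' \<and> T = T'" if "(\<alpha>, w, T) \<in> set xs" "word_tree w' T'" "closing r" "closing r'" "w @ r = w' @ r'" for \<alpha> w T w' T' r r'
      using Cons.prems(1)[of \<alpha> w T w' T' r r'] that by auto
  qed (use Cons.prems in auto)
  then show ?case using e w x ys by simp
qed

lemma word_tree_unique: "word_tree w T \<Longrightarrow> word_tree w' T' \<Longrightarrow> closing r \<Longrightarrow> closing r' \<Longrightarrow> w @ r = w' @ r' \<Longrightarrow> w = w' \<and> T = T'"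
proof (induct arbitrary: w' T' r r' rule: word_tree.induct)
  case (1 xs)
  from 1(3) obtain ys where y: "w' = enc ys" "T' = grf ys" "\<And>\<alpha> w T. (\<alpha>,w,T) \<in> set ys \<Longrightarrow> word_tree w T"
    by (cases rule: word_tree.cases) auto
  have "xs = ys"
  proof (rule enc_unique[where r=r and r'=r'])
    show "enc xs @ r = enc ys @ r'" using 1(6) y(1) by simp
    show "closing r" "closing r'" by (fact 1(4)) (fact 1(5))
    show "word_tree w T" if "(\<alpha>, w, T) \<in> set ys" for \<alpha> w T by (rule y(3)[OF that])
    show "w = w' \<and> T = T'" if "(\<alpha>, w, T) \<in> set xs" "word_tree w' T'" "closing r" "closing r'" "w @ r = w' @ r'" for \<alpha> w T w' T' r r'
      by (rule 1(2)[OF that])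
  qed
  then show ?case using y by simp
qed

lemma word_tree_ex: "w \<in> dyck S \<Longrightarrow> \<exists>xs. w = enc xs \<and> (\<forall>(\<alpha>,w,T) \<in> set xs. \<alpha> \<in> S \<and> w \<in> dyck S \<and> word_tree w T)"
proof (induction rule: dyck.induct)
  case Nil
  then show ?case by (auto intro: exI[of _ "[]"])
next
  case (append u v)
  then obtain xs ys where "u = enc xs" "v = enc ys" "\<forall>(\<alpha>,w,T) \<in> set xs. \<alpha> \<in> S \<and> w \<in> dyck S \<and> word_tree w T" "\<forall>(\<alpha>,w,T) \<in> set ys. \<alpha> \<in> S \<and> w \<in> dyck S \<and> word_tree w T" by blast
  then show ?case by (intro exI[of _ "xs @ ys"]) auto
next
  case (paren \<alpha> w)
  then obtain xs where x: "w = enc xs" "\<forall>(\<alpha>,w,T) \<in> set xs. \<alpha> \<in> S \<and> w \<in> dyck S \<and> word_tree w T" by blast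
  have "word_tree w (grf xs)" unfolding x by (rule word_tree.intros) (use x in auto)
  then show ?case using paren x by (intro exI[of _ "[(\<alpha>,w,grf xs)]"]) auto
qed

text \<open>The \<open>THE\<close> in \<open>dyck_tree\<close> is well defined.\<close>

theorem word_tree_ex1: assumes "w \<in> dyck S" shows "\<exists>!T. word_tree w T"
proof -
  obtain xs where x: "w = enc xs" "\<forall>(\<alpha>,w,T) \<in> set xs. \<alpha> \<in> S \<and> w \<in> dyck S \<and> word_tree w T" using word_tree_ex[OF assms] by blast
  have "word_tree w (grf xs)" unfolding x by (rule word_tree.intros) (use x in auto)
  moreover have "T = T'" if "word_tree w T" "word_tree w T'" for T T'
    using word_tree_unique[OF that, of "[]" "[]"] by (simp add: closing_def)
  ultimately show ?thesis by blast
qed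

lemma cas_graft:
  assumes i: "i < length Ts" and ne: "[] \<notin> arcs (pt_graph (snd (Ts ! i)))" and wf: "wf_digraph (pt_graph (snd (Ts ! i)))"
  shows "u \<in> verts (pt_graph (snd (Ts!i))) \<Longrightarrow> pre_digraph.cas (pt_graph (graft Ts)) (i # u) p v \<and> set p \<subseteq> arcs (pt_graph (graft Ts)) \<longleftrightarrow>
   (\<exists>q v'. p = map ((#) i) q \<and> v = i # v' \<and> pre_digraph.cas (pt_graph (snd (Ts ! i))) u q v' \<and> set q \<subseteq> arcs (pt_graph (snd (Ts ! i))))"
proof (induction p arbitrary: u)
  case Nil
  then show ?case by (auto simp: pre_digraph.cas.simps)
next
  case (Cons e p)
  let ?G = "pt_graph (snd (Ts!i))"
  let ?H = "pt_graph (graft Ts)"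
  have A: "e \<in> arcs ?H \<and> tail ?H e = i # u \<longleftrightarrow> (\<exists>f \<in> arcs ?G. e = i # f \<and> tail ?G f = u)"
    using i ne by (auto simp: graft_def Let_def)
  have B: "head ?H (i # f) = i # head ?G f" if "f \<in> arcs ?G" for f
    using that ne by (auto simp: graft_def Let_def)
  have hv: "head ?G f \<in> verts ?G" if "f \<in> arcs ?G" for f using that wf by (simp add: wf_digraph_def)
  show ?case
  proof
    assume l: "pre_digraph.cas ?H (i # u) (e # p) v \<and> set (e # p) \<subseteq> arcs ?H"
    then obtain f where f: "f \<in> arcs ?G" "e = i # f" "tail ?G f = u" using A by (auto simp: pre_digraph.cas.simps)
    have "pre_digraph.cas ?H (i # head ?G f) p v \<and> set p \<subseteq> arcs ?H" using l f B by (simp add: pre_digraph.cas.simps)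
    from Cons.IH[OF hv[OF f(1)]] this obtain q v' where "p = map ((#) i) q \<and> v = i # v' \<and> pre_digraph.cas ?G (head ?G f) q v' \<and> set q \<subseteq> arcs ?G" by auto
    then show "\<exists>q v'. e # p = map ((#) i) q \<and> v = i # v' \<and> pre_digraph.cas ?G u q v' \<and> set q \<subseteq> arcs ?G"
      using f by (intro exI[of _ "f # q"] exI[of _ v']) (auto simp: pre_digraph.cas.simps)
  next
    assume "\<exists>q v'. e # p = map ((#) i) q \<and> v = i # v' \<and> pre_digraph.cas ?G u q v' \<and> set q \<subseteq> arcs ?G"
    then obtain f q v' where f: "e = i # f" "p = map ((#) i) q" "v = i # v'" "f \<in> arcs ?G" "tail ?G f = u" "pre_digraph.cas ?G (head ?G f) q v'" "set q \<subseteq> arcs ?G"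
      by (auto simp: Cons_eq_map_conv pre_digraph.cas.simps)
    have "pre_digraph.cas ?H (i # head ?G f) p v \<and> set p \<subseteq> arcs ?H" using Cons.IH[OF hv[OF f(4)]] f by auto
    moreover have "e \<in> arcs ?H \<and> tail ?H e = i # u" using A f by auto
    ultimately show "pre_digraph.cas ?H (i # u) (e # p) v \<and> set (e # p) \<subseteq> arcs ?H"
      using B[OF f(4)] f(1) by (simp add: pre_digraph.cas.simps)
  qed
qed

lemma linear_order_on_map_prod: assumes "linear_order_on A r" "inj f" shows "linear_order_on (f ` A) (map_prod f f ` r)"
proof -
  have a: "(f x, f y) \<in> map_prod f f ` r \<longleftrightarrow> (x,y) \<in> r" for x y using assms(2) by (auto simp: inj_def)
  have r: "r \<subseteq> A \<times> A" "\<And>x. x \<in> A \<Longrightarrow> (x,x) \<in> r" "\<And>x y z. (x,y) \<in> r \<Longrightarrow> (y,z) \<in> r \<Longrightarrow> (x,z) \<in> r" "\<And>x y. (x,y) \<in> r \<Longrightarrow> (y,x) \<in> r \<Longrightarrow> x = y"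
     "\<And>x y. x \<in> A \<Longrightarrow> y \<in> A \<Longrightarrow> x \<noteq> y \<Longrightarrow> (x,y) \<in> r \<or> (y,x) \<in> r"
    using assms(1) unfolding order_on_defs refl_on_def trans_def antisym_def total_on_def by (meson)+
  have 1: "trans (map_prod f f ` r)" 
  proof (rule transI)
    fix x y z assume "(x,y) \<in> map_prod f f ` r" "(y,z) \<in> map_prod f f ` r"
    then obtain p q q' t where "(p,q) \<in> r" "(q',t) \<in> r" "x = f p" "y = f q" "y = f q'" "z = f t" by auto
    moreover from this have "q = q'" using assms(2) by (auto simp: inj_def)
    ultimately show "(x,z) \<in> map_prod f f ` r" using r(3)[of p q t] by (simp add: a)
  qed
  have 2: "antisym (map_prod f f ` r)"
  proof (rule antisymI)
    fix x y assume h: "(x,y) \<in> map_prod f f ` r" "(y,x) \<in> map_prod f f ` r"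
    then obtain p q where "(p,q) \<in> r" "x = f p" "y = f q" by auto
    with h(2) r(4)[of p q] show "x = y" by (simp add: a)
  qed
  have 3: "map_prod f f ` r \<subseteq> f ` A \<times> f ` A" using r(1) by auto
  have 4: "refl_on (f ` A) (map_prod f f ` r)" unfolding refl_on_def using r(2) by (auto simp: a simp del: map_prod_imageI)
  have 5: "total_on (f ` A) (map_prod f f ` r)" unfolding total_on_def using r(5) by (auto simp: a)
  show ?thesis using 1 2 3 4 5 by (simp add: order_on_defs)
qed

lemma planar_graft:
  assumes P: "\<And>\<alpha> T. (\<alpha>,T) \<in> set Ts \<Longrightarrow> \<alpha> \<in> S \<and> planar_tree S T \<and> pt_root T = [] \<and> [] \<notin> arcs (pt_graph T)"
  shows "planar_tree S (graft Ts) \<and> pt_root (graft Ts) = [] \<and> [] \<notin> arcs (pt_graph (graft Ts))"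
proof -
  let ?H = "pt_graph (graft Ts)"
  let ?G = "\<lambda>i. pt_graph (snd (Ts!i))"
  have Q: "fst (Ts!i) \<in> S" "planar_tree S (snd (Ts!i))" "pt_root (snd (Ts!i)) = []" "[] \<notin> arcs (?G i)" if "i < length Ts" for i
    using P[of "fst (Ts!i)" "snd (Ts!i)"] that by auto
  have O: "out_tree (?G i) []" if "i < length Ts" for i using Q[OF that] by (auto simp: planar_tree_def)
  have fd: "fin_digraph (?G i)" if "i < length Ts" for i using O[OF that] by (auto simp: out_tree_def)
  have wf: "wf_digraph (?G i)" if "i < length Ts" for i using fd[OF that] by (auto simp: fin_digraph_def)
  have wfd: "tail (?G i) e \<in> verts (?G i)" "head (?G i) e \<in> verts (?G i)" if "i < length Ts" "e \<in> arcs (?G i)" for i e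
    using wf[OF that(1)] that by (auto simp: wf_digraph_def)
  have rv: "[] \<in> verts (?G i)" if "i < length Ts" for i using O[OF that] by (auto simp: out_tree_def)
  have fin: "fin_digraph ?H"
  proof
    fix e assume e: "e \<in> arcs ?H"
    then consider i where "i < length Ts" "e = [i]" | i f where "i < length Ts" "e = i # f" "f \<in> arcs (?G i)"
      by (auto simp: graft_def Let_def)
    then show "tail ?H e \<in> verts ?H" "head ?H e \<in> verts ?H"
      by (cases; use Q rv wfd in \<open>fastforce simp: graft_def Let_def\<close>)+
  next
    show "finite (verts ?H)" "finite (arcs ?H)"
      using fd by (auto simp: graft_def Let_def fin_digraph_def fin_digraph_axioms_def)
  qed
  have step: "pre_digraph.awalk ?H [] p v \<longleftrightarrow> (p = [] \<and> v = []) \<or>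
     (\<exists>i<length Ts. \<exists>q v'. p = [i] # map ((#) i) q \<and> v = i # v' \<and> pre_digraph.awalk (?G i) [] q v')" for p v
  proof (cases p)
    case Nil then show ?thesis by (auto simp: pre_digraph.awalk_def pre_digraph.cas.simps graft_def Let_def)
  next
    case (Cons e p')
    have A: "e \<in> arcs ?H \<and> tail ?H e = [] \<longleftrightarrow> (\<exists>i<length Ts. e = [i])"
      using Q by (auto simp: graft_def Let_def)
    have B: "head ?H [i] = [i]" if "i < length Ts" for i using Q[OF that] by (simp add: graft_def Let_def)
    have C: "[] \<in> verts ?H" by (simp add: graft_def Let_def)
    have "pre_digraph.awalk ?H [] p v \<longleftrightarrow> (\<exists>i<length Ts. e = [i] \<and> pre_digraph.cas ?H [i] p' v \<and> set p' \<subseteq> arcs ?H)"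
      unfolding Cons pre_digraph.awalk_def using A B C by (auto simp: pre_digraph.cas.simps)
    moreover have "\<And>i. i < length Ts \<Longrightarrow> (pre_digraph.cas ?H [i] p' v \<and> set p' \<subseteq> arcs ?H) \<longleftrightarrow> (\<exists>q v'. p' = map ((#) i) q \<and> v = i # v' \<and> pre_digraph.cas (?G i) [] q v' \<and> set q \<subseteq> arcs (?G i))"
      by (rule cas_graft[OF _ Q(4) wf rv])
    then have "(\<exists>i<length Ts. e = [i] \<and> pre_digraph.cas ?H [i] p' v \<and> set p' \<subseteq> arcs ?H) \<longleftrightarrow> (\<exists>i<length Ts. e = [i] \<and> (\<exists>q v'. p' = map ((#) i) q \<and> v = i # v' \<and> pre_digraph.cas (?G i) [] q v' \<and> set q \<subseteq> arcs (?G i)))"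
      by (simp cong: conj_cong)
    ultimately have "pre_digraph.awalk ?H [] p v \<longleftrightarrow> (\<exists>i<length Ts. e = [i] \<and> (\<exists>q v'. p' = map ((#) i) q \<and> v = i # v' \<and> pre_digraph.cas (?G i) [] q v' \<and> set q \<subseteq> arcs (?G i)))" by simp
    then show ?thesis using rv by (auto simp: Cons pre_digraph.awalk_def)
  qed
  have ot: "out_tree ?H []"
    unfolding out_tree_def
  proof (intro conjI ballI fin)
    show "[] \<in> verts ?H" by (simp add: graft_def Let_def)
    fix v assume "v \<in> verts ?H"
    then consider "v = []" | i v' where "i < length Ts" "v = i # v'" "v' \<in> verts (?G i)"
      by (auto simp: graft_def Let_def)
    then show "\<exists>!p. pre_digraph.awalk ?H [] p v"
    proof cases
      case 1 then show ?thesis unfolding step by auto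
    next
      case 2
      then have "\<exists>!q. pre_digraph.awalk (?G i) [] q v'" using O unfolding out_tree_def by blast
      then show ?thesis unfolding step using 2 by auto
    qed
  qed
  have lab: "pt_label (graft Ts) \<in> arcs ?H \<rightarrow> S"
  proof
    fix e assume "e \<in> arcs ?H"
    then consider i where "i < length Ts" "e = [i]" | i f where "i < length Ts" "e = i # f" "f \<in> arcs (?G i)" "f \<noteq> []"
      using Q by (auto simp: graft_def Let_def)
    then show "pt_label (graft Ts) e \<in> S"
      by cases (use Q in \<open>auto simp: graft_def Let_def planar_tree_def\<close>)
  qed
  have ord: "linear_order_on (out_arcs ?H u) (pt_order (graft Ts) u)" if u: "u \<in> verts ?H" for u
  proof -
    from u consider "u = []" | i v where "i < length Ts" "u = i # v" "v \<in> verts (?G i)"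
      by (auto simp: graft_def Let_def)
    then show ?thesis
    proof cases
      case 1
      have "out_arcs ?H u = {[i] | i. i < length Ts}" using 1 Q by (auto simp: graft_def Let_def out_arcs_def)
      then show ?thesis using 1 
        by (auto simp: order_on_defs refl_on_def trans_def antisym_def total_on_def graft_def Let_def)
    next
      case 2
      have a: "out_arcs ?H u = (#) i ` out_arcs (?G i) v" using 2 Q by (auto simp: graft_def Let_def out_arcs_def)
      have b: "pt_order (graft Ts) u = map_prod ((#) i) ((#) i) ` pt_order (snd (Ts!i)) v" using 2 by (simp add: graft_def)
      have "linear_order_on (out_arcs (?G i) v) (pt_order (snd (Ts!i)) v)" using Q(2)[OF 2(1)] 2 by (auto simp: planar_tree_def)
      then show ?thesis unfolding a b by (rule linear_order_on_map_prod) (simp add: inj_def)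
    qed
  qed
  have r: "pt_root (graft Ts) = []" by (simp add: graft_def Let_def)
  have "[] \<notin> arcs ?H" by (auto simp: graft_def Let_def)
  then show ?thesis using ot lab ord r unfolding planar_tree_def by auto
qed

lemma planar_tree_word_tree: "word_tree w T \<Longrightarrow> w \<in> lists (LParen ` S \<union> RParen ` S) \<Longrightarrow>
  planar_tree S T \<and> pt_root T = [] \<and> [] \<notin> arcs (pt_graph T) \<and> length w = 2 * card (arcs (pt_graph T))"
proof (induction rule: word_tree.induct)
  case (1 xs)
  have P: "\<alpha> \<in> S \<and> planar_tree S T \<and> pt_root T = [] \<and> [] \<notin> arcs (pt_graph T) \<and> length w = 2 * card (arcs (pt_graph T))" if "(\<alpha>,w,T) \<in> set xs" for \<alpha> w T
    using 1(2)[OF that] 1(3) that by (fastforce simp: subset_iff)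
  let ?Ts = "map (\<lambda>(\<alpha>, w, T). (\<alpha>, T)) xs"
  let ?g = "\<lambda>i. arcs (pt_graph (snd (?Ts ! i)))"
  have gf: "finite (?g i)" "[] \<notin> ?g i" "length (fst (snd (xs!i))) = 2 * card (?g i)" if "i < length xs" for i
    using P[of "fst (xs!i)" "fst (snd (xs!i))" "snd (snd (xs!i))"] that by (auto simp: planar_tree_def out_tree_def fin_digraph_def fin_digraph_axioms_def split: prod.splits) 
  have pg: "planar_tree S (grf xs) \<and> pt_root (grf xs) = [] \<and> [] \<notin> arcs (pt_graph (grf xs))"
    by (rule planar_graft) (use P in auto)
  have "card (arcs (pt_graph (grf xs))) = card (\<Union>i<length xs. insert [i] ((#) i ` ?g i))"
    by (simp add: graft_def Let_def)
  also have "\<dots> = (\<Sum>i<length xs. card (insert [i] ((#) i ` ?g i)))"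
    by (rule card_UN_disjoint) (use gf in auto)
  also have "\<dots> = (\<Sum>i<length xs. Suc (card (?g i)))"
    by (intro sum.cong refl, subst card_insert_disjoint) (use gf in \<open>auto simp: card_image\<close>)
  finally have c: "2 * card (arcs (pt_graph (grf xs))) = (\<Sum>i<length xs. 2 + length (fst (snd (xs!i))))"
    using gf by (auto simp: sum_distrib_left intro!: sum.cong)
  have "length (enc xs) = (\<Sum>x\<leftarrow>xs. 2 + length (fst (snd x)))"
    by (induction xs) (auto split: prod.splits)
  also have "\<dots> = (\<Sum>i<length xs. 2 + length (fst (snd (xs!i))))"
    by (simp add: sum_list_sum_nth atLeast0LessThan)
  finally show ?case using pg c by simp
qed

lemma dyck_lists: "w \<in> dyck S \<Longrightarrow> w \<in> lists (LParen ` S \<union> RParen ` S)"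
  by (induction rule: dyck.induct) auto

theorem planar_tree_dyck_tree: assumes "w \<in> dyck S" shows "planar_tree S (dyck_tree w)" "length w = 2 * card (arcs (pt_graph (dyck_tree w)))"
  using planar_tree_word_tree[OF theI'[OF word_tree_ex1[OF assms]] dyck_lists[OF assms]] by (auto simp: dyck_tree_def)

text \<open>The sums in \<open>hilbert_dyck\<close> are finite.\<close>

theorem finite_dyck_edges: assumes "finite S" shows "finite {w \<in> dyck S. card (arcs (pt_graph (dyck_tree w))) = n}"
proof (rule finite_subset)
  show "{w \<in> dyck S. card (arcs (pt_graph (dyck_tree w))) = n} \<subseteq> {w. set w \<subseteq> LParen ` S \<union> RParen ` S \<and> length w = 2 * n}"
    using planar_tree_dyck_tree dyck_lists by fastforce
  show "finite {w. set w \<subseteq> LParen ` S \<union> RParen ` S \<and> length w = 2 * n}"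
    by (rule finite_lists_length_eq) (use assms in auto)
qed

end

theory Submission
  imports Defs "HOL-Library.Ramsey" "HOL-Library.List_Lexorder" "HOL-Library.Sublist"
begin

text \<open>
  A morphism out of the tree of a Dyck word is a deletion of matched pairs of parentheses, so the
  morphisms to a fixed tree \<open>T'\<close> are the plane forests whose nodes are decorated by their images
  in \<open>T'\<close>, and precomposition enlarges such a forest in the sense of Kruskal's embedding order.
  Choose bases of the generating spaces \<open>M T'\<close> and compare the resulting spanning vectors of \<open>M T\<close>
  by an order that is compatible with precomposition. The dimension of \<open>M T\<close> is the number of
  spanning vectors that do not lie in the span of the smaller ones, and the remaining ones are closed
  under precomposition. By Kruskal's theorem they are given by finitely many minimal forests, hence
  they are recognized by a finite tree automaton. The generating functions of the states of the
  automaton solve a system of quadratic equations, and its solution is algebraic: after a perturbation of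
  the constant terms by powers of a parameter \<open>s\<close>, there are more monomials in \<open>t\<close>, \<open>s\<close> and one unknown
  than the equations allow to be independent; divide the relation by a power of \<open>s\<close> and put \<open>s = 0\<close>.
\<close>

section \<open>Algebraicity of quadratic systems\<close>

text \<open>Why a perturbation: the equations express each constant term as a polynomial in
  \<open>t\<close> and the \<open>n\<close> unknowns. If the constant terms were indeterminates,
  they, \<open>t\<close> and one unknown would be \<open>n + 2\<close> elements of a ring generated
  by \<open>n + 1\<close>, hence related; but the relation could vanish when the constant terms take
  their values. The exponents \<open>(N + 1) ^ q\<close> are a Kronecker substitution: monomials
  with exponents up to \<open>N\<close> stay apart, and the one parameter that is left can be
  divided out. The obstacle on the side of forests is that a forest above a decorated morphism need
  not be decorated by a morphism. Two tests that a finite automaton can carry out repair this: a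
  contracted edge carries the value of its upper end, and there are as many uncontracted edges as
  \<open>T'\<close> has. By the second test every node missed by the embedding is contracted, and by
  the first its decoration is then forced. The order on the generators must be total, so that a
  basis can be chosen greedily, and strictly preserved by precomposition. Comparing two morphisms at
  the first node, in depth-first order, where they differ achieves both.\<close>

fun quad_sol :: "nat \<Rightarrow> (nat \<Rightarrow> nat \<Rightarrow> nat \<Rightarrow> nat) \<Rightarrow> (nat \<Rightarrow> 'r::comm_ring_1) \<Rightarrow> nat \<Rightarrow> nat \<Rightarrow> 'r" where
  "quad_sol n \<beta> u q 0 = u q"
| "quad_sol n \<beta> u q (Suc m) = (\<Sum>p<n. \<Sum>r<n. of_nat (\<beta> q p r) * (\<Sum>i\<le>m. quad_sol n \<beta> u p i * quad_sol n \<beta> u r (m - i)))"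

text \<open>The recursion is this system read coefficientwise: because of the factor
  \<open>fps_X\<close>, coefficient \<open>m + 1\<close> involves only coefficients up to
  \<open>m\<close>. The coefficient ring is left general because the system is solved over the
  rationals and, after the perturbation, over polynomials in \<open>s\<close>.\<close>

lemma quad_sol_fps:
  "Abs_fps (quad_sol n \<beta> u q) = fps_const (u q) + fps_X * (\<Sum>p<n. \<Sum>r<n. fps_const (of_nat (\<beta> q p r))
      * (Abs_fps (quad_sol n \<beta> u p) * Abs_fps (quad_sol n \<beta> u r)))"
proof (rule fps_ext)
  fix m
  show "fps_nth (Abs_fps (quad_sol n \<beta> u q)) m = fps_nth (fps_const (u q) + fps_X * (\<Sum>p<n. \<Sum>r<n. fps_const (of_nat (\<beta> q p r))
      * (Abs_fps (quad_sol n \<beta> u p) * Abs_fps (quad_sol n \<beta> u r)))) m"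
    by (cases m) (simp_all add: fps_sum_nth fps_mult_nth[of "Abs_fps _"] atMost_atLeast0 fps_mult_left_const_nth)
qed

section \<open>Rational spans of monomials with bounded exponents\<close>

definition rat_scale :: "rat \<Rightarrow> rat poly fps \<Rightarrow> rat poly fps" where
  "rat_scale c x = fps_const [:c:] * x"

text \<open>Series in \<open>t\<close> over polynomials in \<open>s\<close> are taken as a vector
  space over the rationals: the dimension count must produce a relation whose coefficients involve
  neither \<open>t\<close> nor \<open>s\<close>.\<close>

interpretation rat_fps: vector_space rat_scale
proof
  fix a b and x y :: "rat poly fps"
  show "rat_scale a (x + y) = rat_scale a x + rat_scale a y" by (simp add: rat_scale_def algebra_simps)
  have "fps_const [:a + b:] = fps_const [:a:] + fps_const [:b:]" by simp
  then show "rat_scale (a + b) x = rat_scale a x + rat_scale b x" by (simp only: rat_scale_def distrib_right)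
  have "fps_const [:a * b:] = fps_const [:a:] * fps_const [:b:]" by simp
  then show "rat_scale a (rat_scale b x) = rat_scale (a * b) x" by (simp only: rat_scale_def mult.assoc)
  show "rat_scale 1 x = x" by (simp add: rat_scale_def flip: one_pCons)
qed

lemma span_mult:
  assumes "x \<in> rat_fps.span A" "y \<in> rat_fps.span B" "\<And>a b. a \<in> A \<Longrightarrow> b \<in> B \<Longrightarrow> a * b \<in> rat_fps.span C"
  shows "x * y \<in> rat_fps.span C"
proof -
  have 1: "a * y \<in> rat_fps.span C" if "a \<in> A" for a
    using assms(2)
  proof (induction rule: rat_fps.span_induct_alt)
    case base then show ?case by (simp add: rat_fps.span_zero)
  next
    case (step c b z)
    have "a * (rat_scale c b + z) = rat_scale c (a * b) + a * z" by (simp add: rat_scale_def algebra_simps)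
    then show ?case using step assms(3)[OF that step(1)] by (simp add: rat_fps.span_add rat_fps.span_scale)
  qed
  show ?thesis
    using assms(1)
  proof (induction rule: rat_fps.span_induct_alt)
    case base then show ?case by (simp add: rat_fps.span_zero)
  next
    case (step c b z)
    have "(rat_scale c b + z) * y = rat_scale c (b * y) + z * y" by (simp add: rat_scale_def algebra_simps)
    then show ?case using step 1[OF step(1)] by (simp add: rat_fps.span_add rat_fps.span_scale)
  qed
qed

text \<open>Every exponent is bounded separately, not the total degree. The number of monomials in
  \<open>t\<close> and the \<open>n\<close> unknowns is then at most
  \<open>(D + 1) ^ (n + 1)\<close>, and the bounds add up under multiplication. Exponent vectors are
  extensional so that there are finitely many.\<close>

definition box_monomials :: "nat \<Rightarrow> (nat \<Rightarrow> rat poly fps) \<Rightarrow> nat \<Rightarrow> rat poly fps set" where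
  "box_monomials n X D = (\<lambda>(a, b). fps_X ^ a * (\<Prod>q<n. X q ^ b q)) ` ({..D} \<times> ({..<n} \<rightarrow>\<^sub>E {..D}))"

abbreviation "box_span n X D \<equiv> rat_fps.span (box_monomials n X D)"

lemma card_box_monomials: "finite (box_monomials n X D)" "card (box_monomials n X D) \<le> (D + 1) ^ (n + 1)"
proof -
  have f: "finite ({..D} \<times> ({..<n} \<rightarrow>\<^sub>E {..D}))" by (intro finite_cartesian_product finite_PiE) auto
  then show "finite (box_monomials n X D)" by (simp add: box_monomials_def)
  have "card (box_monomials n X D) \<le> card ({..D} \<times> ({..<n} \<rightarrow>\<^sub>E {..D}))"
    unfolding box_monomials_def by (rule card_image_le[OF f])
  then show "card (box_monomials n X D) \<le> (D + 1) ^ (n + 1)" by (simp add: card_cartesian_product card_PiE)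
qed

lemma box_monomialsI:
  assumes "a \<le> D" "\<And>q. q < n \<Longrightarrow> b q \<le> D"
  shows "fps_X ^ a * (\<Prod>q<n. X q ^ b q) \<in> box_monomials n X D"
  unfolding box_monomials_def
  by (rule image_eqI[of _ _ "(a, restrict b {..<n})"]) (use assms in \<open>auto intro!: prod.cong\<close>)

lemma box_span_mult:
  assumes "x \<in> box_span n X D" "y \<in> box_span n X D'" shows "x * y \<in> box_span n X (D + D')"
proof (rule span_mult[OF assms])
  fix x y assume "x \<in> box_monomials n X D" "y \<in> box_monomials n X D'"
  then obtain a b a' b' where x: "x = fps_X ^ a * (\<Prod>q<n. X q ^ b q)" "a \<le> D" "b \<in> {..<n} \<rightarrow>\<^sub>E {..D}"
    and y: "y = fps_X ^ a' * (\<Prod>q<n. X q ^ b' q)" "a' \<le> D'" "b' \<in> {..<n} \<rightarrow>\<^sub>E {..D'}"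
    by (auto simp: box_monomials_def)
  have "x * y = fps_X ^ (a + a') * (\<Prod>q<n. X q ^ (b q + b' q))"
    unfolding x(1) y(1) by (simp only: power_add prod.distrib mult_ac)
  also have "\<dots> \<in> box_monomials n X (D + D')"
  proof (rule box_monomialsI)
    show "a + a' \<le> D + D'" using x(2) y(2) by (rule add_mono)
    show "b q + b' q \<le> D + D'" if "q < n" for q
      using PiE_mem[OF x(3), of q] PiE_mem[OF y(3), of q] that by simp
  qed
  finally show "x * y \<in> box_span n X (D + D')" by (rule rat_fps.span_base)
qed

lemma box_span_mono:
  assumes "D \<le> D'" "x \<in> box_span n X D" shows "x \<in> box_span n X D'"
proof -
  have "box_monomials n X D \<subseteq> box_monomials n X D'"
    unfolding box_monomials_def by (intro image_mono Sigma_mono PiE_mono) (use assms(1) in auto)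
  then show ?thesis using assms(2) rat_fps.span_mono by blast
qed

lemma one_in_box_span: "1 \<in> box_span n X D"
  using rat_fps.span_base[OF box_monomialsI[of 0 D n "\<lambda>_. 0" X]] by simp

lemma fps_X_in_box_span: "fps_X \<in> box_span n X 1"
  using rat_fps.span_base[OF box_monomialsI[of 1 1 n "\<lambda>_. 0" X]] by simp

lemma var_in_box_span: assumes "q < n" shows "X q \<in> box_span n X 1"
proof -
  have "(\<Prod>p<n. X p ^ (if p = q then 1 else 0)) = (\<Prod>p<n. if p = q then X p else 1)"
    by (intro prod.cong) auto
  also have "\<dots> = X q" using assms by simp
  finally show ?thesis
    using rat_fps.span_base[OF box_monomialsI[of 0 1 n "\<lambda>p. if p = q then 1 else 0" X]] by simp
qed

lemma box_span_const_mult: "x \<in> box_span n X D \<Longrightarrow> fps_const [:c:] * x \<in> box_span n X D"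
  using rat_fps.span_scale[of x _ c] by (simp add: rat_scale_def)

lemma box_span_power: "x \<in> box_span n X D \<Longrightarrow> x ^ k \<in> box_span n X (k * D)"
  by (induction k) (auto simp: one_in_box_span intro: box_span_mult)

lemma box_span_of_nat: "x \<in> box_span n X D \<Longrightarrow> fps_const (of_nat c) * x \<in> box_span n X D"
  using box_span_const_mult[of x n X D "of_nat c"] by (simp add: of_nat_poly)

text \<open>
  The digits of \<open>\<kappa>\<close> in base \<open>N + 1\<close> express \<open>s ^ \<kappa>\<close> through the perturbations
  \<open>s ^ (N + 1) ^ q\<close>.
\<close>

lemma monom_in_box_span:
  assumes v: "\<And>q. q < n \<Longrightarrow> fps_const (monom 1 ((N + 1) ^ q)) \<in> box_span n X 3"
  shows "i \<le> n \<Longrightarrow> \<kappa> < (N + 1) ^ i \<Longrightarrow> fps_const (monom 1 \<kappa>) \<in> box_span n X (3 * i * N)"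
proof (induction i arbitrary: \<kappa>)
  case 0
  then show ?case using one_in_box_span[of n X 0] by (simp add: monom_0 flip: one_pCons)
next
  case (Suc i)
  let ?B = "(N + 1) ^ i"
  have lt: "\<kappa> div ?B \<le> N" using Suc.prems(2)
    by (metis Suc_eq_plus1 less_Suc_eq_le less_mult_imp_div_less power_Suc)
  have "monom 1 \<kappa> = monom (1::rat) (\<kappa> mod ?B) * (monom 1 ?B) ^ (\<kappa> div ?B)"
    by (simp add: mult_monom monom_power)
  then have e: "fps_const (monom (1::rat) \<kappa>) = fps_const (monom 1 (\<kappa> mod ?B)) * fps_const (monom 1 ?B) ^ (\<kappa> div ?B)"
    by (simp only: fps_const_power fps_const_mult)
  have 1: "fps_const (monom 1 (\<kappa> mod ?B)) \<in> box_span n X (3 * i * N)"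
    by (rule Suc.IH) (use Suc.prems in auto)
  have 2: "fps_const (monom 1 ?B) ^ (\<kappa> div ?B) \<in> box_span n X ((\<kappa> div ?B) * 3)"
    by (rule box_span_power[OF v]) (use Suc.prems in auto)
  show ?case unfolding e
    by (rule box_span_mono[OF _ box_span_mult[OF 1 2]]) (use lt in \<open>simp add: algebra_simps\<close>)
qed

section \<open>Setting \<open>s = 0\<close>\<close>

definition fps_eval0 :: "rat poly fps \<Rightarrow> rat fps" where
  "fps_eval0 F = Abs_fps (\<lambda>n. poly (fps_nth F n) 0)"

lemma fps_eval0_add: "fps_eval0 (F + G) = fps_eval0 F + fps_eval0 G"
  by (rule fps_ext) (simp add: fps_eval0_def)
lemma fps_eval0_mult: "fps_eval0 (F * G) = fps_eval0 F * fps_eval0 G"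
  by (rule fps_ext) (simp add: fps_eval0_def fps_mult_nth poly_sum)
lemma fps_eval0_const: "fps_eval0 (fps_const c) = fps_const (poly c 0)"
  by (rule fps_ext) (simp add: fps_eval0_def)
lemma fps_eval0_X: "fps_eval0 fps_X = fps_X"
  by (rule fps_ext) (simp add: fps_eval0_def)
lemma fps_eval0_power: "fps_eval0 (F ^ k) = fps_eval0 F ^ k"
  by (induction k) (auto simp: fps_eval0_mult fps_eval0_const[of 1, simplified])
lemma fps_eval0_sum: "fps_eval0 (sum f A) = (\<Sum>a\<in>A. fps_eval0 (f a))"
  by (induction A rule: infinite_finite_induct) (auto simp: fps_eval0_add fps_eval0_const[of 0, simplified])

text \<open>Evaluation at 0 is a ring homomorphism and the recursion uses ring operations only, so
  setting \<open>s = 0\<close> in the perturbed solution gives back the original one.\<close>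

lemma fps_eval0_quad_sol: "poly (quad_sol n \<beta> u q m) 0 = quad_sol n \<beta> (\<lambda>q. poly (u q) 0) q m"
  by (induction n \<beta> u q m rule: quad_sol.induct) (simp_all add: poly_sum)

text \<open>The family is indexed because different products of \<open>t\<close>, \<open>s\<close>
  and the unknown might be equal as series. Two equal members give the relation
  \<open>1, - 1\<close> at once; otherwise the image is a dependent set.\<close>

lemma (in vector_space) family_dependent:
  assumes "finite J" "finite B" "card B < card J" "f ` J \<subseteq> span B"
  shows "\<exists>r. (\<exists>j\<in>J. r j \<noteq> 0) \<and> (\<Sum>j\<in>J. scale (r j) (f j)) = 0"
proof (cases "inj_on f J")
  case True
  have "dependent (f ` J)"
  proof (rule ccontr)
    assume "\<not> dependent (f ` J)"
    then have "card (f ` J) \<le> card B" using independent_span_bound[OF assms(2) _ assms(4)] by blast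
    then show False using card_image[OF True] assms(3) by simp
  qed
  then obtain c where c: "\<exists>v\<in>f ` J. c v \<noteq> 0" "(\<Sum>v\<in>f ` J. scale (c v) v) = 0"
    using dependent_finite[of "f ` J"] assms(1) by auto
  then show ?thesis using True by (intro exI[of _ "c \<circ> f"]) (auto simp: sum.reindex)
next
  case False
  then obtain i j where ij: "i \<in> J" "j \<in> J" "i \<noteq> j" "f i = f j" by (auto simp: inj_on_def)
  let ?r = "(\<lambda>_. 0)(i := 1, j := - 1)"
  have "(\<Sum>k\<in>J. scale (?r k) (f k)) = (\<Sum>k\<in>{i, j}. scale (?r k) (f k))"
    by (rule sum.mono_neutral_right) (use assms(1) ij in auto)
  also have "\<dots> = 0" using ij by simp
  finally show ?thesis using ij by (intro exI[of _ ?r]) auto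
qed

lemma algebraic_fpsI:
  fixes F :: "rat fps"
  assumes "(\<Sum>a\<le>N. \<Sum>k\<le>N. fps_const (r a k) * fps_X ^ a * F ^ k) = 0" "a \<le> N" "k \<le> N" "r a k \<noteq> 0"
  shows "algebraic_fps F"
proof -
  define c where "c k = (\<Sum>a\<le>N. monom (r a k) a)" for k
  define P where "P = (\<Sum>k\<le>N. monom (c k) k)"
  let ?ev = "\<lambda>P. poly (map_poly fps_of_poly P) F"
  have add: "?ev (p + q) = ?ev p + ?ev q" for p q
  proof -
    have "map_poly fps_of_poly (p + q) = map_poly fps_of_poly p + map_poly fps_of_poly q"
      by (rule poly_eqI) (simp add: coeff_map_poly fps_of_poly_add)
    then show ?thesis by simp
  qed
  have sum: "?ev (sum f A) = (\<Sum>x\<in>A. ?ev (f x))" for f and A :: "nat set"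
    by (induction A rule: infinite_finite_induct) (simp_all add: add)
  have "?ev P = (\<Sum>k\<le>N. \<Sum>a\<le>N. fps_const (r a k) * fps_X ^ a * F ^ k)"
    unfolding P_def sum
    by (simp add: c_def map_poly_monom poly_monom fps_of_poly_sum fps_of_poly_monom sum_distrib_right)
  also have "\<dots> = 0" using assms(1) by (subst sum.swap) simp
  finally have "?ev P = 0" .
  moreover have "coeff (coeff P k) a = r a k"
    using assms(2,3) by (simp add: P_def c_def coeff_sum)
  then have "P \<noteq> 0" using assms(4) by auto
  ultimately show ?thesis unfolding algebraic_fps_def by blast
qed

text \<open>A weighted sum of the unknowns lies in the span with exponent bound 1 just as a single
  unknown does, so the relation is sought directly for the sum.\<close>

theorem algebraic_quad_sol:
  fixes e :: "nat \<Rightarrow> rat" and w :: "nat \<Rightarrow> nat"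
  shows "algebraic_fps (\<Sum>q<n. fps_const (of_nat (w q)) * Abs_fps (quad_sol n \<beta> e q))"
proof -
  \<comment> \<open>The dimension is at most \<open>((3 * n + 2) * (N + 1)) ^ (n + 1)\<close>, which
    for this \<open>N\<close> equals \<open>N * (N + 1) ^ (n + 1)\<close>, just below the number
    \<open>(N + 1) ^ (n + 2)\<close> of products considered.\<close>
  define N where "N = (3 * n + 2) ^ (n + 1)"
  define u where "u q = [:e q:] + monom 1 ((N + 1) ^ q)" for q
  define X where "X q = Abs_fps (quad_sol n \<beta> u q)" for q
  define Z where "Z = (\<Sum>q<n. fps_const (of_nat (w q)) * X q)"
  define F where "F = (\<Sum>q<n. fps_const (of_nat (w q)) * Abs_fps (quad_sol n \<beta> e q))"
  have XF: "fps_eval0 (X q) = Abs_fps (quad_sol n \<beta> e q)" for q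
  proof -
    have "poly (u q) 0 = e q" for q by (simp add: u_def poly_monom)
    then show ?thesis by (intro fps_ext) (simp add: fps_eval0_def X_def fps_eval0_quad_sol)
  qed
  have ZF: "fps_eval0 Z = F"
    by (simp add: Z_def F_def fps_eval0_sum fps_eval0_mult fps_eval0_const XF of_nat_poly)
  \<comment> \<open>Equation \<open>q\<close> is solved for its own perturbation. The bound 3 comes
    from the term \<open>fps_X\<close> times a quadratic expression.\<close>
  have v: "fps_const (monom 1 ((N + 1) ^ q)) \<in> box_span n X 3" if "q < n" for q
  proof -
    let ?B = "\<Sum>p<n. \<Sum>r<n. fps_const (of_nat (\<beta> q p r)) * (X p * X r)"
    have "X q = fps_const (u q) + fps_X * ?B" unfolding X_def by (rule quad_sol_fps)
    then have eq: "fps_const (monom 1 ((N + 1) ^ q)) = X q - fps_const [:e q:] * 1 - fps_X * ?B"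
      by (simp add: u_def flip: fps_const_add)
    have 2: "fps_const (of_nat (\<beta> q p r)) * (X p * X r) \<in> box_span n X 2" if "p < n" "r < n" for p r
      using box_span_of_nat[OF box_span_mult[OF var_in_box_span[of p n X] var_in_box_span[of r n X]]] that by (simp add: numeral_2_eq_2)
    have B: "?B \<in> box_span n X 2"
      by (intro rat_fps.span_sum 2) auto
    have "fps_X * ?B \<in> box_span n X 3"
      by (rule box_span_mono[OF _ box_span_mult[OF fps_X_in_box_span B]]) simp
    moreover have "X q \<in> box_span n X 3" by (rule box_span_mono[OF _ var_in_box_span[OF that]]) simp
    moreover have "fps_const [:e q:] * 1 \<in> box_span n X 3" by (rule box_span_const_mult[OF one_in_box_span])
    ultimately show ?thesis unfolding eq by (intro rat_fps.span_diff)
  qed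
  define K where "K = (N + 1) ^ n"
  \<comment> \<open>The middle index runs over all \<open>n\<close>-digit numbers in base
    \<open>N + 1\<close>, so the powers of \<open>s\<close> contribute as much to the count as
    \<open>n\<close> independent variables.\<close>
  define J where "J = {..N} \<times> {..<K} \<times> {..N}"
  define f where "f = (\<lambda>(a, \<kappa>, k). fps_X ^ a * (fps_const (monom 1 \<kappa>) * Z ^ k))"
  \<comment> \<open>The three summands bound the exponents caused by \<open>fps_X ^ a\<close>, by
    the power of \<open>s\<close> with its \<open>n\<close> digits, and by
    \<open>Z ^ k\<close>.\<close>
  define D where "D = N + (3 * n * N + N)"
  have Zs: "Z \<in> box_span n X 1"
    unfolding Z_def by (intro rat_fps.span_sum box_span_of_nat var_in_box_span) auto
  have fJ: "f ` J \<subseteq> box_span n X D"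
  proof clarify
    fix a \<kappa> k assume "(a, \<kappa>, k) \<in> J"
    then have j: "a \<le> N" "\<kappa> < (N + 1) ^ n" "k \<le> N" by (auto simp: J_def K_def)
    have sZ: "fps_const (monom 1 \<kappa>) * Z ^ k \<in> box_span n X (3 * n * N + k * 1)"
      by (rule box_span_mult[OF monom_in_box_span[OF v order.refl j(2)] box_span_power[OF Zs]])
    show "f (a, \<kappa>, k) \<in> box_span n X D"
      unfolding f_def prod.case
      by (rule box_span_mono[OF _ box_span_mult[OF box_span_power[OF fps_X_in_box_span] sZ]])
        (use j in \<open>simp add: D_def\<close>)
  qed
  have "(D + 1) ^ (n + 1) \<le> ((3 * n + 2) * (N + 1)) ^ (n + 1)"
    by (rule power_mono) (simp_all add: D_def algebra_simps)
  also have "\<dots> = N * (N + 1) ^ (n + 1)" by (simp only: power_mult_distrib N_def[symmetric])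
  also have "\<dots> < (N + 1) * (N + 1) ^ (n + 1)" by (rule mult_strict_right_mono) simp_all
  also have "\<dots> = card J" by (simp add: J_def K_def)
  finally have "card (box_monomials n X D) < card J" by (rule le_less_trans[OF card_box_monomials(2)])
  from rat_fps.family_dependent[OF _ card_box_monomials(1) this fJ]
  obtain r where r: "\<exists>j\<in>J. r j \<noteq> 0" "(\<Sum>j\<in>J. rat_scale (r j) (f j)) = 0"
    by (auto simp: J_def)
  \<comment> \<open>The least power of \<open>s\<close> with a nonzero coefficient. Once it is
    divided out, setting \<open>s = 0\<close> keeps exactly the terms with this power, and one of
    them is nonzero.\<close>
  define m where "m = (LEAST \<kappa>. \<exists>a k. (a, \<kappa>, k) \<in> J \<and> r (a, \<kappa>, k) \<noteq> 0)"
  have ex: "\<exists>\<kappa>. \<exists>a k. (a, \<kappa>, k) \<in> J \<and> r (a, \<kappa>, k) \<noteq> 0" using r(1) by auto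
  obtain a0 k0 where ak: "(a0, m, k0) \<in> J" "r (a0, m, k0) \<noteq> 0" using LeastI_ex[OF ex] unfolding m_def by blast
  have small: "r (a, \<kappa>, k) = 0" if "(a, \<kappa>, k) \<in> J" "\<kappa> < m" for a \<kappa> k
    using not_less_Least[of \<kappa> "\<lambda>\<kappa>. \<exists>a k. (a, \<kappa>, k) \<in> J \<and> r (a, \<kappa>, k) \<noteq> 0"] that unfolding m_def by blast
  define g where "g = (\<lambda>(a, \<kappa>, k). rat_scale (r (a, \<kappa>, k)) (fps_X ^ a * (fps_const (monom 1 (\<kappa> - m)) * Z ^ k)))"
  have fg: "rat_scale (r j) (f j) = fps_const (monom 1 m) * g j" if "j \<in> J" for j
  proof -
    obtain a \<kappa> k where j: "j = (a, \<kappa>, k)" by (cases j)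
    show ?thesis
    proof (cases "\<kappa> < m")
      case True then show ?thesis using small[of a \<kappa> k] that by (simp add: j g_def)
    next
      case False
      then have "monom (1::rat) \<kappa> = monom 1 m * monom 1 (\<kappa> - m)" by (simp add: mult_monom)
      then have "fps_const (monom (1::rat) \<kappa>) = fps_const (monom 1 m) * fps_const (monom 1 (\<kappa> - m))"
        by (simp only: fps_const_mult)
      then show ?thesis by (simp add: j g_def f_def rat_scale_def mult_ac)
    qed
  qed
  have "fps_const (monom 1 m) * (\<Sum>j\<in>J. g j) = 0"
    using r(2) by (simp add: fg sum_distrib_left)
  \<comment> \<open>Cancellation of \<open>s ^ m\<close>: the ring has no zero divisors.\<close>
  then have "(\<Sum>j\<in>J. g j) = 0" by simp
  then have "(\<Sum>j\<in>J. fps_eval0 (g j)) = 0"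
    by (metis fps_eval0_sum fps_eval0_const fps_const_0_eq_0 poly_0)
  moreover have "fps_eval0 (g (a, \<kappa>, k)) = (if \<kappa> = m then fps_const (r (a, m, k)) * fps_X ^ a * F ^ k else 0)"
    if "(a, \<kappa>, k) \<in> J" for a \<kappa> k
    using small[OF that]
    by (auto simp: g_def rat_scale_def fps_eval0_mult fps_eval0_const fps_eval0_power fps_eval0_X ZF poly_monom)
  ultimately have "(\<Sum>a\<le>N. \<Sum>\<kappa><K. \<Sum>k\<le>N. if \<kappa> = m then fps_const (r (a, m, k)) * fps_X ^ a * F ^ k else 0) = 0"
    by (simp add: J_def sum.cartesian_product' case_prod_unfold flip: sum.cartesian_product)
  moreover have "(\<Sum>\<kappa><K. \<Sum>k\<le>N. if \<kappa> = m then fps_const (r (a, m, k)) * fps_X ^ a * F ^ k else 0)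
      = (\<Sum>k\<le>N. fps_const (r (a, m, k)) * fps_X ^ a * F ^ k)" for a
    using ak by (subst sum.swap) (simp add: J_def)
  ultimately have "(\<Sum>a\<le>N. \<Sum>k\<le>N. fps_const (r (a, m, k)) * fps_X ^ a * F ^ k) = 0" by simp
  from algebraic_fpsI[where r = "\<lambda>a k. r (a, m, k)", OF this, of a0 k0] show ?thesis using ak by (simp add: F_def J_def)
qed

section \<open>Well-quasi-ordering of plane forests\<close>

text \<open>A plane forest as a binary tree: the trees on the left, then the label of the edge to
  the last root, then the forest below that root. Growing on the right leaves the positions of the
  earlier trees unchanged, in accordance with the numbering in \<open>graft\<close>.\<close>

datatype (labels: 'l) forest = EmptyF | SnocF "'l forest" 'l "'l forest"

text \<open>Homeomorphic embedding of the binary trees that code the forests. It is stricter than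
  the deletion of arbitrary nodes, since the children of a deleted node are never kept together with
  the trees to its left; in return it has a simple bottom-up recursion.\<close>

inductive embeds :: "'l forest \<Rightarrow> 'l forest \<Rightarrow> bool" where
  embeds_Empty: "embeds EmptyF f"
| embeds_Snoc: "embeds a b \<Longrightarrow> embeds c d \<Longrightarrow> embeds (SnocF a l c) (SnocF b l d)"
| embeds_left: "embeds f b \<Longrightarrow> embeds f (SnocF b l d)"
| embeds_child: "embeds f d \<Longrightarrow> embeds f (SnocF b l d)"

text \<open>Only \<open>m\<close> and its immediate parts are tested against \<open>b\<close> and
  \<open>d\<close>. This is the transition rule of the automaton that recognizes the forests above
  \<open>m\<close>.\<close>

lemma embeds_Snoc_right:
  "embeds m (SnocF b l d) \<longleftrightarrow> m = EmptyF \<or> embeds m b \<or> embeds m d \<or> (\<exists>a c. m = SnocF a l c \<and> embeds a b \<and> embeds c d)"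
  by (auto elim: embeds.cases intro: embeds.intros)

definition bad_seq :: "'l set \<Rightarrow> (nat \<Rightarrow> 'l forest) \<Rightarrow> bool" where
  "bad_seq L s \<longleftrightarrow> (\<forall>i. labels (s i) \<subseteq> L) \<and> (\<forall>i j. i < j \<longrightarrow> \<not> embeds (s i) (s j))"

text \<open>The choice of Nash-Williams: each entry has the least size among the bad sequences with
  the same earlier entries. The diagonal is again bad because badness is a condition on pairs of
  entries, and any pair lies in a common initial part.\<close>

lemma minimal_bad_seq:
  assumes "bad_seq L t"
  obtains s where "bad_seq L s"
    "\<And>n t. bad_seq L t \<Longrightarrow> \<forall>i<n. t i = s i \<Longrightarrow> size (s n) \<le> size (t n)"
proof -
  \<comment> \<open>Minimality is demanded of entry \<open>n - 1\<close> only, so \<open>P 0\<close>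
    holds for every bad sequence and the step from \<open>n\<close> fixes entry
    \<open>n\<close>.\<close>
  define P where "P n t \<longleftrightarrow> bad_seq L t \<and>
    (\<forall>m t'. n = Suc m \<longrightarrow> bad_seq L t' \<longrightarrow> (\<forall>i<m. t' i = t i) \<longrightarrow> size (t m) \<le> size (t' m))" for n t
  have step: "\<exists>t'. P (Suc n) t' \<and> (\<forall>i<n. t' i = t i)" if "P n t" for n t
  proof -
    have "bad_seq L t \<and> (\<forall>i<n. t i = t i)" using that by (simp add: P_def)
    from ex_has_least_nat[of "\<lambda>t'. bad_seq L t' \<and> (\<forall>i<n. t' i = t i)", OF this, of "\<lambda>t'. size (t' n)"]
    obtain t' where t': "bad_seq L t'" "\<forall>i<n. t' i = t i"
      and min: "\<And>t''. bad_seq L t'' \<Longrightarrow> \<forall>i<n. t'' i = t i \<Longrightarrow> size (t' n) \<le> size (t'' n)"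
      by blast
    have "size (t' n) \<le> size (t'' n)" if "bad_seq L t''" "\<forall>i<n. t'' i = t' i" for t''
      using min[of t''] that t'(2) by simp
    then show ?thesis using t' unfolding P_def by blast
  qed
  have "P 0 t" using assms by (simp add: P_def)
  with dependent_nat_choice[of P "\<lambda>n t t'. \<forall>i<n. t' i = t i"] step
  obtain T where T: "\<And>n. P n (T n)" "\<And>n i. i < n \<Longrightarrow> T (Suc n) i = T n i" by metis
  define s where "s n = T (Suc n) n" for n
  have agree: "T m i = s i" if "i < m" for m i
    using that by (induction m) (auto simp: s_def less_Suc_eq T(2))
  show thesis
  proof (rule that)
    have "\<not> embeds (s i) (s j)" if "i < j" for i j
    proof -
      have "\<not> embeds (T (Suc j) i) (T (Suc j) j)"
        using T(1)[of "Suc j"] that by (auto simp: P_def bad_seq_def)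
      then show ?thesis using that by (simp add: agree)
    qed
    moreover have "labels (s i) \<subseteq> L" for i using T(1)[of "Suc i"] by (auto simp: P_def bad_seq_def s_def)
    ultimately show "bad_seq L s" by (simp add: bad_seq_def)
    show "size (s n) \<le> size (t n)" if "bad_seq L t" "\<forall>i<n. t i = s i" for n t
      using T(1)[of "Suc n"] that agree[of _ "Suc n"] by (auto simp: P_def)
  qed
qed

text \<open>Otherwise \<open>s\<close> before the first index of \<open>H\<close>, continued by
  \<open>a\<close> along \<open>H\<close>, would be bad and smaller at that index. An old entry
  embeds in no new one, because an embedding into a piece is an embedding into the whole.
  \<open>H\<close> is arbitrary so that the lemma can also be used inside a homogeneous set.\<close>

lemma minimal_bad_seq_subtrees:
  assumes s: "bad_seq L s" and min: "\<And>n t. bad_seq L t \<Longrightarrow> \<forall>i<n. t i = s i \<Longrightarrow> size (s n) \<le> size (t n)"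
    and H: "infinite H" and sub: "\<And>n. labels (a n) \<subseteq> labels (s n)" "\<And>n. size (a n) < size (s n)"
      "\<And>n f. embeds f (a n) \<Longrightarrow> embeds f (s n)"
  shows "\<exists>i\<in>H. \<exists>j\<in>H. i < j \<and> embeds (a i) (a j)"
proof (rule ccontr)
  assume no: "\<not> ?thesis"
  define h where "h = enumerate H"
  have hH: "h k \<in> H" for k using H by (simp add: h_def enumerate_in_set)
  have mono: "strict_mono h" using H by (simp add: h_def strict_mono_enumerate)
  have h0: "h 0 \<le> h k" for k using mono by (simp add: strict_mono_less_eq)
  define t where "t n = (if n < h 0 then s n else a (h (n - h 0)))" for n
  have "\<not> embeds (t i) (t j)" if "i < j" for i j
  proof (cases "j < h 0")
    case True then show ?thesis using s that by (simp add: t_def bad_seq_def)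
  next
    case j: False
    show ?thesis
    proof (cases "i < h 0")
      case True
      then have "i < h (j - h 0)" using h0[of "j - h 0"] by simp
      then have "\<not> embeds (s i) (s (h (j - h 0)))" using s by (simp add: bad_seq_def)
      then show ?thesis using sub(3) True j by (auto simp: t_def)
    next
      case False
      then have "h (i - h 0) < h (j - h 0)" using that mono by (simp add: strict_mono_less)
      then show ?thesis using no hH False j by (simp add: t_def)
    qed
  qed
  then have "bad_seq L t" using s sub(1) by (fastforce simp: bad_seq_def t_def)
  from min[OF this, of "h 0"] sub(2)[of "h 0"] show False by (simp add: t_def)
qed

text \<open>The labels are made constant by the pigeonhole principle, and Ramsey's theorem gives an
  infinite set in which either all left parts embed in later ones or none do. Minimality excludes
  the second case; a good pair of lower parts inside this set is then good in both
  components.\<close>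

theorem embeds_wqo:
  fixes s :: "nat \<Rightarrow> 'l forest"
  assumes L: "finite L" "\<And>i. labels (s i) \<subseteq> L"
  shows "\<exists>i j. i < j \<and> embeds (s i) (s j)"
proof (rule ccontr)
  assume "\<not> ?thesis"
  then have "bad_seq L s" using L(2) by (simp add: bad_seq_def)
  then obtain s :: "nat \<Rightarrow> 'l forest" where s: "bad_seq L s"
    and min: "\<And>n t. bad_seq L t \<Longrightarrow> \<forall>i<n. t i = s i \<Longrightarrow> size (s n) \<le> size (t n)"
    by (rule minimal_bad_seq) blast
  have "\<exists>a l c. s n = SnocF a l c" for n
  proof (cases "s n")
    case EmptyF
    then show ?thesis using s embeds_Empty by (metis bad_seq_def lessI)
  qed auto
  then obtain a l c where alc: "\<And>n. s n = SnocF (a n) (l n) (c n)" by metis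
  have "labels (s n) \<subseteq> L" for n using s by (simp add: bad_seq_def)
  then have lL: "l n \<in> L" for n by (simp add: alc)
  \<comment> \<open>Ramsey's theorem colours unordered pairs; \<open>Min\<close> and
    \<open>Max\<close> recover which index comes first.\<close>
  define col where "col = (\<lambda>A. if embeds (a (Min A)) (a (Max A)) then (0::nat) else 1)"
  obtain l0 where "infinite {n. l n = l0}"
    using pigeonhole_infinite[of UNIV l] finite_subset[OF _ L(1), of "range l"] lL by auto
  moreover have "\<forall>x\<in>{n. l n = l0}. \<forall>y\<in>{n. l n = l0}. x \<noteq> y \<longrightarrow> col {x, y} < 2"
    by (simp add: col_def)
  ultimately obtain H t where H: "H \<subseteq> {n. l n = l0}" "infinite H" "\<forall>x\<in>H. \<forall>y\<in>H. x \<noteq> y \<longrightarrow> col {x, y} = t"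
    using Ramsey2[of "{n. l n = l0}" col 2] by blast
  obtain i j where "i \<in> H" "j \<in> H" "i < j" "embeds (a i) (a j)"
    using minimal_bad_seq_subtrees[where s = s and a = a, OF s _ H(2)] min alc
    by (force intro: embeds.intros)
  then have "t = 0" using H(3)[rule_format, of i j] by (simp add: col_def)
  then have amono: "embeds (a i) (a j)" if "i \<in> H" "j \<in> H" "i < j" for i j
    using H(3)[rule_format, of i j] that by (simp add: col_def split: if_splits)
  obtain i j where ij: "i \<in> H" "j \<in> H" "i < j" "embeds (c i) (c j)"
    using minimal_bad_seq_subtrees[where s = s and a = c, OF s _ H(2)] min alc
    by (force intro: embeds.intros)
  have "embeds (s i) (s j)" unfolding alc using ij amono H(1) by (auto intro!: embeds_Snoc simp: subset_iff)
  then show False using s ij by (simp add: bad_seq_def)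
qed

text \<open>Without a finite basis one could pick forever an element above none of those picked
  before, which would be a bad sequence.\<close>

lemma embeds_finite_basis:
  assumes "finite L" "\<And>f. f \<in> X \<Longrightarrow> labels f \<subseteq> L"
  shows "\<exists>Y. finite Y \<and> Y \<subseteq> X \<and> (\<forall>f\<in>X. \<exists>g\<in>Y. embeds g f)"
proof (rule ccontr)
  assume contra: "\<not> ?thesis"
  have no: "\<exists>f\<in>X. \<forall>g\<in>Y. \<not> embeds g f" if "finite Y" "Y \<subseteq> X" for Y
  proof (rule ccontr)
    assume "\<not> (\<exists>f\<in>X. \<forall>g\<in>Y. \<not> embeds g f)"
    then have "finite Y \<and> Y \<subseteq> X \<and> (\<forall>f\<in>X. \<exists>g\<in>Y. embeds g f)" using that by simp
    with contra show False by (rule notE[OF _ exI])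
  qed
  define next_elt where "next_elt Y = (SOME f. f \<in> X \<and> (\<forall>g\<in>Y. \<not> embeds g f))" for Y
  have elt: "next_elt Y \<in> X \<and> (\<forall>g\<in>Y. \<not> embeds g (next_elt Y))" if "finite Y" "Y \<subseteq> X" for Y
    unfolding next_elt_def by (rule someI_ex) (use no[OF that] in blast)
  define Ys where "Ys = rec_nat {} (\<lambda>_ Y. insert (next_elt Y) Y)"
  have Ys: "Ys 0 = {}" "\<And>n. Ys (Suc n) = insert (next_elt (Ys n)) (Ys n)" by (simp_all add: Ys_def)
  have fin: "finite (Ys n) \<and> Ys n \<subseteq> X" for n by (induction n) (auto simp: Ys elt)
  define s where "s n = next_elt (Ys n)" for n
  have mem: "s m \<in> Ys n" if "m < n" for m n using that by (induction n) (auto simp: Ys s_def less_Suc_eq)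
  have s: "s n \<in> X" "m < n \<Longrightarrow> \<not> embeds (s m) (s n)" for m n
    using elt[of "Ys n"] fin[of n] mem[of m n] by (auto simp: s_def)
  have "labels (s n) \<subseteq> L" for n by (rule assms(2)[OF s(1)])
  from embeds_wqo[of L s, OF assms(1) this] s(2) show False by blast
qed

section \<open>Counting forests by the states of a finite automaton\<close>

definition forests :: "'l set \<Rightarrow> nat \<Rightarrow> 'l forest set" where
  "forests L n = {f. labels f \<subseteq> L \<and> size f = n}"

lemma forests_0: "forests L 0 = {EmptyF}"
proof -
  have "f = EmptyF" if "size f = 0" for f :: "'a forest" using that by (cases f) auto
  then show ?thesis by (auto simp: forests_def)
qed

lemma forests_Suc:
  "forests L (Suc n) = (\<Union>i\<le>n. (\<lambda>(a, l, c). SnocF a l c) ` (forests L i \<times> L \<times> forests L (n - i)))"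
proof (intro equalityI subsetI)
  fix f assume f: "f \<in> forests L (Suc n)"
  then obtain a l c where f': "f = SnocF a l c" by (cases f) (auto simp: forests_def)
  then have "size a \<le> n" "(a, l, c) \<in> forests L (size a) \<times> L \<times> forests L (n - size a)"
    using f by (auto simp: forests_def)
  then show "f \<in> (\<Union>i\<le>n. (\<lambda>(a, l, c). SnocF a l c) ` (forests L i \<times> L \<times> forests L (n - i)))"
    using f' by (intro UN_I[of "size a"] image_eqI[of _ _ "(a, l, c)"]) simp_all
qed (auto simp: forests_def)

lemma finite_forests: "finite L \<Longrightarrow> finite (forests L n)"
proof (induction n rule: less_induct)
  case (less n)
  then show ?case by (cases n) (auto simp: forests_0 forests_Suc)
qed

text \<open>The truth values of the predicates in \<open>P\<close> form the state of a deterministic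
  bottom-up automaton: the states of the two parts and the label determine the state of the whole.
  In this form the product of automata is a union of sets of predicates.\<close>

definition compositional :: "('l forest \<Rightarrow> bool) set \<Rightarrow> bool" where
  "compositional P \<longleftrightarrow> (\<forall>p\<in>P. \<forall>a a' l c c'. (\<forall>q\<in>P. q a = q a') \<longrightarrow> (\<forall>q\<in>P. q c = q c') \<longrightarrow>
     p (SnocF a l c) = p (SnocF a' l c'))"

lemma compositionalD:
  assumes "compositional P" "p \<in> P" "\<And>q. q \<in> P \<Longrightarrow> q a = q a'" "\<And>q. q \<in> P \<Longrightarrow> q c = q c'"
  shows "p (SnocF a l c) = p (SnocF a' l c')"
  using assms unfolding compositional_def by simp

lemma compositional_UN:
  assumes "\<And>i. i \<in> I \<Longrightarrow> compositional (P i)" shows "compositional (\<Union>i\<in>I. P i)"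
  unfolding compositional_def
proof (intro ballI allI impI)
  fix p a a' l c c'
  assume "p \<in> (\<Union>i\<in>I. P i)" and q: "\<forall>q\<in>\<Union>i\<in>I. P i. q a = q a'" "\<forall>q\<in>\<Union>i\<in>I. P i. q c = q c'"
  then obtain i where i: "i \<in> I" "p \<in> P i" by blast
  show "p (SnocF a l c) = p (SnocF a' l c')"
    by (rule compositionalD[OF assms[OF i(1)] i(2)]) (use q i(1) in auto)
qed

lemma compositional_Un:
  assumes "compositional P" "compositional Q" shows "compositional (P \<union> Q)"
proof -
  have "P \<union> Q = (\<Union>b. if b then P else Q)" by (simp add: UNIV_bool Un_commute)
  then show ?thesis using compositional_UN[of UNIV "\<lambda>b. if b then P else Q"] assms by simp
qed

primrec subforests :: "'l forest \<Rightarrow> 'l forest set" where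
  "subforests EmptyF = {EmptyF}"
| "subforests (SnocF a l c) = insert (SnocF a l c) (subforests a \<union> subforests c)"

lemma finite_subforests: "finite (subforests f)" by (induction f) auto
lemma subforests_self: "f \<in> subforests f" by (cases f) auto
lemma subforests_trans: "g \<in> subforests f \<Longrightarrow> h \<in> subforests g \<Longrightarrow> h \<in> subforests f"
  by (induction f) (auto simp: subforests_self)

text \<open>The recursion for a test against a subforest of \<open>m\<close> calls only tests
  against subforests of \<open>m\<close>.\<close>

lemma compositional_embeds: "compositional (embeds ` subforests m)"
  unfolding compositional_def
proof (intro ballI allI impI)
  fix p a a' c c' and l :: 'a
  assume p: "p \<in> embeds ` subforests m"
    and 1: "\<forall>q\<in>embeds ` subforests m. q a = q a'" and 2: "\<forall>q\<in>embeds ` subforests m. q c = q c'"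
  then obtain m' where m': "m' \<in> subforests m" "p = embeds m'" by auto
  have "b \<in> subforests m \<and> d \<in> subforests m" if "m' = SnocF b l d" for b d
    using subforests_trans[OF m'(1)] subforests_self[of b] subforests_self[of d] that by auto
  then show "p (SnocF a l c) = p (SnocF a' l c')"
    using 1 2 m' by (simp add: m'(2) embeds_Snoc_right) blast
qed

definition class_count :: "'l set \<Rightarrow> ('l forest \<Rightarrow> nat) \<Rightarrow> nat \<Rightarrow> nat \<Rightarrow> nat" where
  "class_count L \<sigma> q m = card {f \<in> forests L m. \<sigma> f = q}"

text \<open>A nonempty forest splits uniquely into a left part, a label and a lower part whose sizes
  add up to one less. Sorting by the states of the parts gives the recursion of
  \<open>quad_sol\<close>; its coefficients count the labels that effect a given transition.\<close>

lemma class_count_Suc: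
  assumes L: "finite L" and \<sigma>: "\<And>a l c. \<sigma> (SnocF a l c) = \<delta> l (\<sigma> a) (\<sigma> c)" "\<And>f. \<sigma> f < n"
  shows "class_count L \<sigma> q (Suc m) = (\<Sum>p<n. \<Sum>r<n. card {l \<in> L. \<delta> l p r = q} *
    (\<Sum>i\<le>m. class_count L \<sigma> p i * class_count L \<sigma> r (m - i)))"
proof -
  let ?C = "\<lambda>p i. {f \<in> forests L i. \<sigma> f = p}"
  let ?A = "\<lambda>(p, r, i). ?C p i \<times> {l \<in> L. \<delta> l p r = q} \<times> ?C r (m - i)"
  let ?S = "\<lambda>(a, l, c). SnocF a l c"
  let ?I = "{..<n} \<times> {..<n} \<times> {..m}"
  have inj: "inj_on ?S X" for X :: "('a forest \<times> 'a \<times> 'a forest) set" by (auto simp: inj_on_def)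
  have fin: "finite (?C p i)" for p i using finite_forests[OF L] by simp
  have eq: "{f \<in> forests L (Suc m). \<sigma> f = q} = ?S ` (\<Union>x\<in>?I. ?A x)"
    using \<sigma> by (fastforce simp: forests_Suc image_iff)
  have "class_count L \<sigma> q (Suc m) = card (\<Union>x\<in>?I. ?A x)"
    unfolding class_count_def eq by (rule card_image[OF inj])
  also have "\<dots> = (\<Sum>x\<in>?I. card (?A x))"
    by (rule card_UN_disjoint) (use fin L in \<open>auto simp: forests_def\<close>)
  also have "\<dots> = (\<Sum>(p, r, i)\<in>?I. card {l \<in> L. \<delta> l p r = q} * (class_count L \<sigma> p i * class_count L \<sigma> r (m - i)))"
    by (intro sum.cong refl) (auto simp: card_cartesian_product class_count_def)
  finally show ?thesis by (simp add: sum.cartesian_product sum_distrib_left)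
qed

section \<open>Generating functions of recognizable sets of forests\<close>

theorem algebraic_compositional_weight:
  fixes W :: "'l forest \<Rightarrow> nat"
  assumes L: "finite L" and P: "finite P" "compositional P"
    and W: "\<And>f g. (\<And>p. p \<in> P \<Longrightarrow> p f = p g) \<Longrightarrow> W f = W g"
  shows "algebraic_fps (Abs_fps (\<lambda>m. of_nat (\<Sum>f\<in>forests L m. W f)))"
proof -
  define st where "st f = {p \<in> P. p f}" for f :: "'l forest"
  \<comment> \<open>A state is the set of true predicates; the states are numbered to index the
    unknowns of the quadratic system.\<close>
  obtain b where b: "bij_betw b (Pow P) {0..<card (Pow P)}" using ex_bij_betw_finite_nat[of "Pow P"] P by auto
  define n where "n = card (Pow P)"
  define \<sigma> where "\<sigma> f = b (st f)" for f
  have stP: "st f \<in> Pow P" for f by (auto simp: st_def)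
  have less: "\<sigma> f < n" for f using bij_betwE[OF b] stP[of f] by (auto simp: \<sigma>_def n_def)
  have "st f = st g \<longleftrightarrow> (\<forall>p\<in>P. p f = p g)" for f g unfolding st_def by blast
  then have \<sigma>: "\<sigma> f = \<sigma> g \<longleftrightarrow> (\<forall>p\<in>P. p f = p g)" for f g
    using inj_on_eq_iff[OF bij_betw_imp_inj_on[OF b] stP stP] by (simp add: \<sigma>_def)
  \<comment> \<open>A forest in each state. For a state that no forest attains the choice is
    arbitrary and harmless, since its class is empty.\<close>
  define rep where "rep q = (SOME f. \<sigma> f = q)" for q
  have rep: "\<sigma> (rep (\<sigma> f)) = \<sigma> f" for f unfolding rep_def by (rule someI) simp
  define \<delta> where "\<delta> l p r = \<sigma> (SnocF (rep p) l (rep r))" for l p r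
  have comp: "\<sigma> (SnocF a l c) = \<delta> l (\<sigma> a) (\<sigma> c)" for a l c
  proof -
    have "p a = p (rep (\<sigma> a))" "p c = p (rep (\<sigma> c))" if "p \<in> P" for p
      using rep[of a] rep[of c] \<sigma>[of a "rep (\<sigma> a)"] \<sigma>[of c "rep (\<sigma> c)"] that by simp_all
    then have "\<forall>p\<in>P. p (SnocF a l c) = p (SnocF (rep (\<sigma> a)) l (rep (\<sigma> c)))"
      by (intro ballI compositionalD[OF P(2)])
    then show ?thesis unfolding \<delta>_def \<sigma> .
  qed
  define \<beta> where "\<beta> q p r = card {l \<in> L. \<delta> l p r = q}" for q p r
  define e :: "nat \<Rightarrow> rat" where "e q = (if \<sigma> EmptyF = q then 1 else 0)" for q
  have count_labels: "of_nat (class_count L \<sigma> q m) = quad_sol n \<beta> e q m" for q m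
  proof (induction m arbitrary: q rule: less_induct)
    case (less m)
    show ?case
    proof (cases m)
      case 0
      have "{f \<in> forests L 0. \<sigma> f = q} = (if \<sigma> EmptyF = q then {EmptyF} else {})"
        by (auto simp: forests_0)
      then show ?thesis by (simp add: 0 class_count_def e_def)
    next
      case (Suc k)
      have IH: "quad_sol n \<beta> e q i = of_nat (class_count L \<sigma> q i)" if "i \<le> k" for q i
        using less[of i q] Suc that by simp
      show ?thesis
        unfolding Suc class_count_Suc[where \<sigma> = \<sigma> and \<delta> = \<delta>, OF L comp \<open>\<And>f. \<sigma> f < n\<close>] quad_sol.simps
        by (simp add: IH \<beta>_def)
    qed
  qed
  have Ww: "W f = W (rep (\<sigma> f))" for f
    by (rule W) (use rep[of f] \<sigma>[of "rep (\<sigma> f)" f] in auto)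
  have "(\<Sum>f\<in>forests L m. W f) = (\<Sum>q<n. W (rep q) * class_count L \<sigma> q m)" for m
  proof -
    have "(\<Sum>f\<in>forests L m. W f) = (\<Sum>q<n. \<Sum>f\<in>{f \<in> forests L m. \<sigma> f = q}. W f)"
      by (rule sum.group[symmetric]) (use less finite_forests[OF L] in auto)
    also have "\<dots> = (\<Sum>q<n. W (rep q) * class_count L \<sigma> q m)"
    proof (rule sum.cong[OF refl])
      fix q
      have "(\<Sum>f\<in>{f \<in> forests L m. \<sigma> f = q}. W f) = (\<Sum>f\<in>{f \<in> forests L m. \<sigma> f = q}. W (rep q))"
        by (rule sum.cong[OF refl]) (use Ww in auto)
      then show "(\<Sum>f\<in>{f \<in> forests L m. \<sigma> f = q}. W f) = W (rep q) * class_count L \<sigma> q m"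
        by (simp add: class_count_def)
    qed
    finally show ?thesis .
  qed
  then have "Abs_fps (\<lambda>m. of_nat (\<Sum>f\<in>forests L m. W f)) =
      (\<Sum>q<n. fps_const (of_nat (W (rep q))) * Abs_fps (quad_sol n \<beta> e q))"
    by (intro fps_ext) (simp add: fps_sum_nth count_labels)
  then show ?thesis by (simp only: algebraic_quad_sol)
qed

section \<open>Dyck words and forests\<close>

primrec width :: "'l forest \<Rightarrow> nat" where
  "width EmptyF = 0"
| "width (SnocF a l c) = Suc (width a)"

text \<open>A node is the list of positions on the path from the root \<open>[]\<close>. Every other
  node also serves as the name of the edge that ends in it.\<close>

primrec nodes :: "'l forest \<Rightarrow> nat list set" where
  "nodes EmptyF = {[]}"
| "nodes (SnocF a l c) = nodes a \<union> (#) (width a) ` nodes c"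

text \<open>The label belongs to the edge above \<open>v\<close>. The root has none and
  \<open>hd []\<close> is unspecified, hence the condition \<open>v \<noteq> []\<close> wherever
  labels are used.\<close>

primrec node_label :: "'l forest \<Rightarrow> nat list \<Rightarrow> 'l" where
  "node_label EmptyF v = undefined"
| "node_label (SnocF a l c) v = (if hd v = width a then if tl v = [] then l else node_label c (tl v) else node_label a v)"

primrec dyck_word :: "'s forest \<Rightarrow> 's paren list" where
  "dyck_word EmptyF = []"
| "dyck_word (SnocF a l c) = dyck_word a @ LParen l # dyck_word c @ [RParen l]"

primrec kids :: "'s forest \<Rightarrow> ('s \<times> (nat list, nat list, 's) planar_tree) list" where
  "kids EmptyF = []"
| "kids (SnocF a l c) = kids a @ [(l, graft (kids c))]"

definition ftree :: "'s forest \<Rightarrow> (nat list, nat list, 's) planar_tree" where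
  "ftree f = graft (kids f)"

lemma finite_nodes: "finite (nodes f)" by (induction f) auto
lemma Nil_in_nodes [simp]: "[] \<in> nodes f" by (induction f) auto
lemma hd_less_width: "i # v \<in> nodes f \<Longrightarrow> i < width f" by (induction f) auto

lemma width_notin_nodes [simp]: "width f # v \<notin> nodes f" using hd_less_width by blast

lemma singleton_in_nodes: "[i] \<in> nodes f \<longleftrightarrow> i < width f"
  by (induction f) (auto simp: less_Suc_eq)

lemma nodes_snocD: "v @ [i] \<in> nodes f \<Longrightarrow> v \<in> nodes f"
proof (induction f arbitrary: v)
  case (SnocF a l c)
  then show ?case by (cases v) auto
qed auto

lemma nodes_butlast: "v \<in> nodes f \<Longrightarrow> butlast v \<in> nodes f"
  using nodes_snocD[of "butlast v" "last v" f] by (cases "v = []") auto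

lemma nodes_prefix: "prefix u v \<Longrightarrow> v \<in> nodes f \<Longrightarrow> u \<in> nodes f"
proof (induction v rule: rev_induct)
  case (snoc i v)
  then show ?case using nodes_snocD[of v i f] by (auto simp: prefix_snoc)
qed auto

lemma length_kids [simp]: "length (kids f) = width f" by (induction f) auto

lemma card_nodes: "card (nodes f - {[]}) = size f"
proof (induction f)
  case (SnocF a l c)
  have "nodes (SnocF a l c) - {[]} = (nodes a - {[]}) \<union> insert [width a] ((#) (width a) ` (nodes c - {[]}))"
    using Nil_in_nodes[of c] by auto
  also have "card \<dots> = card (nodes a - {[]}) + card (insert [width a] ((#) (width a) ` (nodes c - {[]})))"
    by (rule card_Un_disjoint) (auto simp: finite_nodes)
  also have "card (insert [width a] ((#) (width a) ` (nodes c - {[]}))) = Suc (card (nodes c - {[]}))"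
    by (subst card_insert_disjoint) (auto simp: finite_nodes card_image)
  finally show ?case using SnocF by simp
qed simp

text \<open>\<open>graft\<close> numbers its arguments from the left, so a new last tree leaves all
  earlier addresses alone. This adapts \<open>graft\<close> to induction along
  \<open>SnocF\<close>.\<close>

lemma graft_snoc:
  assumes "k = length Ts"
  shows "verts (pt_graph (graft (Ts @ [(l, T)]))) = verts (pt_graph (graft Ts)) \<union> (#) k ` verts (pt_graph T)"
    and "arcs (pt_graph (graft (Ts @ [(l, T)]))) = arcs (pt_graph (graft Ts)) \<union> insert [k] ((#) k ` arcs (pt_graph T))"
    and "hd e < k \<Longrightarrow> tail (pt_graph (graft (Ts @ [(l, T)]))) e = tail (pt_graph (graft Ts)) e"
    and "hd e < k \<Longrightarrow> head (pt_graph (graft (Ts @ [(l, T)]))) e = head (pt_graph (graft Ts)) e"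
    and "hd e < k \<Longrightarrow> pt_label (graft (Ts @ [(l, T)])) e = pt_label (graft Ts) e"
    and "u \<noteq> [] \<Longrightarrow> hd u < k \<Longrightarrow> pt_order (graft (Ts @ [(l, T)])) u = pt_order (graft Ts) u"
    and "hd e = k \<Longrightarrow> tail (pt_graph (graft (Ts @ [(l, T)]))) e = (if tl e = [] then [] else k # tail (pt_graph T) (tl e))"
    and "hd e = k \<Longrightarrow> head (pt_graph (graft (Ts @ [(l, T)]))) e = k # (if tl e = [] then pt_root T else head (pt_graph T) (tl e))"
    and "hd e = k \<Longrightarrow> pt_label (graft (Ts @ [(l, T)])) e = (if tl e = [] then l else pt_label T (tl e))"
    and "u \<noteq> [] \<Longrightarrow> hd u = k \<Longrightarrow> pt_order (graft (Ts @ [(l, T)])) u = map_prod ((#) k) ((#) k) ` pt_order T (tl u)"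
  by (auto simp: graft_def Let_def nth_append lessThan_Suc assms)

lemma graft_Nil: "pt_root (graft Ts) = []" "pt_order (graft Ts) [] = {([i], [j]) | i j. i \<le> j \<and> j < length Ts}"
  by (auto simp: graft_def Let_def)

lemma ftree_root [simp]: "pt_root (ftree f) = []" by (simp add: ftree_def graft_Nil)

lemma ftree_verts [simp]: "verts (pt_graph (ftree f)) = nodes f"
  unfolding ftree_def by (induction f) (simp_all add: graft_snoc[OF refl], simp add: graft_def)

lemma ftree_arcs [simp]: "arcs (pt_graph (ftree f)) = nodes f - {[]}"
  unfolding ftree_def
proof (induction f)
  case (SnocF a l c)
  then show ?case using Nil_in_nodes[of c] by (auto simp: graft_snoc[OF refl])
qed (simp add: graft_def)

lemma ftree_arc:
  "e \<in> nodes f \<Longrightarrow> e \<noteq> [] \<Longrightarrow> tail (pt_graph (ftree f)) e = butlast e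
     \<and> head (pt_graph (ftree f)) e = e \<and> pt_label (ftree f) e = node_label f e"
  unfolding ftree_def
proof (induction f arbitrary: e)
  case (SnocF a l c)
  obtain i v where e: "e = i # v" using SnocF.prems by (cases e) auto
  show ?case
  proof (cases "i = width a")
    case True
    then have "v \<in> nodes c" using SnocF.prems e by auto
    then show ?thesis using SnocF.IH(2)[of v] e True by (auto simp: graft_snoc[OF refl] graft_Nil)
  next
    case False
    then have "e \<in> nodes a" using SnocF.prems e by auto
    then show ?thesis using SnocF.IH(1)[of e] e False hd_less_width[of i v a] by (simp add: graft_snoc[OF refl])
  qed
qed auto

lemma ftree_order:
  "u \<in> nodes f \<Longrightarrow> pt_order (ftree f) u = {(u @ [i], u @ [j]) | i j. i \<le> j \<and> u @ [j] \<in> nodes f}"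
proof (cases "u = []")
  case True
  then show ?thesis by (simp add: ftree_def graft_Nil singleton_in_nodes)
next
  case False
  assume "u \<in> nodes f"
  then show ?thesis using False unfolding ftree_def
  proof (induction f arbitrary: u)
    case (SnocF a l c)
    obtain i v where u: "u = i # v" using SnocF.prems by (cases u) auto
    show ?case
    proof (cases "i = width a")
      case True
      then have v: "v \<in> nodes c" using SnocF.prems u by auto
      have "pt_order (graft (kids c)) v = {(v @ [i], v @ [j]) | i j. i \<le> j \<and> v @ [j] \<in> nodes c}"
      proof (cases "v = []")
        case True then show ?thesis by (simp add: graft_Nil singleton_in_nodes)
      qed (use SnocF.IH(2) v in auto)
      then show ?thesis using u True by (fastforce simp: graft_snoc[OF refl] image_iff)
    next
      case False
      then have "u \<in> nodes a" using SnocF.prems u by auto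
      then show ?thesis using SnocF.IH(1)[of u] u False hd_less_width[of i v a] by (auto simp: graft_snoc[OF refl])
    qed
  qed auto
qed

text \<open>The list of triples to which the rule of \<open>word_tree\<close> has to be applied in
  order to produce \<open>dyck_word f\<close> and \<open>ftree f\<close>.\<close>

primrec parsed :: "'s forest \<Rightarrow> ('s \<times> 's paren list \<times> (nat list, nat list, 's) planar_tree) list" where
  "parsed EmptyF = []"
| "parsed (SnocF a l c) = parsed a @ [(l, dyck_word c, ftree c)]"

lemma enc_parsed: "enc (parsed f) = dyck_word f" by (induction f) auto
lemma grf_parsed: "grf (parsed f) = ftree f"
proof -
  have "map (\<lambda>(\<alpha>, w, T). (\<alpha>, T)) (parsed f) = kids f" by (induction f) (auto simp: ftree_def)
  then show ?thesis by (simp add: ftree_def)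
qed

lemma word_tree_dyck_word: "word_tree (dyck_word f) (ftree f)"
proof -
  have "(\<alpha>, w, T) \<in> set (parsed f) \<Longrightarrow> word_tree w T" for \<alpha> w T
  proof (induction f arbitrary: \<alpha> w T)
    case (SnocF a l c)
    then show ?case using word_tree.intros[of "parsed c"] by (auto simp: enc_parsed grf_parsed)
  qed auto
  from word_tree.intros[of "parsed f", OF this] show ?thesis by (simp add: enc_parsed grf_parsed)
qed

lemma dyck_word_in_dyck: "labels f \<subseteq> S \<Longrightarrow> dyck_word f \<in> dyck S"
proof (induction f)
  case (SnocF a l c)
  then show ?case using dyck.append[of "dyck_word a" S, OF _ dyck.paren[of l S "dyck_word c"]] by simp
qed (simp add: dyck.Nil)

primrec append_forest :: "'s forest \<Rightarrow> 's forest \<Rightarrow> 's forest" where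
  "append_forest f EmptyF = f"
| "append_forest f (SnocF a l c) = SnocF (append_forest f a) l c"

lemma dyck_word_append: "dyck_word (append_forest f g) = dyck_word f @ dyck_word g" "labels (append_forest f g) = labels f \<union> labels g"
  by (induction g) auto

lemma dyck_imp_dyck_word: "w \<in> dyck S \<Longrightarrow> \<exists>f. labels f \<subseteq> S \<and> w = dyck_word f"
proof (induction rule: dyck.induct)
  case Nil
  show ?case by (rule exI[of _ EmptyF]) simp
next
  case (append u v)
  then show ?case by (metis dyck_word_append Un_least)
next
  case (paren \<alpha> w)
  then obtain f where "labels f \<subseteq> S" "w = dyck_word f" by blast
  then show ?case using paren by (intro exI[of _ "SnocF EmptyF \<alpha> f"]) auto
qed

text \<open>A word is parsed from the right, so the generalization carries what stands to its left.
  That part is empty or ends in an opening parenthesis, which shows where the forest begins.\<close>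

lemma dyck_word_inj_aux:
  assumes "r = [] \<or> (\<exists>l. last r = LParen l)" "r' = [] \<or> (\<exists>l. last r' = LParen l)" "r @ dyck_word f = r' @ dyck_word g"
  shows "r = r' \<and> f = g"
  using assms
proof (induction f arbitrary: r r' g)
  case EmptyF
  then show ?case by (cases g) (auto simp: last_append split: if_splits)
next
  case (SnocF a l c)
  obtain a' l' c' where g: "g = SnocF a' l' c'"
    using SnocF.prems by (cases g) (auto simp: last_append split: if_splits)
  have eq: "l = l'" "(r @ dyck_word a @ [LParen l]) @ dyck_word c = (r' @ dyck_word a' @ [LParen l']) @ dyck_word c'"
    using SnocF.prems(3) by (auto simp: g)
  have "r @ dyck_word a @ [LParen l] = r' @ dyck_word a' @ [LParen l'] \<and> c = c'"
    by (rule SnocF.IH(2)[OF _ _ eq(2)]) auto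
  then show ?case using SnocF.IH(1)[of r r' a'] SnocF.prems eq by (auto simp: g)
qed

lemma inj_dyck_word: "inj dyck_word"
  using dyck_word_inj_aux[of "[]" "[]"] by (auto simp: inj_def)

lemma dyck_tree_dyck_word: "labels f \<subseteq> S \<Longrightarrow> dyck_tree (dyck_word f) = ftree f"
  unfolding dyck_tree_def by (rule the1_equality[OF word_tree_ex1[OF dyck_word_in_dyck] word_tree_dyck_word])

lemma planar_ftree: "labels f \<subseteq> S \<Longrightarrow> planar_tree S (ftree f)"
  using planar_tree_dyck_tree(1)[OF dyck_word_in_dyck] by (metis dyck_tree_dyck_word)

lemma dyck_edges: "{w \<in> dyck S. card (arcs (pt_graph (dyck_tree w))) = n} = dyck_word ` forests S n"
proof (intro equalityI subsetI)
  fix w assume "w \<in> {w \<in> dyck S. card (arcs (pt_graph (dyck_tree w))) = n}"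
  moreover from this obtain f where "labels f \<subseteq> S" "w = dyck_word f" using dyck_imp_dyck_word by blast
  ultimately show "w \<in> dyck_word ` forests S n" by (simp add: forests_def dyck_tree_dyck_word card_nodes)
next
  fix w assume "w \<in> dyck_word ` forests S n"
  then obtain f where "labels f \<subseteq> S" "size f = n" "w = dyck_word f" by (auto simp: forests_def)
  then show "w \<in> {w \<in> dyck S. card (arcs (pt_graph (dyck_tree w))) = n}"
    by (simp add: dyck_tree_dyck_word card_nodes dyck_word_in_dyck)
qed

section \<open>The ancestor relation and the depth-first order on addresses\<close>

lemma strict_prefix_butlast: "v \<noteq> [] \<Longrightarrow> strict_prefix (butlast v) v"
  by (cases v rule: rev_cases) (auto simp: strict_prefix_def)

lemma wf_ftree: "wf_digraph (pt_graph (ftree f))"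
  using planar_ftree[of f "labels f"] by (simp add: planar_tree_def out_tree_def fin_digraph_def)

lemma arcs_ends_ftree: "arcs_ends (pt_graph (ftree f)) = {(butlast e, e) | e. e \<in> nodes f \<and> e \<noteq> []}"
  using ftree_arc[of _ f] by (force simp: arcs_ends_conv image_iff)

lemma reachable1_ftree:
  "u \<rightarrow>\<^sup>+\<^bsub>pt_graph (ftree f)\<^esub> v \<longleftrightarrow> strict_prefix u v \<and> v \<in> nodes f"
proof
  assume "u \<rightarrow>\<^sup>+\<^bsub>pt_graph (ftree f)\<^esub> v"
  then show "strict_prefix u v \<and> v \<in> nodes f"
  proof (induction rule: trancl.induct)
    case (r_into_trancl a b)
    then show ?case by (auto simp: arcs_ends_ftree strict_prefix_butlast)
  next
    case (trancl_into_trancl a b c)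
    then have "strict_prefix b c" "c \<in> nodes f" by (auto simp: arcs_ends_ftree strict_prefix_butlast)
    then show ?case using trancl_into_trancl by (auto intro: prefix_order.less_trans)
  qed
next
  assume "strict_prefix u v \<and> v \<in> nodes f"
  then show "u \<rightarrow>\<^sup>+\<^bsub>pt_graph (ftree f)\<^esub> v"
  proof (induction v rule: rev_induct)
    case (snoc i v)
    then have e: "(v, v @ [i]) \<in> arcs_ends (pt_graph (ftree f))" and v: "v \<in> nodes f"
      by (auto simp: arcs_ends_ftree dest: nodes_snocD)
    show ?case
    proof (cases "u = v")
      case False
      then have "strict_prefix u v" using snoc by (auto simp: strict_prefix_def prefix_snoc)
      then show ?thesis using snoc.IH v e by (meson trancl_into_trancl)
    qed (use e in auto)
  qed auto
qed

lemma reachable_ftree: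
  "u \<rightarrow>\<^sup>*\<^bsub>pt_graph (ftree f)\<^esub> v \<longleftrightarrow> prefix u v \<and> v \<in> nodes f"
proof -
  interpret wf_digraph "pt_graph (ftree f)" by (rule wf_ftree)
  show ?thesis
  proof (cases "u = v")
    case True
    then show ?thesis using reachable_in_verts(1)[of u v] by auto
  next
    case False
    then have "u \<rightarrow>\<^sup>*\<^bsub>pt_graph (ftree f)\<^esub> v \<longleftrightarrow> u \<rightarrow>\<^sup>+\<^bsub>pt_graph (ftree f)\<^esub> v"
      using reachable1_reachable reachable_neq_reachable1 by blast
    then show ?thesis using False by (simp add: reachable1_ftree strict_prefix_def)
  qed
qed

lemma less_list_iff:
  "(u :: nat list) < v \<longleftrightarrow> strict_prefix u v \<or> (\<exists>w i j x y. u = w @ i # x \<and> v = w @ j # y \<and> i < j)"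
  unfolding list_less_def lexord_def strict_prefix_def prefix_def
  by (auto simp: neq_Nil_conv) (metis neq_Nil_conv)+

text \<open>Depth-first order is the lexicographic order of addresses: an ancestor is a proper
  prefix, and otherwise the two addresses first differ at two edges out of a common vertex. The
  order on lists is linear, which the comparison of morphisms exploits.\<close>

lemma df_less_ftree:
  assumes "u \<in> nodes f" "v \<in> nodes f"
  shows "df_less (ftree f) u v \<longleftrightarrow> u < v"
proof
  assume "df_less (ftree f) u v"
  then have "strict_prefix u v \<or> (\<exists>e\<in>nodes f - {[]}. \<exists>g\<in>nodes f - {[]}.
      tail (pt_graph (ftree f)) e = tail (pt_graph (ftree f)) g \<and> e \<noteq> g \<and>
      (e, g) \<in> pt_order (ftree f) (tail (pt_graph (ftree f)) e) \<and>
      prefix (head (pt_graph (ftree f)) e) u \<and> prefix (head (pt_graph (ftree f)) g) v)"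
    unfolding df_less_def reachable1_ftree reachable_ftree ftree_arcs by blast
  then show "u < v"
  proof (elim disjE bexE conjE)
    fix e g
    assume e: "e \<in> nodes f - {[]}" and g: "g \<in> nodes f - {[]}" "e \<noteq> g"
      and t: "tail (pt_graph (ftree f)) e = tail (pt_graph (ftree f)) g"
      and o: "(e, g) \<in> pt_order (ftree f) (tail (pt_graph (ftree f)) e)"
      and p: "prefix (head (pt_graph (ftree f)) e) u" "prefix (head (pt_graph (ftree f)) g) v"
    have p: "prefix e u" "prefix g v" using p ftree_arc[of e f] ftree_arc[of g f] e g by simp_all
    have "(e, g) \<in> pt_order (ftree f) (butlast e)" using o ftree_arc[of e f] e by simp
    then obtain i j where ij: "e = butlast e @ [i]" "g = butlast e @ [j]" "i \<le> j"
      using ftree_order[OF nodes_butlast, of e f] e by auto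
    have "i \<noteq> j" using ij g(2) by metis
    then have "i < j" using ij(3) by simp
    moreover obtain x y where "u = e @ x" "v = g @ y" using p by (auto simp: prefix_def)
    then have "u = butlast e @ i # x" "v = butlast e @ j # y" using ij(1,2) by (metis append.assoc append_Cons append_Nil)+
    ultimately show "u < v" unfolding less_list_iff by blast
  qed (simp add: less_list_iff)
next
  assume "u < v"
  then consider "strict_prefix u v" | w i j x y where "u = w @ i # x" "v = w @ j # y" "i < j"
    unfolding less_list_iff by blast
  then show "df_less (ftree f) u v"
  proof cases
    case 1 then show ?thesis using assms by (simp add: df_less_def reachable1_ftree)
  next
    case 2
    have e: "prefix (w @ [i]) u" "prefix (w @ [j]) v" using 2 by (auto simp: prefix_def)
    then have n: "w @ [i] \<in> nodes f" "w @ [j] \<in> nodes f" using assms nodes_prefix by blast+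
    have "(w @ [i], w @ [j]) \<in> pt_order (ftree f) w" using n 2 by (subst ftree_order) (auto dest: nodes_snocD)
    then show ?thesis unfolding df_less_def using n e 2 assms
      by (intro disjI2 bexI[of _ "w @ [i]"] bexI[of _ "w @ [j]"]) (auto simp: ftree_arc reachable_ftree)
  qed
qed

section \<open>Contractions\<close>

text \<open>Contracting the edges of \<open>g\<close> outside the image of \<open>j\<close> yields
  \<open>f\<close>, so \<open>j\<close> is a contraction of \<open>ftree g\<close> onto
  \<open>ftree f\<close> seen backwards: it picks the root of each fibre. Labels are handled
  separately.\<close>

locale node_embedding =
  fixes f g :: "'l forest" and j :: "nat list \<Rightarrow> nat list"
  assumes in_nodes: "v \<in> nodes f \<Longrightarrow> j v \<in> nodes g"
    and j_Nil: "j [] = []"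
    and j_less: "u \<in> nodes f \<Longrightarrow> v \<in> nodes f \<Longrightarrow> u < v \<Longrightarrow> j u < j v"
    and j_prefix: "u \<in> nodes f \<Longrightarrow> v \<in> nodes f \<Longrightarrow> prefix (j u) (j v) \<longleftrightarrow> prefix u v"
begin

lemma j_eq: "u \<in> nodes f \<Longrightarrow> v \<in> nodes f \<Longrightarrow> j u = j v \<longleftrightarrow> u = v"
  using j_prefix[of u v] j_prefix[of v u] by (auto intro: prefix_order.antisym)

lemma j_Nil_iff: "v \<in> nodes f \<Longrightarrow> j v = [] \<longleftrightarrow> v = []"
  using j_eq[of v "[]"] by (simp add: j_Nil)

text \<open>The vertex of \<open>f\<close> to which the vertex \<open>w\<close> of \<open>g\<close>
  is contracted, namely the lowest one whose image lies on the path from the root to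
  \<open>w\<close>.\<close>

definition is_anc :: "nat list \<Rightarrow> nat list \<Rightarrow> bool" where
  "is_anc w v \<longleftrightarrow> v \<in> nodes f \<and> prefix (j v) w \<and> (\<forall>u\<in>nodes f. prefix (j u) w \<longrightarrow> prefix u v)"

definition anc :: "nat list \<Rightarrow> nat list" where
  "anc w = (THE v. is_anc w v)"

lemma is_anc_unique: "is_anc w u \<Longrightarrow> is_anc w v \<Longrightarrow> u = v"
  unfolding is_anc_def by (blast intro: prefix_order.antisym)

lemma anc_eqI: "is_anc w v \<Longrightarrow> anc w = v"
  unfolding anc_def using is_anc_unique by blast

text \<open>The prefixes of \<open>w\<close> form a chain and \<open>j\<close> reflects the prefix
  relation, so the candidates form a chain too. It contains the root, and its longest member is the
  one wanted.\<close>

lemma is_anc_anc: "is_anc w (anc w)"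
proof -
  let ?P = "\<lambda>v. v \<in> nodes f \<and> prefix (j v) w"
  have P0: "?P []" by (simp add: j_Nil)
  have "\<forall>v. ?P v \<longrightarrow> length v < Suc (Max (length ` nodes f))" by (simp add: finite_nodes less_Suc_eq_le)
  from ex_has_greatest_nat[where P = ?P and f = length, OF P0 this]
  obtain v where v: "?P v" "\<forall>u. ?P u \<longrightarrow> length u \<le> length v" by (elim exE conjE) (rule that; simp)
  have "prefix u v" if "u \<in> nodes f" "prefix (j u) w" for u
  proof -
    have "prefix (j u) (j v) \<or> prefix (j v) (j u)"
      using prefix_same_cases[of "j u" w "j v"] that v(1) by blast
    then have "prefix u v \<or> prefix v u" using j_prefix that v(1) by blast
    moreover have "length u \<le> length v" using v(2) that by blast
    ultimately show ?thesis by (auto simp: prefix_def)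
  qed
  then have "is_anc w v" using v(1) by (simp add: is_anc_def)
  then show ?thesis using anc_eqI by simp
qed

lemma anc_in_nodes: "anc w \<in> nodes f"
  using is_anc_anc by (simp add: is_anc_def)

lemma prefix_anc: "prefix (j (anc w)) w"
  using is_anc_anc by (simp add: is_anc_def)

lemma anc_j: "v \<in> nodes f \<Longrightarrow> anc (j v) = v"
  by (rule anc_eqI) (simp add: is_anc_def j_prefix)

lemma anc_Nil: "anc [] = []"
  using anc_j[of "[]"] by (simp add: j_Nil)

text \<open>An edge that is not an image can be contracted because both its ends fall on the same
  vertex. The next lemma is the counterpart for image edges, which survive with the correct upper
  end.\<close>

lemma anc_butlast:
  assumes "w \<noteq> []" "w \<notin> j ` nodes f" shows "anc (butlast w) = anc w"
proof (rule anc_eqI)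
  have "j (anc w) \<noteq> w" using assms(2) by (metis anc_in_nodes image_eqI)
  then have "prefix (j (anc w)) (butlast w)"
    using prefix_anc[of w] assms(1) by (metis append_butlast_last_id prefix_snoc)
  moreover have "prefix u (anc w)" if "u \<in> nodes f" "prefix (j u) (butlast w)" for u
  proof -
    have "prefix (j u) w" using that(2) prefix_order.trans prefixeq_butlast by blast
    then show ?thesis using is_anc_anc[of w] that(1) by (simp add: is_anc_def)
  qed
  ultimately show "is_anc (butlast w) (anc w)" by (simp add: is_anc_def anc_in_nodes)
qed

lemma anc_butlast_j:
  assumes v: "v \<in> nodes f" "v \<noteq> []" shows "anc (butlast (j v)) = butlast v"
proof (rule anc_eqI)
  have bv: "butlast v \<in> nodes f" using v(1) by (rule nodes_butlast)
  have ne: "j v \<noteq> []" using v j_Nil_iff by simp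
  have "prefix (j (butlast v)) (j v)" using j_prefix[OF bv v(1)] prefixeq_butlast by blast
  moreover have "j (butlast v) \<noteq> j v"
    using j_eq[OF bv v(1)] v(2) strict_prefix_butlast[of v] by (auto simp: strict_prefix_def)
  ultimately have "prefix (j (butlast v)) (butlast (j v))"
    using ne by (metis append_butlast_last_id prefix_snoc)
  moreover have "prefix u (butlast v)" if u: "u \<in> nodes f" "prefix (j u) (butlast (j v))" for u
  proof -
    have "prefix (j u) (j v)" using u(2) prefix_order.trans prefixeq_butlast by blast
    then have "prefix u v" using j_prefix u(1) v(1) by blast
    moreover have "u \<noteq> v"
    proof
      assume "u = v"
      then have "strict_prefix (j v) (j v)"
        using u(2) strict_prefix_butlast[OF ne] by (meson prefix_order.le_less_trans)
      then show False by simp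
    qed
    ultimately show ?thesis using v(2) by (metis append_butlast_last_id prefix_snoc)
  qed
  ultimately show "is_anc (butlast (j v)) (butlast v)" using bv by (simp add: is_anc_def)
qed

lemma anc_image: "anc ` nodes g = nodes f"
proof (intro equalityI subsetI)
  fix v assume "v \<in> nodes f"
  then show "v \<in> anc ` nodes g" using anc_j in_nodes by (intro image_eqI[of _ _ "j v"]) auto
qed (auto simp: anc_in_nodes)

end

section \<open>From embeddings of forests to embeddings of nodes\<close>

lemma node_less_width: "u \<in> nodes a \<Longrightarrow> u < width a # v"
  using hd_less_width[of _ _ a] by (cases u) auto
lemma width_not_less_node: "u \<in> nodes a \<Longrightarrow> \<not> width a # v < u"
  using node_less_width[of u a v] by (meson order.asym)
lemma prefix_width_node: "u \<in> nodes a \<Longrightarrow> \<not> prefix (width a # v) u"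
  using hd_less_width[of _ _ a] by (cases u) auto
lemma prefix_node_width: "u \<in> nodes a \<Longrightarrow> prefix u (width a # v) \<longleftrightarrow> u = []"
  using hd_less_width[of _ _ a] by (cases u) auto

lemma lab_Snoc_left: "v \<in> nodes a \<Longrightarrow> v \<noteq> [] \<Longrightarrow> node_label (SnocF a l c) v = node_label a v"
  using hd_less_width[of "hd v" "tl v" a] by auto

text \<open>Addresses in a left part do not change when a tree is added on the right, so only the
  lower part has to be moved, below the node \<open>width b\<close>. If the embedding goes into the
  lower part alone, the root must still stay at \<open>[]\<close>.\<close>

lemma embeds_imp_node_embedding:
  "embeds f g \<Longrightarrow> \<exists>j. node_embedding f g j \<and> (\<forall>v\<in>nodes f. v \<noteq> [] \<longrightarrow> node_label g (j v) = node_label f v)"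
proof (induction rule: embeds.induct)
  case (embeds_Empty g)
  show ?case by (rule exI[of _ "\<lambda>_. []"]) (auto simp: node_embedding_def)
next
  case (embeds_Snoc a b c d l)
  then obtain ja jc where ja: "node_embedding a b ja" "\<forall>v\<in>nodes a. v \<noteq> [] \<longrightarrow> node_label b (ja v) = node_label a v"
    and jc: "node_embedding c d jc" "\<forall>v\<in>nodes c. v \<noteq> [] \<longrightarrow> node_label d (jc v) = node_label c v" by blast
  interpret A: node_embedding a b ja by (rule ja(1))
  interpret C: node_embedding c d jc by (rule jc(1))
  define J where "J v = (if v \<noteq> [] \<and> hd v = width a then width b # jc (tl v) else ja v)" for v
  have Ja: "J v = ja v" if "v \<in> nodes a" for v
    using that hd_less_width[of "hd v" "tl v" a] by (cases v) (auto simp: J_def)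
  have Jc: "J (width a # v) = width b # jc v" for v by (simp add: J_def)
  have "node_embedding (SnocF a l c) (SnocF b l d) J"
  proof
    show "J [] = []" using Ja[of "[]"] by (simp add: A.j_Nil)
    fix u assume u: "u \<in> nodes (SnocF a l c)"
    then show "J u \<in> nodes (SnocF b l d)" by (auto simp: Ja Jc A.in_nodes C.in_nodes)
    fix v assume "v \<in> nodes (SnocF a l c)"
    with u consider "u \<in> nodes a" "v \<in> nodes a" | v' where "u \<in> nodes a" "v = width a # v'" "v' \<in> nodes c"
      | u' where "v \<in> nodes a" "u = width a # u'" "u' \<in> nodes c"
      | u' v' where "u = width a # u'" "u' \<in> nodes c" "v = width a # v'" "v' \<in> nodes c" by auto
    then have "(u < v \<longrightarrow> J u < J v) \<and> (prefix (J u) (J v) \<longleftrightarrow> prefix u v)"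
    proof cases
      case 1 then show ?thesis by (simp add: Ja A.j_less A.j_prefix)
    next
      case 2 then show ?thesis
        by (simp add: Ja Jc A.in_nodes node_less_width prefix_node_width A.j_Nil_iff)
    next
      case 3 then show ?thesis
        by (simp add: Ja Jc A.in_nodes width_not_less_node prefix_width_node)
    next
      case 4 then show ?thesis by (simp add: Jc C.j_less C.j_prefix)
    qed
    then show "u < v \<Longrightarrow> J u < J v" "prefix (J u) (J v) \<longleftrightarrow> prefix u v" by auto
  qed
  moreover have "node_label (SnocF b l d) (J v) = node_label (SnocF a l c) v" if v: "v \<in> nodes (SnocF a l c)" "v \<noteq> []" for v
  proof (cases "v \<in> nodes a")
    case True
    then show ?thesis using v(2) ja(2) A.j_Nil_iff[OF True]
      by (simp add: Ja lab_Snoc_left A.in_nodes del: node_label.simps)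
  next
    case False
    then obtain v' where "v = width a # v'" "v' \<in> nodes c" using v by auto
    then show ?thesis using jc(2) C.j_Nil_iff[of v'] by (auto simp: Jc)
  qed
  ultimately show ?case by blast
next
  case (embeds_left f b l d)
  then obtain j where j: "node_embedding f b j" "\<forall>v\<in>nodes f. v \<noteq> [] \<longrightarrow> node_label b (j v) = node_label f v" by blast
  interpret node_embedding f b j by (rule j(1))
  have "node_embedding f (SnocF b l d) j"
    by unfold_locales (auto simp: in_nodes j_Nil j_less j_prefix)
  moreover have "node_label (SnocF b l d) (j v) = node_label f v" if "v \<in> nodes f" "v \<noteq> []" for v
    using that j(2) j_Nil_iff[OF that(1)] by (simp add: lab_Snoc_left in_nodes del: node_label.simps)
  ultimately show ?case by blast
next
  case (embeds_child f d b l)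
  then obtain j where j: "node_embedding f d j" "\<forall>v\<in>nodes f. v \<noteq> [] \<longrightarrow> node_label d (j v) = node_label f v" by blast
  interpret node_embedding f d j by (rule j(1))
  define J where "J v = (if v = [] then [] else width b # j v)" for v
  have "node_embedding f (SnocF b l d) J"
  proof
    show "J [] = []" by (simp add: J_def)
    fix u assume u: "u \<in> nodes f"
    then show "J u \<in> nodes (SnocF b l d)" by (auto simp: J_def in_nodes)
    fix v assume v: "v \<in> nodes f"
    show "J u < J v" if "u < v" using that u v j_less[of u v] by (auto simp: J_def)
    show "prefix (J u) (J v) \<longleftrightarrow> prefix u v" using u v by (auto simp: J_def j_prefix)
  qed
  moreover have "node_label (SnocF b l d) (J v) = node_label f v" if "v \<in> nodes f" "v \<noteq> []" for v
    using that j(2) j_Nil_iff[OF that(1)] by (simp add: J_def)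
  ultimately show ?case by blast
qed

section \<open>Subtrees in terms of addresses\<close>

lemma elems_ftree: "Inl v \<in> elems (ftree f) \<longleftrightarrow> v \<in> nodes f" "Inr v \<in> elems (ftree f) \<longleftrightarrow> v \<in> nodes f \<and> v \<noteq> []"
  by (auto simp: elems_def)

text \<open>A subtree without walks: every vertex except \<open>r\<close> comes with the edge above
  it, and every edge with its upper end, so climbing from any vertex stays in \<open>X\<close> until
  \<open>r\<close> is reached.\<close>

definition rooted_at :: "'l forest \<Rightarrow> (nat list + nat list) set \<Rightarrow> nat list \<Rightarrow> bool" where
  "rooted_at f X r \<longleftrightarrow> Inl r \<in> X \<and> X \<subseteq> elems (ftree f) \<and> (\<forall>v. Inr v \<in> X \<longleftrightarrow> Inl v \<in> X \<and> v \<noteq> r)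
     \<and> (\<forall>v. Inr v \<in> X \<longrightarrow> Inl (butlast v) \<in> X)"

lemma rooted_at_prefix: "rooted_at f X r \<Longrightarrow> Inl v \<in> X \<Longrightarrow> prefix r v"
proof (induction v rule: rev_induct)
  case Nil
  have "r = []"
  proof (rule ccontr)
    assume "r \<noteq> []"
    then have "Inr [] \<in> elems (ftree f)" using Nil unfolding rooted_at_def by blast
    then show False by (simp add: elems_ftree)
  qed
  then show ?case by simp
next
  case (snoc i v)
  show ?case
  proof (cases "v @ [i] = r")
    case False
    then have "Inr (v @ [i]) \<in> X" using snoc.prems unfolding rooted_at_def by blast
    then have "Inl v \<in> X" using snoc.prems unfolding rooted_at_def by (metis butlast_snoc)
    then show ?thesis using snoc by simp
  qed simp
qed

text \<open>The root of a subtree is a prefix of all its vertices, hence lexicographically least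
  among them.\<close>

lemma df_first_rooted:
  assumes r: "rooted_at f X r" shows "df_first (ftree f) (Inl -` X) = r"
proof -
  have X: "v \<in> nodes f" if "Inl v \<in> X" for v
    using r that elems_ftree(1)[of v f] unfolding rooted_at_def by blast
  have rX: "Inl r \<in> X" using r by (simp add: rooted_at_def)
  have less: "df_less (ftree f) u v \<longleftrightarrow> u < v" if "Inl u \<in> X" "Inl v \<in> X" for u v
    using df_less_ftree X that by blast
  have "r < v" if "Inl v \<in> X" "v \<noteq> r" for v
    using rooted_at_prefix[OF r that(1)] that(2) by (simp add: less_list_iff strict_prefix_def)
  note first = this
  show ?thesis
    unfolding df_first_def
  proof (rule the_equality)
    show "r \<in> Inl -` X \<and> (\<forall>v\<in>Inl -` X. v \<noteq> r \<longrightarrow> df_less (ftree f) r v)" using rX first less by simp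
    fix u assume u: "u \<in> Inl -` X \<and> (\<forall>v\<in>Inl -` X. v \<noteq> u \<longrightarrow> df_less (ftree f) u v)"
    show "u = r"
    proof (rule ccontr)
      assume "u \<noteq> r"
      then have "u < r" "r < u" using u rX less[of u r] first[of u] by auto
      then show False by (rule order.asym)
    qed
  qed
qed

lemma cas_append: "pre_digraph.cas G u p w \<Longrightarrow> pre_digraph.cas G w q v \<Longrightarrow> pre_digraph.cas G u (p @ q) v"
  by (induction p arbitrary: u) (auto simp: pre_digraph.cas.simps)

text \<open>An arc is named by its lower end, so a walk is the list of the prefixes through which it
  passes and is determined by its two ends. \<open>G\<close> need only have arcs of
  \<open>ftree f\<close>, so that subtrees are covered.\<close>

lemma cas_ftree:
  assumes "arcs G \<subseteq> nodes f - {[]}" "tail G = tail (pt_graph (ftree f))" "head G = head (pt_graph (ftree f))"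
  shows "pre_digraph.cas G u p v \<Longrightarrow> set p \<subseteq> arcs G \<Longrightarrow>
    prefix u v \<and> p = map (\<lambda>k. take k v) [Suc (length u)..<Suc (length v)]"
proof (induction p arbitrary: u)
  case Nil
  then show ?case by (simp add: pre_digraph.cas.simps)
next
  case (Cons e p)
  have e: "e \<in> nodes f" "e \<noteq> []" using Cons.prems(2) assms(1) by auto
  then have u: "u = butlast e" and cas: "pre_digraph.cas G e p v"
    using Cons.prems(1) ftree_arc[OF e] by (auto simp: pre_digraph.cas.simps assms)
  have IH: "prefix e v" "p = map (\<lambda>k. take k v) [Suc (length e)..<Suc (length v)]"
    using Cons.IH[OF cas] Cons.prems(2) by auto
  have len: "length e = Suc (length u)" using e(2) u by simp
  have "length e \<le> length v" using IH(1) by (rule prefix_length_le)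
  then have "[Suc (length u)..<Suc (length v)] = length e # [Suc (length e)..<Suc (length v)]"
    unfolding len by (rule upt_conv_Cons[OF le_imp_less_Suc])
  moreover have "take (length e) v = e" using IH(1) by (auto simp: prefix_def)
  moreover have "prefix u v" using prefix_order.trans[OF prefixeq_butlast IH(1)] u by simp
  ultimately show ?case using IH(2) by simp
qed

text \<open>Walks are unique by \<open>cas_ftree\<close>; the existence of a walk from
  \<open>r\<close> to every vertex amounts to climbing edge by edge inside \<open>X\<close>.\<close>

lemma subtree_ftree: "subtree (ftree f) X \<longleftrightarrow> (\<exists>r. rooted_at f X r)"
proof -
  let ?G = "\<lparr>verts = Inl -` X, arcs = Inr -` X, tail = tail (pt_graph (ftree f)), head = head (pt_graph (ftree f))\<rparr>"
  have "out_tree ?G r \<longleftrightarrow> rooted_at f X r" if X: "X \<subseteq> elems (ftree f)" for r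
  proof -
    have V: "v \<in> nodes f" if "Inl v \<in> X" for v using X that elems_ftree(1)[of v f] by blast
    have A: "v \<in> nodes f \<and> v \<noteq> []" if "Inr v \<in> X" for v using X that elems_ftree(2)[of v f] by blast
    have arcs: "arcs ?G \<subseteq> nodes f - {[]}" using A by auto
    note walk = cas_ftree[OF arcs, simplified]
    show ?thesis
    proof
      assume ot: "out_tree ?G r"
      then have r: "Inl r \<in> X" and ex: "\<And>v. Inl v \<in> X \<Longrightarrow> \<exists>p. pre_digraph.awalk ?G r p v"
        by (auto simp: out_tree_def)
      have wf: "wf_digraph ?G" using ot by (simp add: out_tree_def fin_digraph_def)
      have hd: "Inl v \<in> X" "Inl (butlast v) \<in> X" if "Inr v \<in> X" for v
        using wf_digraph.head_in_verts[OF wf, of v] wf_digraph.tail_in_verts[OF wf, of v] that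
          ftree_arc[of v f] A[OF that] by simp_all
      have pre: "prefix r v" if "Inl v \<in> X" for v
        using ex[OF that] walk[of r _ v] by (auto simp: pre_digraph.awalk_def)
      have "Inr r \<notin> X"
      proof
        assume rX: "Inr r \<in> X"
        have "strict_prefix (butlast r) r" using A[OF rX] by (simp add: strict_prefix_butlast)
        then have "strict_prefix r r" using pre[OF hd(2)[OF rX]] by (rule prefix_order.le_less_trans[rotated])
        then show False by simp
      qed
      moreover have "Inr v \<in> X" if v: "Inl v \<in> X" "v \<noteq> r" for v
      proof -
        obtain p where p: "pre_digraph.cas ?G r p v" "set p \<subseteq> Inr -` X"
          using ex[OF v(1)] by (auto simp: pre_digraph.awalk_def)
        have eq: "prefix r v" "p = map (\<lambda>k. take k v) [Suc (length r)..<Suc (length v)]"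
          using walk[OF p] by auto
        have "length r < length v" using eq(1) v(2) by (auto simp: prefix_def)
        then have "length v \<in> set [Suc (length r)..<Suc (length v)]" by simp
        then have "take (length v) v \<in> set p" unfolding eq(2) set_map by (rule imageI)
        then show ?thesis using p(2) by auto
      qed
      ultimately show "rooted_at f X r" using r X hd unfolding rooted_at_def by blast
    next
      assume r: "rooted_at f X r"
      have "fin_digraph ?G"
      proof
        show "finite (verts ?G)" using V finite_subset[OF _ finite_nodes[of f], of "Inl -` X"] by auto
        show "finite (arcs ?G)" using A finite_subset[OF _ finite_nodes[of f], of "Inr -` X"] by auto
        fix e assume "e \<in> arcs ?G"
        then have e: "Inr e \<in> X" by simp
        then show "tail ?G e \<in> verts ?G" "head ?G e \<in> verts ?G"
          using r ftree_arc[of e f] A[OF e] by (auto simp: rooted_at_def)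
      qed
      moreover have "\<exists>p. pre_digraph.awalk ?G r p v" if "Inl v \<in> X" for v
        using that
      proof (induction v rule: rev_induct)
        case Nil
        then have "r = []" using rooted_at_prefix[OF r, of "[]"] by simp
        then show ?case using Nil by (intro exI[of _ "[]"]) (simp add: pre_digraph.awalk_def pre_digraph.cas.simps)
      next
        case (snoc i v)
        show ?case
        proof (cases "v @ [i] = r")
          case True
          then show ?thesis using snoc by (intro exI[of _ "[]"]) (simp add: pre_digraph.awalk_def pre_digraph.cas.simps)
        next
          case False
          then have e: "Inr (v @ [i]) \<in> X" using snoc.prems r unfolding rooted_at_def by blast
          then have "Inl v \<in> X" using r unfolding rooted_at_def by (metis butlast_snoc)
          then obtain p where p: "pre_digraph.awalk ?G r p v" using snoc.IH by blast
          have "pre_digraph.cas ?G v [v @ [i]] (v @ [i])"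
            using ftree_arc[of "v @ [i]" f] A[OF e] by (simp add: pre_digraph.cas.simps)
          then have "pre_digraph.awalk ?G r (p @ [v @ [i]]) (v @ [i])"
            using p e cas_append[of ?G r p v] by (simp add: pre_digraph.awalk_def)
          then show ?thesis by blast
        qed
      qed
      moreover have "p = q" if "pre_digraph.awalk ?G r p v" "pre_digraph.awalk ?G r q v" for p q v
        using that walk[of r p v] walk[of r q v] by (simp add: pre_digraph.awalk_def)
      ultimately show "out_tree ?G r"
        using r unfolding out_tree_def by (auto simp: rooted_at_def)
    qed
  qed
  then show ?thesis unfolding subtree_def by (auto simp: rooted_at_def)
qed

section \<open>The contraction given by a node embedding\<close>

context node_embedding
begin

text \<open>An edge is named by its lower end, so \<open>anc e\<close> also names the image of a
  surviving edge: for \<open>e = j v\<close> it is \<open>v\<close>.\<close>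

definition contract :: "nat list + nat list \<Rightarrow> nat list + nat list" where
  "contract = (\<lambda>z\<in>elems (ftree g). case z of Inl w \<Rightarrow> Inl (anc w)
     | Inr e \<Rightarrow> if e \<in> j ` nodes f then Inr (anc e) else Inl (anc e))"

lemma contract_Inl: "w \<in> nodes g \<Longrightarrow> contract (Inl w) = Inl (anc w)"
  by (simp add: contract_def elems_ftree)

lemma contract_j: "v \<in> nodes f \<Longrightarrow> v \<noteq> [] \<Longrightarrow> contract (Inr (j v)) = Inr v"
  using j_Nil_iff[of v] by (simp add: contract_def elems_ftree in_nodes anc_j)

lemma contract_other: "e \<in> nodes g \<Longrightarrow> e \<noteq> [] \<Longrightarrow> e \<notin> j ` nodes f \<Longrightarrow> contract (Inr e) = Inl (anc e)"
  by (simp add: contract_def elems_ftree)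

lemma edge_cases:
  assumes "e \<in> nodes g" "e \<noteq> []"
  obtains v where "v \<in> nodes f" "v \<noteq> []" "e = j v" "contract (Inr e) = Inr v"
  | "e \<notin> j ` nodes f" "contract (Inr e) = Inl (anc e)"
proof (cases "e \<in> j ` nodes f")
  case True
  then obtain v where v: "v \<in> nodes f" "e = j v" by blast
  then have "v \<noteq> []" using assms(2) j_Nil by auto
  then show thesis using that(1)[of v] v contract_j by simp
next
  case False
  then show thesis using that(2) contract_other[OF assms] by simp
qed

lemma contract_in_elems: "z \<in> elems (ftree g) \<Longrightarrow> contract z \<in> elems (ftree f)"
proof (cases z)
  case (Inl w)
  then show "z \<in> elems (ftree g) \<Longrightarrow> ?thesis" by (simp add: elems_ftree contract_Inl anc_in_nodes)
next
  case (Inr e)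
  assume "z \<in> elems (ftree g)"
  then have e: "e \<in> nodes g" "e \<noteq> []" by (simp_all add: Inr elems_ftree)
  then show ?thesis by (cases rule: edge_cases) (simp_all add: Inr elems_ftree anc_in_nodes)
qed

lemma endpoints_ftree: "e \<in> nodes h \<Longrightarrow> e \<noteq> [] \<Longrightarrow> endpoints (ftree h) (Inr e) = {butlast e, e}"
  by (simp add: ftree_arc)

lemma contract_endpoints:
  assumes "e \<in> nodes g" "e \<noteq> []"
  shows "contract ` Inl ` endpoints (ftree g) (Inr e) = Inl ` endpoints (ftree f) (contract (Inr e))"
proof -
  have b: "butlast e \<in> nodes g" using assms(1) by (rule nodes_butlast)
  have "contract ` Inl ` endpoints (ftree g) (Inr e) = {Inl (anc (butlast e)), Inl (anc e)}"
    using assms b by (simp add: endpoints_ftree contract_Inl del: endpoints.simps)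
  also have "\<dots> = Inl ` endpoints (ftree f) (contract (Inr e))"
    using assms
  proof (cases rule: edge_cases)
    case (1 v)
    then show ?thesis by (simp add: endpoints_ftree anc_butlast_j anc_j del: endpoints.simps(2))
  next
    case 2
    then show ?thesis using assms(2) by (simp add: anc_butlast)
  qed
  finally show ?thesis .
qed

text \<open>Climbing in \<open>g\<close> stays in the preimage, since a contracted edge does not
  change the image and a surviving edge goes to an edge of \<open>X\<close>. The climb ends at
  \<open>j r\<close>, the one vertex whose own edge leads out of the preimage. Thus \<open>j\<close>
  carries roots of fibres to roots of fibres.\<close>

lemma rooted_contract:
  assumes X: "rooted_at f X r"
  shows "rooted_at g {z \<in> elems (ftree g). contract z \<in> X} (j r)"
proof -
  have rX: "Inl r \<in> X" and sub: "X \<subseteq> elems (ftree f)"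
    and Inr: "\<And>v. Inr v \<in> X \<longleftrightarrow> Inl v \<in> X \<and> v \<noteq> r" and bl: "\<And>v. Inr v \<in> X \<Longrightarrow> Inl (butlast v) \<in> X"
    using X by (auto simp: rooted_at_def)
  have r: "r \<in> nodes f" using rX sub elems_ftree(1)[of r f] by blast
  have r1: "Inl (j r) \<in> {z \<in> elems (ftree g). contract z \<in> X}"
    using r rX by (simp add: elems_ftree in_nodes contract_Inl anc_j)
  have nonroot: "contract (Inr e) \<in> X \<longleftrightarrow> contract (Inl e) \<in> X \<and> e \<noteq> j r" if "e \<in> nodes g" "e \<noteq> []" for e
    using that
  proof (cases rule: edge_cases)
    case (1 v)
    then show ?thesis using Inr[of v] that r by (simp add: contract_Inl anc_j j_eq)
  next
    case 2
    then show ?thesis using that r by (auto simp: contract_Inl)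
  qed
  have root: "e \<noteq> []" if "contract (Inl e) \<in> X" "e \<noteq> j r" for e
  proof
    assume e: "e = []"
    then have "Inl [] \<in> X" using that(1) contract_Inl[of "[]"] by (simp add: anc_Nil)
    then have "Inr [] \<in> X" using Inr[of "[]"] that(2) e j_Nil by auto
    then show False using sub elems_ftree(2)[of "[]" f] by blast
  qed
  have "contract (Inl (butlast e)) \<in> X" if "e \<in> nodes g" "e \<noteq> []" "contract (Inr e) \<in> X" for e
    using that(1,2)
  proof (cases rule: edge_cases)
    case (1 v)
    then show ?thesis using bl[of v] that nodes_butlast[OF that(1)] by (simp add: contract_Inl anc_butlast_j)
  next
    case 2
    then show ?thesis using that nodes_butlast[OF that(1)] by (simp add: contract_Inl anc_butlast)
  qed
  then show ?thesis
    using r1 nonroot root unfolding rooted_at_def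
    by (auto simp: elems_ftree intro: nodes_butlast)
qed

text \<open>The conditions on a morphism pull back along the contraction; for the depth-first
  condition, the first vertices of the fibres are \<open>r\<close> in \<open>f\<close> and
  \<open>j r\<close> in \<open>g\<close>, and \<open>j\<close> is monotone. With the identity for
  \<open>\<phi>\<close> this shows that the contraction is itself a morphism.\<close>

lemma compose_contract_in_hom:
  assumes \<phi>: "\<phi> \<in> pt_hom (ftree f) T'"
    and node_label: "\<And>v. v \<in> nodes f \<Longrightarrow> v \<noteq> [] \<Longrightarrow> node_label g (j v) = node_label f v"
  shows "compose (elems (ftree g)) \<phi> contract \<in> pt_hom (ftree g) T'"
proof -
  let ?T = "ftree f" and ?U = "ftree g"
  let ?\<phi>' = "compose (elems ?U) \<phi> contract"
  have ext: "\<phi> \<in> elems ?T \<rightarrow>\<^sub>E elems T'"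
    and onto: "\<phi> ` Inl ` nodes f = Inl ` verts (pt_graph T')"
    and ends: "\<And>e. e \<in> nodes f \<Longrightarrow> e \<noteq> [] \<Longrightarrow> \<phi> ` Inl ` endpoints ?T (Inr e) = Inl ` endpoints T' (\<phi> (Inr e))"
    and bij: "bij_betw \<phi> {z \<in> elems ?T. \<phi> z \<in> Inr ` arcs (pt_graph T')} (Inr ` arcs (pt_graph T'))"
    and lab': "\<And>e e'. e \<in> nodes f \<Longrightarrow> e \<noteq> [] \<Longrightarrow> \<phi> (Inr e) = Inr e' \<Longrightarrow> pt_label T' e' = pt_label ?T e"
    and sub: "\<And>x. x \<in> verts (pt_graph T') \<Longrightarrow> subtree ?T (fibre ?T \<phi> x)"
    and root: "\<phi> (Inl []) = Inl (pt_root T')"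
    and df: "\<And>x y. x \<in> verts (pt_graph T') \<Longrightarrow> y \<in> verts (pt_graph T') \<Longrightarrow> df_less T' x y \<Longrightarrow>
        df_less ?T (df_first ?T (Inl -` fibre ?T \<phi> x)) (df_first ?T (Inl -` fibre ?T \<phi> y))"
    using \<phi> unfolding pt_hom_def by simp_all
  have c: "?\<phi>' z = \<phi> (contract z)" if "z \<in> elems ?U" for z using that by (simp add: compose_def)
  have \<phi>Inl: "\<exists>x. \<phi> (Inl v) = Inl x" if "v \<in> nodes f" for v using onto that by blast
  have fib: "fibre ?U ?\<phi>' x = {z \<in> elems ?U. contract z \<in> fibre ?T \<phi> x}" for x
    unfolding fibre_def using c contract_in_elems by auto
  have rooted: "\<exists>r. rooted_at f (fibre ?T \<phi> x) r \<and> rooted_at g (fibre ?U ?\<phi>' x) (j r)"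
    if "x \<in> verts (pt_graph T')" for x
    using sub[OF that] unfolding subtree_ftree fib using rooted_contract by blast
  have 1: "?\<phi>' \<in> elems ?U \<rightarrow>\<^sub>E elems T'"
    using ext contract_in_elems by (auto simp: compose_def)
  have "?\<phi>' ` Inl ` nodes g = \<phi> ` Inl ` anc ` nodes g"
    unfolding image_image by (intro image_cong refl) (simp add: c elems_ftree contract_Inl)
  then have 2: "?\<phi>' ` Inl ` nodes g = Inl ` verts (pt_graph T')" using onto by (simp add: anc_image)
  have 3: "?\<phi>' ` Inl ` endpoints ?U (Inr e) = Inl ` endpoints T' (?\<phi>' (Inr e))" if e: "e \<in> nodes g" "e \<noteq> []" for e
  proof -
    have "?\<phi>' ` Inl ` endpoints ?U (Inr e) = \<phi> ` contract ` Inl ` endpoints ?U (Inr e)"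
      unfolding image_image
      by (intro image_cong refl c) (use e nodes_butlast[OF e(1)] in \<open>auto simp: endpoints_ftree elems_ftree simp del: endpoints.simps\<close>)
    also have "\<dots> = \<phi> ` Inl ` endpoints ?T (contract (Inr e))" using contract_endpoints[OF e] by simp
    also have "\<dots> = Inl ` endpoints T' (\<phi> (contract (Inr e)))"
      using e
    proof (cases rule: edge_cases)
      case (1 v) then show ?thesis using ends by simp
    next
      case 2
      obtain x where "\<phi> (Inl (anc e)) = Inl x" using \<phi>Inl anc_in_nodes by blast
      then show ?thesis using 2 by simp
    qed
    finally show ?thesis using e by (simp add: c elems_ftree)
  qed
  let ?A = "{z \<in> elems ?T. \<phi> z \<in> Inr ` arcs (pt_graph T')}"
  let ?A' = "{z \<in> elems ?U. ?\<phi>' z \<in> Inr ` arcs (pt_graph T')}"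
  have A: "\<exists>v. z = Inr v \<and> v \<in> nodes f \<and> v \<noteq> []" if "z \<in> ?A" for z
  proof (cases z)
    case (Inl v)
    then have "v \<in> nodes f" using that by (simp add: elems_ftree)
    then show ?thesis using \<phi>Inl[of v] that Inl by auto
  qed (use that in \<open>simp add: elems_ftree\<close>)
  have A': "\<exists>v. z = Inr (j v) \<and> v \<in> nodes f \<and> v \<noteq> [] \<and> contract z = Inr v" if "z \<in> ?A'" for z
  proof -
    have z: "z \<in> elems ?U" and "contract z \<in> ?A" using that c contract_in_elems by auto
    then obtain v where v: "contract z = Inr v" using A by blast
    show ?thesis
    proof (cases z)
      case (Inl w) then show ?thesis using z v by (simp add: elems_ftree contract_Inl)
    next
      case (Inr e)
      then have "e \<in> nodes g" "e \<noteq> []" using z by (simp_all add: elems_ftree)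
      then show ?thesis using v Inr by (cases rule: edge_cases) auto
    qed
  qed
  \<comment> \<open>Only edges are sent to edges, and the edges of \<open>g\<close> that survive are
    the \<open>j v\<close>. So \<open>j\<close> is the inverse on these elements.\<close>
  have "bij_betw contract ?A' ?A"
  proof (rule bij_betw_byWitness[where f' = "\<lambda>z. case z of Inr v \<Rightarrow> Inr (j v) | Inl v \<Rightarrow> Inl v"])
    show "\<forall>z\<in>?A'. (case contract z of Inr v \<Rightarrow> Inr (j v) | Inl v \<Rightarrow> Inl v) = z" using A' by fastforce
    show "\<forall>z\<in>?A. contract (case z of Inr v \<Rightarrow> Inr (j v) | Inl v \<Rightarrow> Inl v) = z" using A contract_j by fastforce
    show "contract ` ?A' \<subseteq> ?A" using c contract_in_elems by auto
    show "(\<lambda>z. case z of Inr v \<Rightarrow> Inr (j v) | Inl v \<Rightarrow> Inl v) ` ?A \<subseteq> ?A'"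
    proof (intro image_subsetI)
      fix z assume "z \<in> ?A"
      then have z: "z \<in> elems ?T" "\<phi> z \<in> Inr ` arcs (pt_graph T')" by simp_all
      obtain v where v: "z = Inr v" "v \<in> nodes f" "v \<noteq> []" using A[OF \<open>z \<in> ?A\<close>] by blast
      then have "Inr (j v) \<in> elems ?U" using in_nodes j_Nil_iff by (simp add: elems_ftree)
      then show "(case z of Inr v \<Rightarrow> Inr (j v) | Inl v \<Rightarrow> Inl v) \<in> ?A'" using v z(2) by (simp add: c contract_j)
    qed
  qed
  from bij_betw_trans[OF this bij] have "bij_betw (\<phi> \<circ> contract) ?A' (Inr ` arcs (pt_graph T'))" .
  then have 4: "bij_betw ?\<phi>' ?A' (Inr ` arcs (pt_graph T'))"
    by (rule bij_betw_cong[THEN iffD1, rotated]) (simp add: c)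
  have 5: "pt_label T' e' = pt_label ?U e" if e: "e \<in> nodes g" "e \<noteq> []" "?\<phi>' (Inr e) = Inr e'" for e e'
  proof -
    have "\<phi> (contract (Inr e)) = Inr e'" using e by (simp add: c elems_ftree)
    with e(1,2) show ?thesis
    proof (cases rule: edge_cases)
      case (1 v)
      then show ?thesis using lab'[of v e'] \<open>\<phi> (contract (Inr e)) = Inr e'\<close> e node_label[of v] ftree_arc[of v f] ftree_arc[of e g] by simp
    next
      case 2
      then show ?thesis using \<phi>Inl[OF anc_in_nodes[of e]] \<open>\<phi> (contract (Inr e)) = Inr e'\<close> by auto
    qed
  qed
  have 6: "subtree ?U (fibre ?U ?\<phi>' x)" if "x \<in> verts (pt_graph T')" for x
    using rooted[OF that] unfolding subtree_ftree by blast
  have 7: "?\<phi>' (Inl []) = Inl (pt_root T')" using root by (simp add: c elems_ftree contract_Inl anc_Nil)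
  have 8: "df_less ?U (df_first ?U (Inl -` fibre ?U ?\<phi>' x)) (df_first ?U (Inl -` fibre ?U ?\<phi>' y))"
    if xy: "x \<in> verts (pt_graph T')" "y \<in> verts (pt_graph T')" "df_less T' x y" for x y
  proof -
    obtain r s where r: "rooted_at f (fibre ?T \<phi> x) r" "rooted_at g (fibre ?U ?\<phi>' x) (j r)"
      and s: "rooted_at f (fibre ?T \<phi> y) s" "rooted_at g (fibre ?U ?\<phi>' y) (j s)" using rooted xy by blast
    have rs: "r \<in> nodes f" "s \<in> nodes f"
      using r(1) s(1) elems_ftree(1)[of _ f] unfolding rooted_at_def by blast+
    then have "r < s" using df[OF xy] r(1) s(1) by (simp add: df_first_rooted df_less_ftree)
    then have "df_less ?U (j r) (j s)" using rs by (simp add: df_less_ftree in_nodes j_less)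
    then show ?thesis using r(2) s(2) by (simp add: df_first_rooted)
  qed
  show ?thesis
    unfolding pt_hom_def using 1 2 3 4 5 6 7 8 by (simp del: endpoints.simps)
qed

end

lemma restrict_id_in_hom: "restrict id (elems (ftree f)) \<in> pt_hom (ftree f) (ftree f)"
proof -
  let ?T = "ftree f" and ?i = "restrict id (elems (ftree f))"
  have i: "?i z = z" if "z \<in> elems ?T" for z using that by simp
  have fib: "rooted_at f (fibre ?T ?i x) x" if "x \<in> nodes f" for x
    using that by (auto simp: rooted_at_def fibre_def elems_ftree)
  have e: "?i ` Inl ` endpoints ?T (Inr e) = Inl ` endpoints ?T (?i (Inr e))" if "e \<in> nodes f" "e \<noteq> []" for e
    using that nodes_butlast[of e f] by (simp add: ftree_arc elems_ftree)
  have v: "?i ` Inl ` nodes f = Inl ` nodes f"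
    by (auto simp: elems_ftree image_iff)
  have "bij_betw ?i {z \<in> elems ?T. ?i z \<in> Inr ` (nodes f - {[]})} (Inr ` (nodes f - {[]}))"
    by (auto simp: bij_betw_def inj_on_def elems_ftree image_iff)
  then show ?thesis
    unfolding pt_hom_def using fib e v df_first_rooted[OF fib]
    by (auto simp: subtree_ftree elems_ftree simp del: endpoints.simps)
qed

section \<open>Morphisms as decorated forests\<close>

lemma width_map_forest [simp]: "width (map_forest k f) = width f" by (induction f) auto
lemma nodes_map_forest [simp]: "nodes (map_forest k f) = nodes f" by (induction f) auto

lemma nodes_Snoc_cases:
  assumes "v \<in> nodes (SnocF a l c)" "v \<noteq> []"
  obtains "v \<in> nodes a" "node_label (SnocF a l c) v = node_label a v"
  | "v = [width a]" "node_label (SnocF a l c) v = l"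
  | u where "v = width a # u" "u \<in> nodes c" "u \<noteq> []" "node_label (SnocF a l c) v = node_label c u"
proof -
  consider "v \<in> nodes a" | u where "v = width a # u" "u \<in> nodes c" using assms(1) by auto
  then show thesis
  proof cases
    case 1 then show thesis using that(1) lab_Snoc_left[OF 1 assms(2)] by blast
  next
    case (2 u)
    then show thesis using that(2,3) by (cases "u = []") auto
  qed
qed

lemma ball_nodes_Snoc:
  "(\<forall>v\<in>nodes (SnocF a l c). v \<noteq> [] \<longrightarrow> P v) \<longleftrightarrow>
    (\<forall>v\<in>nodes a. v \<noteq> [] \<longrightarrow> P v) \<and> P [width a] \<and> (\<forall>v\<in>nodes c. v \<noteq> [] \<longrightarrow> P (width a # v))"
    (is "?L \<longleftrightarrow> ?R")
proof
  assume R: ?R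
  show ?L
  proof (intro ballI impI)
    fix v assume v: "v \<in> nodes (SnocF a l c)" "v \<noteq> []"
    then show "P v" by (cases rule: nodes_Snoc_cases) (use R v in auto)
  qed
qed auto

lemma lab_map_forest: "v \<in> nodes f \<Longrightarrow> v \<noteq> [] \<Longrightarrow> node_label (map_forest k f) v = k (node_label f v)"
proof (induction f arbitrary: v)
  case (SnocF a l c)
  from SnocF.prems show ?case
  proof (cases rule: nodes_Snoc_cases)
    case 1
    then show ?thesis using SnocF.IH(1)[OF 1(1) SnocF.prems(2)] SnocF.prems(2)
      lab_Snoc_left[of v "map_forest k a" "k l" "map_forest k c"] by simp
  next
    case 2
    then show ?thesis by simp
  next
    case (3 u)
    then show ?thesis using SnocF.IH(2)[of u] by simp
  qed
qed auto

primrec decorate :: "'s forest \<Rightarrow> (nat list \<Rightarrow> 'd) \<Rightarrow> ('s \<times> 'd) forest" where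
  "decorate EmptyF D = EmptyF"
| "decorate (SnocF a l c) D = SnocF (decorate a D) (l, D [width a]) (decorate c (\<lambda>v. D (width a # v)))"

lemma width_decorate [simp]: "width (decorate f D) = width f"
  by (induction f arbitrary: D) auto
lemma nodes_decorate [simp]: "nodes (decorate f D) = nodes f"
  by (induction f arbitrary: D) auto
lemma size_decorate [simp]: "size (decorate f D) = size f"
  by (induction f arbitrary: D) auto
lemma map_fst_decorate [simp]: "map_forest fst (decorate f D) = f"
  by (induction f arbitrary: D) auto

lemma lab_decorate: "v \<in> nodes f \<Longrightarrow> v \<noteq> [] \<Longrightarrow> node_label (decorate f D) v = (node_label f v, D v)"
proof (induction f arbitrary: v D)
  case (SnocF a l c)
  from SnocF.prems show ?case
  proof (cases rule: nodes_Snoc_cases)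
    case 1
    then show ?thesis using SnocF.IH(1)[OF 1(1) SnocF.prems(2), of D] SnocF.prems(2)
      lab_Snoc_left[of v "decorate a D"] by simp
  next
    case 2
    then show ?thesis by simp
  next
    case (3 u)
    then show ?thesis using SnocF.IH(2)[of u "\<lambda>v. D (width a # v)"] by simp
  qed
qed auto

lemma decorate_map_fst:
  "(\<And>v. v \<in> nodes h \<Longrightarrow> v \<noteq> [] \<Longrightarrow> D v = snd (node_label h v)) \<Longrightarrow> decorate (map_forest fst h) D = h"
proof (induction h arbitrary: D)
  case (SnocF a l c)
  have "decorate (map_forest fst a) D = a"
    by (rule SnocF.IH(1)) (use SnocF.prems lab_Snoc_left[of _ a l c] in auto)
  moreover have "decorate (map_forest fst c) (\<lambda>v. D (width a # v)) = c"
    by (rule SnocF.IH(2)) (use SnocF.prems in auto)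
  moreover have "D [width a] = snd l" using SnocF.prems[of "[width a]"] by simp
  ultimately show ?case by simp
qed simp

lemma labels_decorate:
  "labels f \<subseteq> S \<Longrightarrow> (\<And>v. v \<in> nodes f \<Longrightarrow> v \<noteq> [] \<Longrightarrow> D v \<in> Z) \<Longrightarrow> labels (decorate f D) \<subseteq> S \<times> Z"
proof (induction f arbitrary: D)
  case (SnocF a l c)
  have "labels (decorate a D) \<subseteq> S \<times> Z" by (rule SnocF.IH(1)) (use SnocF.prems in auto)
  moreover have "labels (decorate c (\<lambda>v. D (width a # v))) \<subseteq> S \<times> Z" by (rule SnocF.IH(2)) (use SnocF.prems in auto)
  moreover have "D [width a] \<in> Z" using SnocF.prems(2)[of "[width a]"] by simp
  ultimately show ?case using SnocF.prems(1) by auto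
qed simp

primrec count_labels :: "('l \<Rightarrow> bool) \<Rightarrow> 'l forest \<Rightarrow> nat" where
  "count_labels Q EmptyF = 0"
| "count_labels Q (SnocF a l c) = count_labels Q a + count_labels Q c + (if Q l then 1 else 0)"

lemma count_eq_card: "count_labels Q f = card {v \<in> nodes f. v \<noteq> [] \<and> Q (node_label f v)}"
proof (induction f)
  case (SnocF a l c)
  let ?N = "\<lambda>f. {v \<in> nodes f. v \<noteq> [] \<and> Q (node_label f v)}"
  have "?N (SnocF a l c) = ?N a \<union> ((#) (width a) ` ?N c \<union> (if Q l then {[width a]} else {}))"
  proof (intro equalityI subsetI)
    fix v assume v: "v \<in> ?N (SnocF a l c)"
    then have "v \<in> nodes (SnocF a l c)" "v \<noteq> []" by simp_all
    then show "v \<in> ?N a \<union> ((#) (width a) ` ?N c \<union> (if Q l then {[width a]} else {}))"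
      by (cases rule: nodes_Snoc_cases) (use v in auto)
  next
    fix v assume "v \<in> ?N a \<union> ((#) (width a) ` ?N c \<union> (if Q l then {[width a]} else {}))"
    then show "v \<in> ?N (SnocF a l c)"
      using lab_Snoc_left[of v a l c] by (auto split: if_splits)
  qed
  also have "card \<dots> = card (?N a) + card ((#) (width a) ` ?N c \<union> (if Q l then {[width a]} else {}))"
    by (rule card_Un_disjoint) (auto simp: finite_nodes split: if_splits)
  also have "card ((#) (width a) ` ?N c \<union> (if Q l then {[width a]} else {})) = card ((#) (width a) ` ?N c) + (if Q l then 1 else 0)"
    by (subst card_Un_disjoint) (auto simp: finite_nodes)
  also have "card ((#) (width a) ` ?N c) = card (?N c)" by (rule card_image) simp
  finally show ?case using SnocF by simp
qed simp

text \<open>A sum up to \<open>n\<close> has both summands up to \<open>n\<close>, where the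
  predicates determine them. All larger counts fall into one state, in which every predicate is
  false.\<close>

lemma compositional_count: "compositional ((\<lambda>k h. count_labels Q h = k) ` {..n})"
  unfolding compositional_def
proof (intro ballI allI impI)
  fix p a a' c c' and l :: 'a
  assume p: "p \<in> (\<lambda>k h. count_labels Q h = k) ` {..n}"
    and 1: "\<forall>q\<in>(\<lambda>k h. count_labels Q h = k) ` {..n}. q a = q a'" and 2: "\<forall>q\<in>(\<lambda>k h. count_labels Q h = k) ` {..n}. q c = q c'"
  from p obtain k where k: "k \<le> n" "p = (\<lambda>h. count_labels Q h = k)" by auto
  have a: "count_labels Q a = i \<longleftrightarrow> count_labels Q a' = i" if "i \<le> n" for i using 1 that by simp
  have c: "count_labels Q c = i \<longleftrightarrow> count_labels Q c' = i" if "i \<le> n" for i using 2 that by simp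
  show "p (SnocF a l c) = p (SnocF a' l c')"
    using a[of "count_labels Q a"] a[of "count_labels Q a'"] c[of "count_labels Q c"] c[of "count_labels Q c'"] k(1) by (auto simp: k(2))
qed

text \<open>
  A morphism \<open>\<phi>\<close> out of \<open>ftree f\<close> is recorded by decorating every node \<open>v \<noteq> []\<close> with the images of the
  edge \<open>v\<close> and of its lower end; edges sent to vertices are those whose first decoration is an \<open>Inl\<close>.
\<close>

definition dec :: "'s forest \<Rightarrow> (nat list + nat list \<Rightarrow> 'd) \<Rightarrow> ('s \<times> 'd \<times> 'd) forest" where
  "dec f \<phi> = decorate f (\<lambda>v. (\<phi> (Inr v), \<phi> (Inl v)))"

text \<open>The argument \<open>p\<close> is the value at the vertex above the forest; for the root
  this value is stored in no node. Requiring each vertex value to lie in \<open>Z\<close> keeps the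
  arguments of the recursive calls in \<open>Z\<close>, so a finite \<open>Z\<close> yields a finite
  automaton.\<close>

primrec consistent :: "('v + 'e) set \<Rightarrow> ('s \<times> ('v + 'e) \<times> ('v + 'e)) forest \<Rightarrow> ('v + 'e) \<Rightarrow> bool" where
  "consistent Z EmptyF p = True"
| "consistent Z (SnocF a l c) p = (consistent Z a p \<and> snd (snd l) \<in> Z \<and> consistent Z c (snd (snd l)) \<and>
     (isl (fst (snd l)) \<longrightarrow> fst (snd l) = p \<and> snd (snd l) = p))"

definition node_val :: "('s \<times> 'd \<times> 'd) forest \<Rightarrow> 'd \<Rightarrow> nat list \<Rightarrow> 'd" where
  "node_val h p v = (if v = [] then p else snd (snd (node_label h v)))"

lemma consistent_iff:
  "consistent Z h p \<longleftrightarrow> (\<forall>v\<in>nodes h. v \<noteq> [] \<longrightarrow> snd (snd (node_label h v)) \<in> Z \<and>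
     (isl (fst (snd (node_label h v))) \<longrightarrow>
       fst (snd (node_label h v)) = node_val h p (butlast v) \<and> snd (snd (node_label h v)) = node_val h p (butlast v)))"
proof (induction h arbitrary: p)
  case (SnocF a l c)
  let ?P = "\<lambda>h p v. snd (snd (node_label h v)) \<in> Z \<and> (isl (fst (snd (node_label h v))) \<longrightarrow>
       fst (snd (node_label h v)) = node_val h p (butlast v) \<and> snd (snd (node_label h v)) = node_val h p (butlast v))"
  let ?h = "SnocF a l c"
  have a: "?P ?h p v \<longleftrightarrow> ?P a p v" if v: "v \<in> nodes a" "v \<noteq> []" for v
  proof -
    have "node_val ?h p (butlast v) = node_val a p (butlast v)"
      using lab_Snoc_left[OF nodes_butlast[OF v(1)]] by (simp add: node_val_def del: node_label.simps)
    then show ?thesis using lab_Snoc_left[OF v] by (simp del: node_label.simps)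
  qed
  have c: "?P ?h p (width a # v) \<longleftrightarrow> ?P c (snd (snd l)) v" if v: "v \<in> nodes c" "v \<noteq> []" for v
    using that by (simp add: node_val_def)
  have l: "?P ?h p [width a] \<longleftrightarrow> snd (snd l) \<in> Z \<and> (isl (fst (snd l)) \<longrightarrow> fst (snd l) = p \<and> snd (snd l) = p)"
    by (simp add: node_val_def)
  have "(\<forall>v\<in>nodes ?h. v \<noteq> [] \<longrightarrow> ?P ?h p v) \<longleftrightarrow>
    (\<forall>v\<in>nodes a. v \<noteq> [] \<longrightarrow> ?P ?h p v) \<and> ?P ?h p [width a] \<and> (\<forall>v\<in>nodes c. v \<noteq> [] \<longrightarrow> ?P ?h p (width a # v))"
    by (rule ball_nodes_Snoc)
  also have "\<dots> \<longleftrightarrow> consistent Z ?h p"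
    using a c l SnocF.IH by auto
  finally show ?case by blast
qed simp

lemma compositional_consistent: "compositional ((\<lambda>p h. consistent Z h p) ` Z)"
  by (auto simp: compositional_def)

section \<open>A total order on morphisms that precomposition preserves\<close>

lemma first_difference:
  fixes c d :: "'x::linorder \<Rightarrow> nat"
  shows "sorted_wrt (<) xs \<Longrightarrow> map c xs < map d xs \<longleftrightarrow>
    (\<exists>v\<in>set xs. c v < d v \<and> (\<forall>u\<in>set xs. u < v \<longrightarrow> c u = d u))"
proof (induction xs)
  case (Cons x xs)
  have lt: "x < y" if "y \<in> set xs" for y using Cons.prems that by simp
  have IH: "map c xs < map d xs \<longleftrightarrow> (\<exists>v\<in>set xs. c v < d v \<and> (\<forall>u\<in>set xs. u < v \<longrightarrow> c u = d u))"
    using Cons by simp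
  show ?case
    using lt by (auto simp: IH dest: order.asym)
qed simp

lemma pt_hom_ftreeD:
  assumes "\<phi> \<in> pt_hom (ftree f) T'"
  shows "\<phi> \<in> elems (ftree f) \<rightarrow>\<^sub>E elems T'" "\<phi> (Inl []) = Inl (pt_root T')"
    "\<phi> ` Inl ` nodes f = Inl ` verts (pt_graph T')"
    "\<And>e. e \<in> nodes f \<Longrightarrow> e \<noteq> [] \<Longrightarrow> \<phi> ` Inl ` {butlast e, e} = Inl ` endpoints T' (\<phi> (Inr e))"
    "bij_betw \<phi> {z \<in> elems (ftree f). \<phi> z \<in> Inr ` arcs (pt_graph T')} (Inr ` arcs (pt_graph T'))"
  using assms ftree_arc[of _ f] unfolding pt_hom_def by simp_all

lemma pt_hom_ftree_eqI:
  assumes "\<phi> \<in> pt_hom (ftree f) T'" "\<psi> \<in> pt_hom (ftree f) T'"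
    and eq: "\<And>v. v \<in> nodes f \<Longrightarrow> v \<noteq> [] \<Longrightarrow> \<phi> (Inr v) = \<psi> (Inr v) \<and> \<phi> (Inl v) = \<psi> (Inl v)"
  shows "\<phi> = \<psi>"
proof (rule PiE_ext[OF pt_hom_ftreeD(1)[OF assms(1)] pt_hom_ftreeD(1)[OF assms(2)]])
  fix z assume z: "z \<in> elems (ftree f)"
  show "\<phi> z = \<psi> z"
  proof (cases z)
    case (Inl v)
    then show ?thesis
      using z eq[of v] pt_hom_ftreeD(2)[OF assms(1)] pt_hom_ftreeD(2)[OF assms(2)]
      by (cases "v = []") (simp_all add: elems_ftree)
  next
    case (Inr v)
    then show ?thesis using z eq[of v] by (simp add: elems_ftree)
  qed
qed

definition edge_code :: "(nat list + nat list \<Rightarrow> nat list + nat list) \<Rightarrow> nat list \<Rightarrow> nat" where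
  "edge_code \<phi> v = to_nat (\<phi> (Inr v), \<phi> (Inl v))"

text \<open>The nodes are listed in depth-first order, so keys are compared at the first node where
  the morphisms differ. Which of two different values counts as smaller is immaterial, hence an
  arbitrary injective code.\<close>

definition hom_key :: "'s forest \<Rightarrow> (nat list + nat list \<Rightarrow> nat list + nat list) \<Rightarrow> nat list" where
  "hom_key f \<phi> = map (edge_code \<phi>) (sorted_list_of_set (nodes f - {[]}))"

lemma edge_code_eq: "edge_code \<phi> u = edge_code \<psi> v \<longleftrightarrow> \<phi> (Inr u) = \<psi> (Inr v) \<and> \<phi> (Inl u) = \<psi> (Inl v)"
  by (simp add: edge_code_def)

lemma set_nodes_list: "set (sorted_list_of_set (nodes f - {[]})) = nodes f - {[]}"
  by (simp add: finite_nodes)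

lemma hom_key_less_iff:
  "hom_key f \<phi> < hom_key f \<psi> \<longleftrightarrow> (\<exists>v\<in>nodes f - {[]}. edge_code \<phi> v < edge_code \<psi> v \<and>
     (\<forall>u\<in>nodes f - {[]}. u < v \<longrightarrow> edge_code \<phi> u = edge_code \<psi> u))"
  unfolding hom_key_def by (subst first_difference) (simp_all add: finite_nodes)

lemma hom_key_inj:
  assumes "\<phi> \<in> pt_hom (ftree f) T'" "\<psi> \<in> pt_hom (ftree f) T'" "hom_key f \<phi> = hom_key f \<psi>"
  shows "\<phi> = \<psi>"
proof (rule pt_hom_ftree_eqI[OF assms(1,2)])
  fix v assume "v \<in> nodes f" "v \<noteq> []"
  moreover have "\<forall>v\<in>nodes f - {[]}. edge_code \<phi> v = edge_code \<psi> v"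
    using assms(3) unfolding hom_key_def map_eq_conv set_nodes_list .
  ultimately show "\<phi> (Inr v) = \<psi> (Inr v) \<and> \<phi> (Inl v) = \<psi> (Inl v)" by (simp add: edge_code_eq)
qed

text \<open>If the first difference is at \<open>v\<close>, then after composition it is at
  \<open>j v\<close>, with the same two values. For \<open>u < j v\<close> the value at
  \<open>u\<close> depends on \<open>anc u\<close> only; from \<open>j (anc u) \<le> u < j v\<close>
  it follows that \<open>anc u < v\<close>, where both morphisms agree.\<close>

lemma (in node_embedding) hom_key_compose:
  assumes root: "\<phi> (Inl []) = \<psi> (Inl [])" and less: "hom_key f \<phi> < hom_key f \<psi>"
  shows "hom_key g (compose (elems (ftree g)) \<phi> contract) < hom_key g (compose (elems (ftree g)) \<psi> contract)"
proof -
  let ?c = "\<lambda>\<phi>. compose (elems (ftree g)) \<phi> contract"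
  have c: "?c \<chi> (Inl u) = \<chi> (Inl (anc u))" "u \<noteq> [] \<Longrightarrow> ?c \<chi> (Inr u) = \<chi> (contract (Inr u))" if "u \<in> nodes g"
    for \<chi> :: "nat list + nat list \<Rightarrow> nat list + nat list" and u
    using that by (simp_all add: compose_def elems_ftree contract_Inl)
  from less obtain v where v: "v \<in> nodes f" "v \<noteq> []" "edge_code \<phi> v < edge_code \<psi> v"
    and before: "\<And>u. u \<in> nodes f \<Longrightarrow> u \<noteq> [] \<Longrightarrow> u < v \<Longrightarrow> edge_code \<phi> u = edge_code \<psi> u"
    unfolding hom_key_less_iff by blast
  have jv: "j v \<in> nodes g" "j v \<noteq> []" using v in_nodes j_Nil_iff by auto
  have code_j: "edge_code (?c \<chi>) (j v) = edge_code \<chi> v" for \<chi>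
    using jv v by (simp add: edge_code_eq c contract_j anc_j)
  have "edge_code (?c \<phi>) u = edge_code (?c \<psi>) u" if u: "u \<in> nodes g" "u \<noteq> []" "u < j v" for u
  proof -
    let ?a = "anc u"
    have a: "?a \<in> nodes f" by (rule anc_in_nodes)
    have "j ?a \<le> u" using prefix_anc[of u] by (auto simp: less_list_iff strict_prefix_def le_less)
    then have "j ?a < j v" using u(3) by simp
    then have "?a < v" using j_less[OF v(1) a] by (metis order.asym not_less_iff_gr_or_eq)
    then have eq: "?a \<noteq> [] \<Longrightarrow> \<phi> (Inr ?a) = \<psi> (Inr ?a)" "\<phi> (Inl ?a) = \<psi> (Inl ?a)"
      using before[OF a] root by (cases "?a = []"; simp add: edge_code_eq)+
    have "\<phi> (contract (Inr u)) = \<psi> (contract (Inr u))"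
      using u(1,2)
    proof (cases rule: edge_cases)
      case (1 w) then show ?thesis using eq by (simp add: anc_j)
    next
      case 2 then show ?thesis using eq by simp
    qed
    then show ?thesis using u eq by (simp add: edge_code_eq c)
  qed
  then show ?thesis
    unfolding hom_key_less_iff using jv v(3) code_j by (intro bexI[of _ "j v"]) auto
qed

section \<open>Which decorated forests come from morphisms\<close>

abbreviation is_edge_label :: "'s \<times> ('v + 'e) \<times> ('v + 'e) \<Rightarrow> bool" where
  "is_edge_label l \<equiv> \<not> isl (fst (snd l))"

lemma lab_dec: "v \<in> nodes f \<Longrightarrow> v \<noteq> [] \<Longrightarrow> node_label (dec f \<phi>) v = (node_label f v, \<phi> (Inr v), \<phi> (Inl v))"
  by (simp add: dec_def lab_decorate)

lemma nodes_dec [simp]: "nodes (dec f \<phi>) = nodes f" "size (dec f \<phi>) = size f" "map_forest fst (dec f \<phi>) = f"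
  by (simp_all add: dec_def)

lemma labels_dec:
  assumes "labels f \<subseteq> S" "\<phi> \<in> pt_hom (ftree f) T'"
  shows "labels (dec f \<phi>) \<subseteq> S \<times> elems T' \<times> elems T'"
  unfolding dec_def
  by (rule labels_decorate[OF assms(1)])
    (use PiE_mem[OF pt_hom_ftreeD(1)[OF assms(2)]] in \<open>auto simp: elems_ftree\<close>)

lemma dec_inj:
  assumes "\<phi> \<in> pt_hom (ftree f) T'" "\<psi> \<in> pt_hom (ftree g) T'" "dec f \<phi> = dec g \<psi>"
  shows "f = g \<and> \<phi> = \<psi>"
proof -
  have fg: "f = g" using nodes_dec(3)[of f \<phi>] nodes_dec(3)[of g \<psi>] assms(3) by simp
  have "\<phi> = \<psi>"
    by (rule pt_hom_ftree_eqI[OF assms(1)])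
      (use assms(2,3) lab_dec[of _ f \<phi>] lab_dec[of _ f \<psi>] in \<open>auto simp: fg\<close>)
  then show ?thesis using fg by simp
qed

lemma consistent_dec:
  assumes \<phi>: "\<phi> \<in> pt_hom (ftree f) T'"
  shows "consistent (elems T') (dec f \<phi>) (Inl (pt_root T'))"
  unfolding consistent_iff nodes_dec
proof (intro ballI impI conjI)
  fix v assume v: "v \<in> nodes f" "v \<noteq> []"
  show "snd (snd (node_label (dec f \<phi>) v)) \<in> elems T'"
    using v PiE_mem[OF pt_hom_ftreeD(1)[OF \<phi>], of "Inl v"] by (simp add: lab_dec elems_ftree)
  assume "isl (fst (snd (node_label (dec f \<phi>) v)))"
  then obtain x where x: "\<phi> (Inr v) = Inl x" using v by (auto simp: lab_dec isl_def)
  have "\<phi> ` Inl ` {butlast v, v} = {Inl x}" using pt_hom_ftreeD(4)[OF \<phi> v] x by simp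
  then have "\<phi> (Inl (butlast v)) = Inl x" "\<phi> (Inl v) = Inl x" by auto
  moreover have "node_val (dec f \<phi>) (Inl (pt_root T')) (butlast v) = \<phi> (Inl (butlast v))"
    using pt_hom_ftreeD(2)[OF \<phi>] lab_dec[of "butlast v" f \<phi>] nodes_butlast[OF v(1)] by (simp add: node_val_def)
  ultimately show "fst (snd (node_label (dec f \<phi>) v)) = node_val (dec f \<phi>) (Inl (pt_root T')) (butlast v)"
    "snd (snd (node_label (dec f \<phi>) v)) = node_val (dec f \<phi>) (Inl (pt_root T')) (butlast v)"
    using x v by (simp_all add: lab_dec)
qed

lemma count_dec:
  assumes \<phi>: "\<phi> \<in> pt_hom (ftree f) T'"
  shows "count_labels is_edge_label (dec f \<phi>) = card (arcs (pt_graph T'))"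
proof -
  let ?N = "{v \<in> nodes f. v \<noteq> [] \<and> \<not> isl (\<phi> (Inr v))}"
  have "{v \<in> nodes f. v \<noteq> [] \<and> is_edge_label (node_label (dec f \<phi>) v)} = ?N"
    using lab_dec[of _ f \<phi>] by auto
  then have "count_labels is_edge_label (dec f \<phi>) = card ?N" by (simp add: count_eq_card)
  also have "\<dots> = card (Inr ` ?N :: (nat list + nat list) set)" by (rule card_image[symmetric]) simp
  also have "Inr ` ?N = {z \<in> elems (ftree f). \<phi> z \<in> Inr ` arcs (pt_graph T')}"
  proof (intro equalityI subsetI)
    fix z :: "nat list + nat list" assume "z \<in> Inr ` ?N"
    then obtain v where v: "z = Inr v" "v \<in> nodes f" "v \<noteq> []" "\<not> isl (\<phi> (Inr v))" by blast
    then have z: "z \<in> elems (ftree f)" by (simp add: elems_ftree)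
    have "\<phi> z \<in> elems T'" by (rule PiE_mem[OF pt_hom_ftreeD(1)[OF \<phi>] z])
    then show "z \<in> {z \<in> elems (ftree f). \<phi> z \<in> Inr ` arcs (pt_graph T')}"
      using z v by (auto simp: elems_def)
  next
    fix z assume z: "z \<in> {z \<in> elems (ftree f). \<phi> z \<in> Inr ` arcs (pt_graph T')}"
    show "z \<in> Inr ` ?N"
    proof (cases z)
      case (Inl v)
      then have "\<phi> (Inl v) \<in> Inl ` verts (pt_graph T')"
        using z pt_hom_ftreeD(3)[OF \<phi>] by (auto simp: elems_ftree)
      then show ?thesis using z Inl by auto
    next
      case (Inr v)
      then show ?thesis using z by (auto simp: elems_ftree)
    qed
  qed
  also have "card \<dots> = card (Inr ` arcs (pt_graph T') :: (nat list + nat list) set)"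
    using bij_betw_same_card[OF pt_hom_ftreeD(5)[OF \<phi>]] .
  also have "\<dots> = card (arcs (pt_graph T'))" by (rule card_image) simp
  finally show ?thesis .
qed

text \<open>The embedding sends edges over edges of \<open>T'\<close> injectively to such edges, and
  the counts agree, so it hits all of them. Every other new node is contracted, and consistency then
  makes it inherit the value of its parent, which is how the contraction behaves.\<close>

lemma dec_lift:
  fixes h :: "('s \<times> (nat list + nat list) \<times> (nat list + nat list)) forest"
  assumes \<phi>: "\<phi> \<in> pt_hom (ftree f) T'" and embeds: "embeds (dec f \<phi>) h"
    and cons: "consistent Z h (Inl (pt_root T'))"
    and count_labels: "count_labels is_edge_label h = card (arcs (pt_graph T'))"
  defines "g \<equiv> map_forest fst h"
  shows "\<exists>j. node_embedding f g j \<and> (\<forall>v\<in>nodes f. v \<noteq> [] \<longrightarrow> node_label g (j v) = node_label f v) \<and>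
    h = dec g (compose (elems (ftree g)) \<phi> (node_embedding.contract f g j))"
proof -
  obtain j where j: "node_embedding (dec f \<phi>) h j" "\<forall>v\<in>nodes f. v \<noteq> [] \<longrightarrow> node_label h (j v) = node_label (dec f \<phi>) v"
    using embeds_imp_node_embedding[OF embeds] by auto
  have ng: "nodes g = nodes h" by (simp add: g_def)
  interpret node_embedding f g j using j(1) by (simp add: node_embedding_def ng)
  have lab_j: "node_label h (j v) = (node_label f v, \<phi> (Inr v), \<phi> (Inl v))" if "v \<in> nodes f" "v \<noteq> []" for v
    using j(2) lab_dec[OF that] that by simp
  have lab_g: "node_label g v = fst (node_label h v)" if "v \<in> nodes h" "v \<noteq> []" for v
    using lab_map_forest[OF that] by (simp add: g_def)
  let ?M = "\<lambda>h. {v \<in> nodes h. v \<noteq> [] \<and> is_edge_label (node_label h v)}"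
  have "j ` ?M (dec f \<phi>) \<subseteq> ?M h"
    using lab_j lab_dec[of _ f \<phi>] in_nodes j_Nil_iff by (auto simp: ng)
  moreover have "card (j ` ?M (dec f \<phi>)) = card (?M h)"
  proof -
    have "inj_on j (?M (dec f \<phi>))" by (rule inj_onI) (simp add: j_eq)
    then have "card (j ` ?M (dec f \<phi>)) = card (?M (dec f \<phi>))" by (rule card_image)
    then show ?thesis using count_dec[OF \<phi>] count_labels unfolding count_eq_card by simp
  qed
  \<comment> \<open>An inclusion of finite sets of equal size, by the assumption on the
    count.\<close>
  ultimately have "j ` ?M (dec f \<phi>) = ?M h" by (intro card_subset_eq) (simp_all add: finite_nodes)
  then have other: "isl (fst (snd (node_label h v)))" if "v \<in> nodes h" "v \<noteq> []" "v \<notin> j ` nodes f" for v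
    using that by auto
  have cons': "fst (snd (node_label h v)) = node_val h (Inl (pt_root T')) (butlast v) \<and> snd (snd (node_label h v)) = node_val h (Inl (pt_root T')) (butlast v)"
    if "v \<in> nodes h" "v \<noteq> []" "isl (fst (snd (node_label h v)))" for v
    using cons that unfolding consistent_iff by blast
  \<comment> \<open>Induction down from the root: at an image node the decoration of
    \<open>f\<close> is read off, at any other node both the stored value and \<open>anc\<close> are
    those of the parent.\<close>
  have val: "node_val h (Inl (pt_root T')) v = \<phi> (Inl (anc v))" if "v \<in> nodes h" for v
    using that
  proof (induction v rule: rev_induct)
    case Nil
    then show ?case using pt_hom_ftreeD(2)[OF \<phi>] by (simp add: node_val_def anc_Nil)
  next
    case (snoc i v)
    let ?w = "v @ [i]"
    have w: "?w \<in> nodes g" "?w \<noteq> []" using snoc.prems ng by simp_all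
    then show ?case
    proof (cases rule: edge_cases)
      case (1 u)
      then show ?thesis using lab_j[of u] j_Nil_iff[of u] by (simp add: node_val_def anc_j)
    next
      case 2
      have "snd (snd (node_label h ?w)) = node_val h (Inl (pt_root T')) v"
        using cons'[OF snoc.prems w(2) other[OF snoc.prems w(2) 2(1)]] by simp
      also have "\<dots> = \<phi> (Inl (anc v))" using snoc nodes_snocD by blast
      also have "anc v = anc ?w" using anc_butlast[OF w(2) 2(1)] by simp
      finally show ?thesis by (simp add: node_val_def)
    qed
  qed
  let ?\<phi>' = "compose (elems (ftree g)) \<phi> contract"
  have "decorate g (\<lambda>v. (?\<phi>' (Inr v), ?\<phi>' (Inl v))) = h"
    unfolding g_def
  proof (rule decorate_map_fst, fold g_def)
    fix v assume v: "v \<in> nodes h" "v \<noteq> []"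
    then have vg: "v \<in> nodes g" by (simp add: ng)
    have 1: "?\<phi>' (Inl v) = \<phi> (Inl (anc v))" "?\<phi>' (Inr v) = \<phi> (contract (Inr v))"
      using vg v(2) by (simp_all add: compose_def elems_ftree contract_Inl)
    have 2: "snd (snd (node_label h v)) = \<phi> (Inl (anc v))" using val[OF v(1)] v(2) by (simp add: node_val_def)
    have 3: "fst (snd (node_label h v)) = \<phi> (contract (Inr v))"
      using vg v(2)
    proof (cases rule: edge_cases)
      case (1 u)
      then show ?thesis using lab_j[of u] by simp
    next
      case c: 2
      then show ?thesis using cons'[OF v other[OF v c(1)]] 2 by simp
    qed
    show "(?\<phi>' (Inr v), ?\<phi>' (Inl v)) = snd (node_label h v)" using 1 2 3 by (simp add: prod_eq_iff)
  qed
  then have "h = dec g ?\<phi>'" by (simp add: dec_def)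
  moreover have "node_label g (j v) = node_label f v" if "v \<in> nodes f" "v \<noteq> []" for v
    using lab_g[of "j v"] lab_j[OF that] in_nodes[OF that(1)] j_Nil_iff[OF that(1)] that(2) by (simp add: ng)
  ultimately show ?thesis using node_embedding_axioms by blast
qed

section \<open>Greedy bases\<close>

lemma (in vectorspace) span_insert_mono:
  assumes "A \<subseteq> carrier V" "B \<subseteq> carrier V" "v \<in> carrier V" "span A = span B"
  shows "span (insert v A) \<subseteq> span (insert v B)"
proof (rule span_is_subset)
  have vB: "insert v B \<subseteq> carrier V" using assms by simp
  have "A \<subseteq> span B" using in_own_span[OF assms(1)] assms(4) by simp
  also have "\<dots> \<subseteq> span (insert v B)" by (rule span_is_monotone) auto
  finally show "insert v A \<subseteq> span (insert v B)" using in_own_span[OF vB] by auto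
  show "submodule K (span (insert v B)) V" by (rule span_is_submodule[OF vB])
qed

text \<open>The keys belong to indices and not to vectors, so a vector that occurs several times can
  be standard only at its first occurrence.\<close>

definition (in vectorspace) standard :: "'g set \<Rightarrow> ('g \<Rightarrow> 'c) \<Rightarrow> ('g \<Rightarrow> 'o::linorder) \<Rightarrow> 'g \<Rightarrow> bool" where
  "standard G x key g \<longleftrightarrow> g \<in> G \<and> x g \<notin> span (x ` {h \<in> G. key h < key g})"

text \<open>Induction on initial segments by removing the largest index. What remains consists of
  all indices with smaller key, so standardness of the removed index is exactly independence from
  the vectors treated before.\<close>

lemma (in vectorspace) standard_initial_segment:
  fixes key :: "'g \<Rightarrow> 'o::linorder"
  assumes G: "finite G" "x \<in> G \<rightarrow> carrier V" "inj_on key G"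
  shows "D \<subseteq> G \<Longrightarrow> (\<And>g h. g \<in> D \<Longrightarrow> h \<in> G \<Longrightarrow> key h < key g \<Longrightarrow> h \<in> D) \<Longrightarrow>
    inj_on x {g \<in> D. standard G x key g} \<and> lin_indpt (x ` {g \<in> D. standard G x key g}) \<and>
    span (x ` {g \<in> D. standard G x key g}) = span (x ` D)"
proof (induction "card D" arbitrary: D)
  case 0
  then have "D = {}" using finite_subset[OF 0(2) G(1)] by simp
  then show ?case by (simp add: lin_dep_def)
next
  case (Suc n)
  let ?st = "standard G x key"
  have fin: "finite D" using Suc.prems(1) G(1) by (rule finite_subset)
  have "D \<noteq> {}" using Suc.hyps(2) by auto
  then have "Max (key ` D) \<in> key ` D" using fin by simp
  then obtain g where g: "g \<in> D" "key g = Max (key ` D)" by force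
  have max: "key h \<le> key g" if "h \<in> D" for h using fin that g(2) by simp
  define D' where "D' = D - {g}"
  have D': "D' = {h \<in> G. key h < key g}"
  proof (intro equalityI subsetI)
    fix h assume h: "h \<in> D'"
    then have "h \<in> G" "g \<in> G" "h \<noteq> g" using Suc.prems(1) g(1) by (auto simp: D'_def)
    then have "key h \<noteq> key g" using inj_onD[OF G(3)] by blast
    then show "h \<in> {h \<in> G. key h < key g}" using max[of h] h \<open>h \<in> G\<close> by (simp add: D'_def)
  next
    fix h assume "h \<in> {h \<in> G. key h < key g}"
    then show "h \<in> D'" using Suc.prems(2)[OF g(1)] by (auto simp: D'_def)
  qed
  have D: "D = insert g D'" using g(1) by (auto simp: D'_def)
  have "n = card D'" using Suc.hyps(2) fin g(1) by (simp add: D'_def)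
  moreover have "D' \<subseteq> G" by (auto simp: D')
  moreover have "h \<in> D'" if "k \<in> D'" "h \<in> G" "key h < key k" for h k using that by (auto simp: D')
  ultimately have IH: "inj_on x {g \<in> D'. ?st g}" "lin_indpt (x ` {g \<in> D'. ?st g})"
    "span (x ` {g \<in> D'. ?st g}) = span (x ` D')"
    using Suc.hyps(1)[of D'] by blast+
  have car: "x ` D' \<subseteq> carrier V" "x ` {g \<in> D'. ?st g} \<subseteq> carrier V" "x g \<in> carrier V"
    using G(2) Suc.prems(1) g(1) by (auto simp: D'_def)
  show ?case
  proof (cases "?st g")
    case True
    then have S: "{h \<in> D. ?st h} = insert g {h \<in> D'. ?st h}" by (auto simp: D)
    have out: "x g \<notin> span (x ` {g \<in> D'. ?st g})" using True IH(3) by (simp add: standard_def D')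
    then have new: "x g \<notin> x ` {g \<in> D'. ?st g}" using in_own_span[OF car(2)] by blast
    have "lin_indpt (insert (x g) (x ` {g \<in> D'. ?st g}))"
      using lin_dep_iff_in_span[OF car(2) IH(2) car(3) new] out by simp
    moreover have "span (insert (x g) (x ` {g \<in> D'. ?st g})) = span (insert (x g) (x ` D'))"
      using span_insert_mono[OF car(1,2,3)] span_insert_mono[OF car(2,1,3)] IH(3) by auto
    moreover have "inj_on x (insert g {h \<in> D'. ?st h})" using IH(1) new by auto
    ultimately show ?thesis unfolding S by (simp add: D)
  next
    case False
    then have S: "{h \<in> D. ?st h} = {h \<in> D'. ?st h}" by (auto simp: D)
    have "x g \<in> span (x ` D')" using False g(1) Suc.prems(1) by (auto simp: standard_def D')
    then have "span (x ` D) = span (x ` D')" using already_in_span[OF car(1)] by (simp add: D)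
    then show ?thesis unfolding S using IH by simp
  qed
qed

lemma (in vectorspace) dim_eq_card_standard:
  fixes key :: "'g \<Rightarrow> 'o::linorder"
  assumes G: "finite G" "x \<in> G \<rightarrow> carrier V" "inj_on key G" "span (x ` G) = carrier V"
  shows "dim = card {g. standard G x key g}"
proof -
  have S: "{g \<in> G. standard G x key g} = {g. standard G x key g}" by (auto simp: standard_def)
  have *: "inj_on x {g. standard G x key g}" "lin_indpt (x ` {g. standard G x key g})"
    "span (x ` {g. standard G x key g}) = span (x ` G)"
    using standard_initial_segment[OF G(1-3), of G] unfolding S by auto
  have "x ` {g. standard G x key g} \<subseteq> carrier V" using G(2) unfolding S[symmetric] by auto
  then have "basis (x ` {g. standard G x key g})" using * G(4) by (simp add: basis_def)
  moreover have "finite (x ` {g. standard G x key g})" using G(1) unfolding S[symmetric] by simp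
  ultimately show ?thesis using dim_basis card_image[OF *(1)] by simp
qed

text \<open>The vectors that \<open>T\<close> maps into the span of the image of \<open>A\<close>
  form a submodule containing \<open>A\<close>.\<close>

lemma linear_map_span:
  assumes "linear_map K V W T" "A \<subseteq> carrier V" "v \<in> LinearCombinations.module.span K V A"
  shows "T v \<in> LinearCombinations.module.span K W (T ` A)"
proof -
  interpret linear_map K V W T by (rule assms(1))
  have TA: "T ` A \<subseteq> carrier W" using assms(2) by auto
  interpret N: submodule K "W.module.span (T ` A)" W by (rule W.module.span_is_submodule[OF TA])
  let ?N = "{v \<in> carrier V. T v \<in> W.module.span (T ` A)}"
  have "submodule K ?N V"
  proof (unfold_locales)
    show "?N \<subseteq> carrier V" by auto
    show "v \<oplus>\<^bsub>V\<^esub> w \<in> ?N" if "v \<in> ?N" "w \<in> ?N" for v w using that by simp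
    show "\<zero>\<^bsub>V\<^esub> \<in> ?N" by simp
    show "c \<odot>\<^bsub>V\<^esub> v \<in> ?N" if "c \<in> carrier K" "v \<in> ?N" for c v using that by simp
  qed
  moreover have "A \<subseteq> ?N" using assms(2) W.module.in_own_span[OF TA] by auto
  ultimately have "V.module.span A \<subseteq> ?N" by (intro V.module.span_is_subset)
  then show ?thesis using assms(3) by blast
qed

section \<open>The Hilbert--Dyck series\<close>

text \<open>The choices behind finite generation, made once: generating objects \<open>Ts\<close>, a
  finite spanning set \<open>B T'\<close> of each generating space, and a numbering
  \<open>\<kappa>\<close> of the pairs of an object and a spanning vector.\<close>

locale generated_module = PG_op_module S K M act
  for S :: "'s set" and K :: "('k, 'd) ring_scheme"
    and M :: "(nat list, nat list, 's) planar_tree \<Rightarrow> ('k, 'm) module"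
    and act :: "(nat list, nat list, 's) planar_tree \<Rightarrow> (nat list, nat list, 's) planar_tree
      \<Rightarrow> (nat list + nat list \<Rightarrow> nat list + nat list) \<Rightarrow> 'm \<Rightarrow> 'm" +
  fixes Ts :: "(nat list, nat list, 's) planar_tree set"
    and B :: "(nat list, nat list, 's) planar_tree \<Rightarrow> 'm set"
    and \<kappa> :: "(nat list, nat list, 's) planar_tree \<times> 'm \<Rightarrow> nat"
  assumes finite_S: "finite S"
    and finite_Ts: "finite Ts" and planar_Ts: "T' \<in> Ts \<Longrightarrow> planar_tree S T'"
    and B: "T' \<in> Ts \<Longrightarrow> finite (B T') \<and> B T' \<subseteq> carrier (M T') \<and>
      LinearCombinations.module.span K (M T') (B T') = carrier (M T')"
    and gen: "planar_tree S T \<Longrightarrow> LinearCombinations.module.span K (M T)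
      (\<Union>T' \<in> Ts. \<Union>\<phi> \<in> pt_hom T T'. act T T' \<phi> ` carrier (M T')) = carrier (M T)"
    and inj_\<kappa>: "inj_on \<kappa> (Sigma Ts B)"
begin

definition gens where
  "gens f = {(T', b, \<phi>). T' \<in> Ts \<and> b \<in> B T' \<and> \<phi> \<in> pt_hom (ftree f) T'}"

definition gen_vec where
  "gen_vec f = (\<lambda>(T', b, \<phi>). act (ftree f) T' \<phi> b)"

text \<open>Different pairs \<open>(T', b)\<close> are separated by \<open>\<kappa>\<close> before
  any morphisms are compared. Morphisms are thus compared only when they have the same target, and
  so agree at the root, as \<open>hom_key_compose\<close> demands.\<close>

definition gen_key :: "'s forest \<Rightarrow> _ \<Rightarrow> nat list" where
  "gen_key f = (\<lambda>(T', b, \<phi>). \<kappa> (T', b) # hom_key f \<phi>)"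

definition std_gen where
  "std_gen f g \<longleftrightarrow> vectorspace.standard K (M (ftree f)) (gens f) (gen_vec f) (gen_key f) g"

lemma finite_elems: "T' \<in> Ts \<Longrightarrow> finite (elems T')"
  using planar_Ts[of T']
  by (auto simp: planar_tree_def out_tree_def elems_def fin_digraph_def fin_digraph_axioms_def)

lemma finite_elems_ftree: "finite (elems (ftree f))"
  by (simp add: elems_def finite_nodes)

lemma finite_hom: "T' \<in> Ts \<Longrightarrow> finite (pt_hom (ftree f) T')"
  using finite_subset[of "pt_hom (ftree f) T'" "elems (ftree f) \<rightarrow>\<^sub>E elems T'"]
    finite_PiE[OF finite_elems_ftree, of f "\<lambda>_. elems T'"] finite_elems by (auto simp: pt_hom_def)

lemma gens_Sigma: "gens f = Sigma Ts (\<lambda>T'. B T' \<times> pt_hom (ftree f) T')"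
  by (auto simp: gens_def)

lemma finite_gens: "finite (gens f)"
  unfolding gens_Sigma using finite_Ts B finite_hom by (intro finite_SigmaI finite_cartesian_product) auto

lemma inj_gen_key: "inj_on (gen_key f) (gens f)"
proof (rule inj_onI)
  fix x y assume xy: "x \<in> gens f" "y \<in> gens f" and eq: "gen_key f x = gen_key f y"
  obtain T b \<phi> T' b' \<psi> where g: "x = (T, b, \<phi>)" "y = (T', b', \<psi>)" by (cases x; cases y)
  have "\<kappa> (T, b) = \<kappa> (T', b')" and k: "hom_key f \<phi> = hom_key f \<psi>" using eq by (simp_all add: gen_key_def g)
  then have "T = T'" "b = b'" using inj_onD[OF inj_\<kappa>, of "(T, b)" "(T', b')"] xy by (simp_all add: gens_def g)
  then show "x = y" using hom_key_inj[of \<phi> f T' \<psi>] k xy by (simp add: gens_def g)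
qed

context
  fixes f :: "'s forest"
  assumes f: "labels f \<subseteq> S"
begin

lemma planar_f: "planar_tree S (ftree f)" using f by (rule planar_ftree)

lemma gen_vec_closed: "gen_vec f \<in> gens f \<rightarrow> carrier (M (ftree f))"
proof clarify
  fix T' b \<phi> assume "(T', b, \<phi>) \<in> gens f"
  then have T': "T' \<in> Ts" and b: "b \<in> carrier (M T')" and \<phi>: "\<phi> \<in> pt_hom (ftree f) T'"
    using B by (auto simp: gens_def)
  interpret linear_map K "M T'" "M (ftree f)" "act (ftree f) T' \<phi>"
    using linear[OF planar_f planar_Ts[OF T'] \<phi>] .
  show "gen_vec f (T', b, \<phi>) \<in> carrier (M (ftree f))" using b by (simp add: gen_vec_def)
qed

lemma span_gen_vec:
  "LinearCombinations.module.span K (M (ftree f)) (gen_vec f ` gens f) = carrier (M (ftree f))"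
proof -
  interpret V: vectorspace K "M (ftree f)" using vectorspace[OF planar_f] .
  have car: "gen_vec f ` gens f \<subseteq> carrier (M (ftree f))" using gen_vec_closed by auto
  let ?X = "\<Union>T' \<in> Ts. \<Union>\<phi> \<in> pt_hom (ftree f) T'. act (ftree f) T' \<phi> ` carrier (M T')"
  have "act (ftree f) T' \<phi> y \<in> V.span (gen_vec f ` gens f)"
    if T': "T' \<in> Ts" and \<phi>: "\<phi> \<in> pt_hom (ftree f) T'" and y: "y \<in> carrier (M T')" for T' \<phi> y
  proof -
    have "act (ftree f) T' \<phi> y \<in> V.span (act (ftree f) T' \<phi> ` B T')"
      by (rule linear_map_span[OF linear[OF planar_f planar_Ts[OF T'] \<phi>]]) (use B[OF T'] y in auto)
    moreover have "act (ftree f) T' \<phi> ` B T' \<subseteq> gen_vec f ` gens f"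
    proof (rule image_subsetI)
      fix b assume "b \<in> B T'"
      then show "act (ftree f) T' \<phi> b \<in> gen_vec f ` gens f"
        using T' \<phi> by (intro image_eqI[of _ _ "(T', b, \<phi>)"]) (simp_all add: gen_vec_def gens_def)
    qed
    ultimately show ?thesis using V.span_is_monotone by blast
  qed
  then have "?X \<subseteq> V.span (gen_vec f ` gens f)" by blast
  then have "V.span ?X \<subseteq> V.span (gen_vec f ` gens f)"
    by (rule V.span_is_subset[OF _ V.span_is_submodule[OF car]])
  then show ?thesis using gen[OF planar_f] V.span_is_subset2[OF car] by simp
qed

lemma dim_eq_card_std: "vectorspace.dim K (M (ftree f)) = card {g. std_gen f g}"
  unfolding std_gen_def
  by (rule vectorspace.dim_eq_card_standard[OF vectorspace[OF planar_f] finite_gens gen_vec_closed inj_gen_key span_gen_vec])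

lemma std_gens: "std_gen f g \<Longrightarrow> g \<in> gens f"
  unfolding std_gen_def vectorspace.standard_def[OF vectorspace[OF planar_f]] by simp

end

text \<open>The map induced by the contraction is linear, by functoriality it takes the vector of a
  generator to the vector of the lifted generator, and lifting preserves the order strictly. So a
  dependence on smaller generators at \<open>f\<close> is carried to one at
  \<open>g\<close>.\<close>

lemma not_std_lift:
  assumes "node_embedding f g j" and node_label: "\<And>v. v \<in> nodes f \<Longrightarrow> v \<noteq> [] \<Longrightarrow> node_label g (j v) = node_label f v"
    and fS: "labels f \<subseteq> S" and gS: "labels g \<subseteq> S"
    and x: "(T', b, \<phi>) \<in> gens f" "\<not> std_gen f (T', b, \<phi>)"
  defines "\<phi>' \<equiv> compose (elems (ftree g)) \<phi> (node_embedding.contract f g j)"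
  shows "(T', b, \<phi>') \<in> gens g \<and> \<not> std_gen g (T', b, \<phi>')"
proof -
  interpret node_embedding f g j by (rule assms(1))
  let ?c = "\<lambda>\<phi>. compose (elems (ftree g)) \<phi> contract"
  let ?C = "\<lambda>(T', b, \<phi>). (T', b, ?c \<phi>)"
  let ?id = "restrict id (elems (ftree f))"
  note pf = planar_ftree[OF fS] and pg = planar_ftree[OF gS]
  have hom: "?c \<psi> \<in> pt_hom (ftree g) T''" if "\<psi> \<in> pt_hom (ftree f) T''" for \<psi> T''
    by (rule compose_contract_in_hom[OF that node_label])
  have "?c ?id = contract"
    by (rule ext) (simp add: compose_def contract_in_elems, simp add: contract_def)
  then have chom: "contract \<in> pt_hom (ftree g) (ftree f)" using hom[OF restrict_id_in_hom] by simp
  have C: "?C x \<in> gens g" if "x \<in> gens f" for x using that hom by (auto simp: gens_def)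
  have vec: "gen_vec g (?C x) = act (ftree g) (ftree f) contract (gen_vec f x)" if "x \<in> gens f" for x
  proof -
    obtain T'' b'' \<psi> where x: "x = (T'', b'', \<psi>)" by (cases x)
    then have "T'' \<in> Ts" "b'' \<in> carrier (M T'')" "\<psi> \<in> pt_hom (ftree f) T''"
      using that B by (auto simp: gens_def)
    then show ?thesis using act_comp[OF pg pf planar_Ts chom] by (simp add: x gen_vec_def)
  qed
  have key: "gen_key g (?C x) < gen_key g (?C y)" if hx: "x \<in> gens f" and hy: "y \<in> gens f" and hk: "gen_key f x < gen_key f y" for x y
  proof -
    obtain T1 b1 \<psi>1 T2 b2 \<psi>2 where xy: "x = (T1, b1, \<psi>1)" "y = (T2, b2, \<psi>2)" by (cases x; cases y)
    consider "\<kappa> (T1, b1) < \<kappa> (T2, b2)" | "\<kappa> (T1, b1) = \<kappa> (T2, b2)" "hom_key f \<psi>1 < hom_key f \<psi>2"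
      using hk by (auto simp: xy gen_key_def)
    then show ?thesis
    proof cases
      case 1 then show ?thesis by (simp add: xy gen_key_def)
    next
      case 2
      have "(T1, b1) = (T2, b2)" using inj_onD[OF inj_\<kappa> 2(1)] hx hy by (simp add: xy gens_def)
      then have "\<psi>1 (Inl []) = \<psi>2 (Inl [])"
        using hx hy pt_hom_ftreeD(2)[of \<psi>1 f T1] pt_hom_ftreeD(2)[of \<psi>2 f T2] by (simp add: xy gens_def)
      from hom_key_compose[OF this 2(2)] show ?thesis using 2(1) by (simp add: xy gen_key_def)
    qed
  qed
  let ?x = "(T', b, \<phi>)"
  let ?L = "{h \<in> gens f. gen_key f h < gen_key f ?x}"
  interpret V: vectorspace K "M (ftree f)" using vectorspace[OF pf] .
  interpret W: vectorspace K "M (ftree g)" using vectorspace[OF pg] .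
  have "gen_vec f ?x \<in> V.span (gen_vec f ` ?L)"
    using x unfolding std_gen_def V.standard_def by blast
  moreover have "gen_vec f ` ?L \<subseteq> carrier (M (ftree f))" using gen_vec_closed[OF fS] by auto
  ultimately have "act (ftree g) (ftree f) contract (gen_vec f ?x)
      \<in> W.span (act (ftree g) (ftree f) contract ` gen_vec f ` ?L)"
    by (intro linear_map_span[OF linear[OF pg pf chom]])
  moreover have "act (ftree g) (ftree f) contract ` gen_vec f ` ?L \<subseteq> gen_vec g ` {h \<in> gens g. gen_key g h < gen_key g (?C ?x)}"
    unfolding image_image
  proof (rule image_subsetI)
    fix h assume "h \<in> ?L"
    then have h: "h \<in> gens f" "gen_key f h < gen_key f ?x" by simp_all
    then show "act (ftree g) (ftree f) contract (gen_vec f h) \<in> gen_vec g ` {h \<in> gens g. gen_key g h < gen_key g (?C ?x)}"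
      using C[OF h(1)] vec[OF h(1)] key[OF h(1) x(1) h(2)] by (intro image_eqI[of _ _ "?C h"]) simp_all
  qed
  ultimately have "act (ftree g) (ftree f) contract (gen_vec f ?x)
      \<in> W.span (gen_vec g ` {h \<in> gens g. gen_key g h < gen_key g (?C ?x)})"
    by (meson W.span_is_monotone subsetD)
  then have "gen_vec g (?C ?x) \<in> W.span (gen_vec g ` {h \<in> gens g. gen_key g h < gen_key g (?C ?x)})"
    using vec[OF x(1)] by simp
  then have "\<not> std_gen g (?C ?x)" unfolding std_gen_def W.standard_def by blast
  then show ?thesis using C[OF x(1)] by (simp add: \<phi>'_def)
qed

text \<open>One alphabet for all generating objects, so that all the automata run on the same
  forests.\<close>

definition all_labels where
  "all_labels = S \<times> (\<Union>T'\<in>Ts. elems T') \<times> (\<Union>T'\<in>Ts. elems T')"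

lemma finite_all_labels: "finite all_labels"
  unfolding all_labels_def using finite_S finite_Ts finite_elems by auto

definition valid where
  "valid T' = {dec f \<phi> | f \<phi>. labels f \<subseteq> S \<and> \<phi> \<in> pt_hom (ftree f) T'}"

definition std_dec where
  "std_dec T' b = {dec f \<phi> | f \<phi>. labels f \<subseteq> S \<and> std_gen f (T', b, \<phi>)}"

lemma labels_valid: "T' \<in> Ts \<Longrightarrow> h \<in> valid T' \<Longrightarrow> labels h \<subseteq> all_labels"
  unfolding valid_def all_labels_def using labels_dec by fastforce

text \<open>Among the forests that pass the two tests, those coming from morphisms form an upward
  closed set, and so do those coming from nonstandard generators. For the latter, injectivity of
  \<open>dec\<close> rules out a second reading of \<open>h\<close> as a standard generator.\<close>

lemma valid_lift:
  assumes "T' \<in> Ts" "b \<in> B T'" and m: "m \<in> valid T'" "embeds m h" and h: "labels h \<subseteq> all_labels"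
    and cons: "consistent (elems T') h (Inl (pt_root T'))"
    and count_labels: "count_labels is_edge_label h = card (arcs (pt_graph T'))"
  shows "h \<in> valid T'" and "m \<notin> std_dec T' b \<Longrightarrow> h \<notin> std_dec T' b"
proof -
  obtain f \<phi> where f: "m = dec f \<phi>" "labels f \<subseteq> S" "\<phi> \<in> pt_hom (ftree f) T'" using m(1) by (auto simp: valid_def)
  define g where "g = map_forest fst h"
  have g: "labels g \<subseteq> S" using h by (force simp: g_def forest.set_map all_labels_def)
  obtain j where j: "node_embedding f g j" "\<And>v. v \<in> nodes f \<Longrightarrow> v \<noteq> [] \<Longrightarrow> node_label g (j v) = node_label f v"
    "h = dec g (compose (elems (ftree g)) \<phi> (node_embedding.contract f g j))"
    using dec_lift[OF f(3) m(2)[unfolded f(1)] cons count_labels] unfolding g_def by blast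
  let ?\<phi>' = "compose (elems (ftree g)) \<phi> (node_embedding.contract f g j)"
  have hom: "?\<phi>' \<in> pt_hom (ftree g) T'" by (rule node_embedding.compose_contract_in_hom[OF j(1) f(3) j(2)])
  then show "h \<in> valid T'" using j(3) g unfolding valid_def by blast
  assume ns: "m \<notin> std_dec T' b"
  have "(T', b, \<phi>) \<in> gens f" using assms(1,2) f(3) by (simp add: gens_def)
  moreover have "\<not> std_gen f (T', b, \<phi>)" using ns f unfolding std_dec_def by blast
  ultimately have nst: "\<not> std_gen g (T', b, ?\<phi>')" using not_std_lift[OF j(1,2) f(2) g] by blast
  show "h \<notin> std_dec T' b"
  proof
    assume "h \<in> std_dec T' b"
    then obtain g' \<psi> where g': "h = dec g' \<psi>" "labels g' \<subseteq> S" "std_gen g' (T', b, \<psi>)" by (auto simp: std_dec_def)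
    then have "\<psi> \<in> pt_hom (ftree g') T'" using std_gens[OF g'(2,3)] by (simp add: gens_def)
    from dec_inj[OF this hom] have "g' = g" "\<psi> = ?\<phi>'" using g'(1) j(3) by simp_all
    then show False using g'(3) nst by simp
  qed
qed

text \<open>The standard forests are the difference of two sets that are upward closed among the
  consistent forests with the right number of edges. Each is described by a finite basis,
  \<open>Y\<close> for all morphisms and \<open>Y'\<close> for the nonstandard ones.\<close>

lemma std_dec_recognizable:
  assumes T': "T' \<in> Ts" "b \<in> B T'"
  shows "\<exists>P A. finite P \<and> compositional P \<and> (\<forall>h h'. (\<forall>p\<in>P. p h = p h') \<longrightarrow> A h = A h') \<and>
    (\<forall>h. labels h \<subseteq> all_labels \<longrightarrow> (h \<in> std_dec T' b \<longleftrightarrow> A h))"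
proof -
  let ?V = "valid T'" and ?N = "valid T' - std_dec T' b"
  have "\<exists>Y. finite Y \<and> Y \<subseteq> ?V \<and> (\<forall>h\<in>?V. \<exists>m\<in>Y. embeds m h)"
    by (rule embeds_finite_basis[OF finite_all_labels labels_valid[OF T'(1)]])
  then obtain Y where Y: "finite Y" "Y \<subseteq> ?V" "\<forall>h\<in>?V. \<exists>m\<in>Y. embeds m h" by (elim exE conjE)
  have "\<exists>Y. finite Y \<and> Y \<subseteq> ?N \<and> (\<forall>h\<in>?N. \<exists>m\<in>Y. embeds m h)"
    by (rule embeds_finite_basis[OF finite_all_labels]) (use labels_valid[OF T'(1)] in simp)
  then obtain Y' where Y': "finite Y'" "Y' \<subseteq> ?N" "\<forall>h\<in>?N. \<exists>m\<in>Y'. embeds m h" by (elim exE conjE)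
  let ?root = "Inl (pt_root T')" and ?n = "card (arcs (pt_graph T'))"
  define A where "A h \<longleftrightarrow> (\<exists>m\<in>Y. embeds m h) \<and> consistent (elems T') h ?root \<and>
    count_labels is_edge_label h = ?n \<and> \<not> (\<exists>m\<in>Y'. embeds m h)" for h
  \<comment> \<open>The tests occurring in \<open>A\<close> together with all those that their
    recursions call: subforests of the basis elements, other values above the forest, and smaller
    counts.\<close>
  define P where "P = (\<Union>m\<in>Y \<union> Y'. embeds ` subforests m) \<union>
    ((\<lambda>p h. consistent (elems T') h p) ` elems T' \<union> (\<lambda>k h. count_labels is_edge_label h = k) ` {..?n})"
  have "finite P" using Y(1) Y'(1) finite_subforests finite_elems[OF T'(1)] by (auto simp: P_def)
  moreover have "compositional P"
    unfolding P_def
    by (intro compositional_Un compositional_UN compositional_embeds compositional_consistent compositional_count)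
  moreover have "A h = A h'" if P: "\<forall>p\<in>P. p h = p h'" for h h'
  proof -
    have "embeds m h = embeds m h'" if "m \<in> Y \<union> Y'" for m
    proof -
      have "embeds m \<in> P" using that subforests_self[of m] by (auto simp: P_def)
      then show ?thesis using P by blast
    qed
    moreover have root: "?root \<in> elems T'"
      using planar_Ts[OF T'(1)] by (simp add: planar_tree_def out_tree_def elems_def InlI)
    have "(\<lambda>h. consistent (elems T') h ?root) \<in> P"
      unfolding P_def by (rule UnI2, rule UnI1, rule imageI[where f = "\<lambda>p h. consistent (elems T') h p", OF root])
    then have "consistent (elems T') h ?root = consistent (elems T') h' ?root" using P by (rule bspec[rotated])
    moreover have "(\<lambda>h. count_labels is_edge_label h = ?n) \<in> P"
      unfolding P_def by (rule UnI2, rule UnI2, rule imageI[where f = "\<lambda>k h. count_labels is_edge_label h = k"]) simp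
    then have "(count_labels is_edge_label h = ?n) = (count_labels is_edge_label h' = ?n)" using P by (rule bspec[rotated])
    ultimately show ?thesis unfolding A_def by auto
  qed
  moreover have "h \<in> std_dec T' b \<longleftrightarrow> A h" if h: "labels h \<subseteq> all_labels" for h
  proof
    assume s: "h \<in> std_dec T' b"
    then obtain f \<phi> where f: "h = dec f \<phi>" "labels f \<subseteq> S" "std_gen f (T', b, \<phi>)" by (auto simp: std_dec_def)
    then have \<phi>: "\<phi> \<in> pt_hom (ftree f) T'" using std_gens[OF f(2,3)] by (simp add: gens_def)
    have c: "consistent (elems T') h ?root" "count_labels is_edge_label h = ?n"
      unfolding f(1) using consistent_dec[OF \<phi>] count_dec[OF \<phi>] by blast+
    have "h \<in> ?V" using f \<phi> by (auto simp: valid_def)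
    moreover have "\<not> embeds m h" if "m \<in> Y'" for m
      using valid_lift(2)[OF T' _ _ h c, of m] that Y'(2) s by blast
    ultimately show "A h" unfolding A_def using c Y(3) by blast
  next
    assume A: "A h"
    then obtain m where "m \<in> Y" "embeds m h" by (auto simp: A_def)
    then have "h \<in> ?V" using valid_lift(1)[OF T' _ _ h, of m] A Y(2) by (auto simp: A_def)
    then show "h \<in> std_dec T' b" using A Y'(3) by (auto simp: A_def)
  qed
  ultimately show ?thesis by blast
qed

text \<open>As \<open>dec\<close> is injective and keeps the size, pairs of a forest and a standard
  morphism can be counted as forests over the larger alphabet.\<close>

lemma card_std_dec:
  assumes T': "T' \<in> Ts"
  shows "(\<Sum>f\<in>forests S n. card {\<phi>. std_gen f (T', b, \<phi>)}) = card (std_dec T' b \<inter> forests all_labels n)"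
proof -
  let ?A = "Sigma (forests S n) (\<lambda>f. {\<phi>. std_gen f (T', b, \<phi>)})"
  have hom: "\<phi> \<in> pt_hom (ftree f) T'" if "labels f \<subseteq> S" "std_gen f (T', b, \<phi>)" for f \<phi>
    using std_gens[OF that] by (simp add: gens_def)
  have fin: "finite {\<phi>. std_gen f (T', b, \<phi>)}" if "f \<in> forests S n" for f
    using finite_subset[OF _ finite_hom[OF T', of f], of "{\<phi>. std_gen f (T', b, \<phi>)}"] hom that by (auto simp: forests_def)
  have "(\<Sum>f\<in>forests S n. card {\<phi>. std_gen f (T', b, \<phi>)}) = card ?A"
    by (rule card_SigmaI[symmetric]) (use fin finite_forests[OF finite_S] in auto)
  also have "\<dots> = card ((\<lambda>(f, \<phi>). dec f \<phi>) ` ?A)"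
  proof (rule card_image[symmetric], rule inj_onI, clarify)
    fix f \<phi> g \<psi> assume "f \<in> forests S n" "std_gen f (T', b, \<phi>)" "g \<in> forests S n" "std_gen g (T', b, \<psi>)" "dec f \<phi> = dec g \<psi>"
    then show "f = g \<and> \<phi> = \<psi>" using hom dec_inj[of \<phi> f T' \<psi> g] by (simp add: forests_def)
  qed
  also have "(\<lambda>(f, \<phi>). dec f \<phi>) ` ?A = std_dec T' b \<inter> forests all_labels n"
  proof (intro equalityI subsetI)
    fix h assume "h \<in> (\<lambda>(f, \<phi>). dec f \<phi>) ` ?A"
    then obtain f \<phi> where f: "h = dec f \<phi>" "labels f \<subseteq> S" "size f = n" "std_gen f (T', b, \<phi>)" by (auto simp: forests_def)
    then have "h \<in> valid T'" using hom[OF f(2,4)] unfolding valid_def by blast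
    then show "h \<in> std_dec T' b \<inter> forests all_labels n"
      using f labels_valid[OF T'] by (auto simp: forests_def std_dec_def)
  next
    fix h assume "h \<in> std_dec T' b \<inter> forests all_labels n"
    then obtain f \<phi> where "h = dec f \<phi>" "labels f \<subseteq> S" "std_gen f (T', b, \<phi>)" "size f = n"
      by (auto simp: std_dec_def forests_def)
    then show "h \<in> (\<lambda>(f, \<phi>). dec f \<phi>) ` ?A" by (intro image_eqI[of _ _ "(f, \<phi>)"]) (simp_all add: forests_def)
  qed
  finally show ?thesis .
qed

theorem algebraic_hilbert_dyck: "algebraic_fps (hilbert_dyck S K M)"
proof -
  let ?I = "Sigma Ts B"
  have finI: "finite ?I" using finite_Ts B by auto
  define Q where "Q i P A \<longleftrightarrow> finite P \<and> compositional P \<and> (\<forall>h h'. (\<forall>p\<in>P. p h = p h') \<longrightarrow> A h = A h') \<and>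
    (\<forall>h. labels h \<subseteq> all_labels \<longrightarrow> (h \<in> std_dec (fst i) (snd i) \<longleftrightarrow> A h))" for i P A
  have "\<forall>i\<in>?I. \<exists>P. \<exists>A. Q i P A"
    unfolding Q_def using std_dec_recognizable by auto
  from bchoice[OF this] obtain P where "\<forall>i\<in>?I. \<exists>A. Q i (P i) A" by (elim exE)
  from bchoice[OF this] obtain A where "\<forall>i\<in>?I. Q i (P i) (A i)" by (elim exE)
  then have Q: "Q i (P i) (A i)" if "i \<in> ?I" for i using that by (rule bspec)
  have PA: "finite (P i)" "compositional (P i)" "(\<forall>p\<in>P i. p h = p h') \<Longrightarrow> A i h = A i h'"
    "labels h \<subseteq> all_labels \<Longrightarrow> h \<in> std_dec (fst i) (snd i) \<longleftrightarrow> A i h" if "i \<in> ?I" for i h h'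
    using Q[OF that] unfolding Q_def by blast+
  \<comment> \<open>A decorated forest may be standard for several pairs \<open>(T', b)\<close>, so
    forests are weighted by the number of these pairs.\<close>
  define W where "W h = (\<Sum>i\<in>?I. if A i h then 1 else 0 :: nat)" for h
  have dim: "(\<Sum>w \<in> {w \<in> dyck S. card (arcs (pt_graph (dyck_tree w))) = n}. vectorspace.dim K (M (dyck_tree w)))
    = (\<Sum>h\<in>forests all_labels n. W h)" for n
  proof -
    have "(\<Sum>w \<in> {w \<in> dyck S. card (arcs (pt_graph (dyck_tree w))) = n}. vectorspace.dim K (M (dyck_tree w)))
      = (\<Sum>f\<in>forests S n. vectorspace.dim K (M (dyck_tree (dyck_word f))))"
      unfolding dyck_edges by (rule sum.reindex_cong[of dyck_word]) (auto intro: inj_on_subset[OF inj_dyck_word])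
    also have "\<dots> = (\<Sum>f\<in>forests S n. \<Sum>i\<in>?I. card {\<phi>. std_gen f (fst i, snd i, \<phi>)})"
    proof (rule sum.cong[OF refl])
      fix f assume "f \<in> forests S n"
      then have f: "labels f \<subseteq> S" by (simp add: forests_def)
      have sub: "{\<phi>. std_gen f (fst i, snd i, \<phi>)} \<subseteq> pt_hom (ftree f) (fst i)" for i
        using std_gens[OF f] by (fastforce simp: gens_def)
      have fin: "finite {\<phi>. std_gen f (fst i, snd i, \<phi>)}" if "i \<in> ?I" for i
        using finite_subset[OF sub finite_hom] that by auto
      have "vectorspace.dim K (M (dyck_tree (dyck_word f))) = card {g. std_gen f g}"
        using dim_eq_card_std[OF f] dyck_tree_dyck_word[OF f] by simp
      also have "{g. std_gen f g} = (\<lambda>(i, \<phi>). (fst i, snd i, \<phi>)) ` Sigma ?I (\<lambda>i. {\<phi>. std_gen f (fst i, snd i, \<phi>)})"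
        using std_gens[OF f] by (force simp: gens_def)
      also have "card \<dots> = card (Sigma ?I (\<lambda>i. {\<phi>. std_gen f (fst i, snd i, \<phi>)}))"
        by (rule card_image) (auto simp: inj_on_def)
      also have "\<dots> = (\<Sum>i\<in>?I. card {\<phi>. std_gen f (fst i, snd i, \<phi>)})"
        by (rule card_SigmaI) (use finI fin in auto)
      finally show "vectorspace.dim K (M (dyck_tree (dyck_word f))) = (\<Sum>i\<in>?I. card {\<phi>. std_gen f (fst i, snd i, \<phi>)})" .
    qed
    also have "\<dots> = (\<Sum>i\<in>?I. card (std_dec (fst i) (snd i) \<inter> forests all_labels n))"
      by (subst sum.swap) (intro sum.cong refl card_std_dec, auto)
    also have "\<dots> = (\<Sum>i\<in>?I. \<Sum>h\<in>forests all_labels n. if A i h then 1 else 0)"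
    proof (rule sum.cong[OF refl])
      fix i assume i: "i \<in> ?I"
      have "std_dec (fst i) (snd i) \<inter> forests all_labels n = {h \<in> forests all_labels n. A i h}"
        using PA(4)[OF i] by (auto simp: forests_def)
      then show "card (std_dec (fst i) (snd i) \<inter> forests all_labels n) = (\<Sum>h\<in>forests all_labels n. if A i h then 1 else 0)"
        using finite_forests[OF finite_all_labels] by (simp add: sum.If_cases Int_def)
    qed
    also have "\<dots> = (\<Sum>h\<in>forests all_labels n. W h)" unfolding W_def by (rule sum.swap)
    finally show ?thesis .
  qed
  have "hilbert_dyck S K M = Abs_fps (\<lambda>n. of_nat (\<Sum>h\<in>forests all_labels n. W h))"
    unfolding hilbert_dyck_def dim[symmetric] by simp
  moreover have "algebraic_fps (Abs_fps (\<lambda>n. of_nat (\<Sum>h\<in>forests all_labels n. W h)))"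
  proof (rule algebraic_compositional_weight[OF finite_all_labels])
    \<comment> \<open>The automata for the individual pairs run in parallel; their product is the
      union of their predicates.\<close>
    show "finite (\<Union>i\<in>?I. P i)" using finI PA(1) by (rule finite_UN_I)
    show "compositional (\<Union>i\<in>?I. P i)" using PA(2) by (rule compositional_UN)
    fix h h' assume eq: "\<And>p. p \<in> (\<Union>i\<in>?I. P i) \<Longrightarrow> p h = p h'"
    have "A i h = A i h'" if "i \<in> ?I" for i
      by (rule PA(3)[OF that]) (use eq that in blast)
    then show "W h = W h'" unfolding W_def by (intro sum.cong) auto
  qed
  ultimately show ?thesis by simp
qed

end

theorem theorem4p4:
  fixes R :: "('a, 'b) ring_scheme"
    and S :: "'a set set"
    and K :: "('k, 'd) ring_scheme"
    and M :: "(nat list, nat list, 'a set) planar_tree \<Rightarrow> ('k, 'm) module"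
    and act :: "(nat list, nat list, 'a set) planar_tree \<Rightarrow> (nat list, nat list, 'a set) planar_tree
      \<Rightarrow> (nat list + nat list \<Rightarrow> nat list + nat list) \<Rightarrow> 'm \<Rightarrow> 'm"
  assumes "cring R" and "noetherian_ring R"
    and "finite S" and "\<forall>I \<in> S. ideal I R"
    and "field K"
    and "PG_op_module S K M act"
    and "PG_op_module.finitely_generated S K M act"
  shows "algebraic_fps (hilbert_dyck S K M)"
proof -
  interpret PG_op_module S K M act by (rule assms)
  obtain Ts where Ts: "finite Ts" "\<forall>T' \<in> Ts. planar_tree S T'"
    "\<And>T. planar_tree S T \<Longrightarrow> LinearCombinations.module.span K (M T)
      (\<Union>T' \<in> Ts. \<Union>\<phi> \<in> pt_hom T T'. act T T' \<phi> ` carrier (M T')) = carrier (M T)"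
    using assms(7) unfolding finitely_generated_def by blast
  have "\<forall>T'\<in>Ts. \<exists>B. finite B \<and> B \<subseteq> carrier (M T') \<and> LinearCombinations.module.span K (M T') B = carrier (M T')"
  proof
    fix T' assume "T' \<in> Ts"
    then have p: "planar_tree S T'" using Ts(2) by blast
    then show "\<exists>B. finite B \<and> B \<subseteq> carrier (M T') \<and> LinearCombinations.module.span K (M T') B = carrier (M T')"
      using fin_dim[OF p] unfolding vectorspace.fin_dim_def[OF vectorspace[OF p]] by blast
  qed
  then obtain B where B: "\<And>T'. T' \<in> Ts \<Longrightarrow> finite (B T') \<and> B T' \<subseteq> carrier (M T') \<and>
      LinearCombinations.module.span K (M T') (B T') = carrier (M T')" by metis
  have "finite (Sigma Ts B)" using Ts(1) B by auto
  \<comment> \<open>Any numbering serves, since precomposition changes only the morphism of a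
    generator and never its pair \<open>(T', b)\<close>.\<close>
  then obtain \<kappa> :: "_ \<Rightarrow> nat" where "inj_on \<kappa> (Sigma Ts B)" using finite_imp_inj_to_nat_seg by blast
  then interpret generated_module S K M act Ts B \<kappa>
    using assms(3) Ts B by unfold_locales auto
  show ?thesis by (rule algebraic_hilbert_dyck)
qed

end
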